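(* Let $G_\circ=(\mathscr{V},\mathscr{E}_\circ,m,\theta_\circ)$ be a weighted tree. Assume there is $\varepsilon_0\in(0,1)$ such that \[ C_0:=\sup_{x\in\mathscr{V}}\max_{y\in\mathscr{V}} d_{G_\circ}^{\varepsilon_0-1}(x)\,\mathscr{E}_\circ(x,y)\,m^{-2}(x)<\infty. \] Let $G=(\mathscr{V},\mathscr{E},m,\theta)$ be another weighted graph (same vertex set and same vertex weight $m$), and let $V:\mathscr{V}\to\mathbb{R}$ satisfy \[ |V(x)|+\Lambda(x)=o(1+d_{G_\circ}(x))\ \text{ as } |x|\to\infty,\qquad\text{where } \Lambda(x):=\frac{1}{m^2(x)}\sum_{y\sim x}|\mathscr{E}(x,y)-\mathscr{E}_\circ(x,y)|. \] Then: (a) The quadratic form $f\mapsto\langle f,(\Delta_{\mathscr{E},\theta}+V(Q))f\rangle$ on $\mathcal{C}_c(\mathscr{V})$ is bounded from below by some constant $-C$; let $H$ be the associated Friedrichs extension. (b) For every $\varepsilon>0$ there is $c_\varepsilon\ge0$ such that for all $f\in\mathcal{C}_c(\mathscr{V})$, \[ (1-\varepsilon)\langle f,d_{G_\circ}(Q)f\rangle-c_\varepsilon\|f\|^2\le\langle f,Hf\rangle\le(1+\varepsilon)\langle f,d_{G_\circ}(Q)f\rangle+c_\varepsilon\|f\|^2, \] and $\mathcal{D}((H+C)^{1/2})=\mathcal{D}(d_{G_\circ}(Q)^{1/2})$. (c) $\sigma_{\rm ess}(H)=\sigma_{\rm ess}(\Delta_{\mathscr{E}_\circ,\theta_\circ})$.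 (d) $\sigma_{\rm ess}(H)=\emptyset$ if and only if $\lim_{|x|\to\infty}d_{G_\circ}(x)=+\infty$; in this case \[ \lim_{N\to\infty}\frac{\lambda_N(H)}{\lambda_N(d_{G_\circ}(Q))}=1, \] where $\lambda_N$ denotes the $N$-th eigenvalue counted with multiplicity.
   Context: A weighted graph $G=(\mathscr{V},\mathscr{E},m,\theta)$: $\mathscr{V}$ countable, $\mathscr{E}:\mathscr{V}\times\mathscr{V}\to[0,\infty)$ symmetric, $m:\mathscr{V}\to(0,\infty)$, $\theta:\mathscr{V}\times\mathscr{V}\to[-\pi,\pi]$ antisymmetric; $x\sim y$ iff $\mathscr{E}(x,y)\ne0$. All graphs are assumed locally finite, connected, and without loops ($\mathscr{E}(x,x)=0$). A tree is such a graph in which removing any single edge disconnects the graph. Hilbert space $\ell^2(\mathscr{V},m^2)$ with $\langle f,g\rangle=\sum_x m^2(x)\overline{f(x)}g(x)$; $\mathcal{C}_c(\mathscr{V})$ = finitely supported functions. $\Delta_{\mathscr{E},\theta}$ is the Friedrichs extension of the form $\frac12\sum_{x,y}\mathscr{E}(x,y)|f(x)-e^{i\theta(x,y)}f(y)|^2$ on $\mathcal{C}_c(\mathscr{V})$; it acts on $\mathcal{C}_c(\mathscr{V})$ by $(\Delta_{\mathscr{E},\theta}f)(x)=m^{-2}(x)\sum_y\mathscr{E}(x,y)(f(x)-e^{i\theta(x,y)}f(y))$. Weighted degree $d_{G_\circ}(x)=m^{-2}(x)\sum_y\mathscr{E}_\circ(x,y)$. $W(Q)$ denotes multiplication by a function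 $W$. For a semibounded form on $\mathcal{C}_c(\mathscr{V})$, the Friedrichs extension is the self-adjoint operator associated with the closure of the form. "$|x|\to\infty$" means $x$ leaves every finite subset of $\mathscr{V}$. *)

theory Defs
  imports "HOL-Analysis.Analysis" "HOL-Library.Landau_Symbols"
begin

text \<open>A weighted graph on the vertex type 'v (countable): edge weight E, vertex weight m,
  magnetic potential th.  x ~ y iff E x y is nonzero.\<close>

definition adj :: "('v \<Rightarrow> 'v \<Rightarrow> real) \<Rightarrow> 'v \<Rightarrow> 'v \<Rightarrow> bool" where
  "adj E x y \<longleftrightarrow> E x y \<noteq> 0"

definition weighted_graph ::
  "('v \<Rightarrow> 'v \<Rightarrow> real) \<Rightarrow> ('v \<Rightarrow> real) \<Rightarrow> ('v \<Rightarrow> 'v \<Rightarrow> real) \<Rightarrow> bool" where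
  "weighted_graph E m th \<longleftrightarrow>
     (\<forall>x y. E x y = E y x) \<and> (\<forall>x y. 0 \<le> E x y) \<and> (\<forall>x. 0 < m x) \<and>
     (\<forall>x y. th x y = - th y x) \<and> (\<forall>x y. - pi \<le> th x y \<and> th x y \<le> pi) \<and>
     (\<forall>x. E x x = 0) \<and>
     (\<forall>x. finite {y. adj E x y}) \<and>
     (\<forall>x y. (adj E)\<^sup>*\<^sup>* x y)"

definition weighted_tree ::
  "('v \<Rightarrow> 'v \<Rightarrow> real) \<Rightarrow> ('v \<Rightarrow> real) \<Rightarrow> ('v \<Rightarrow> 'v \<Rightarrow> real) \<Rightarrow> bool" where
  "weighted_tree E m th \<longleftrightarrow> weighted_graph E m th \<and>
     (\<forall>a b. adj E a b \<longrightarrow>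
        (\<exists>x y. \<not> (\<lambda>u w. adj E u w \<and> {u, w} \<noteq> {a, b})\<^sup>*\<^sup>* x y))"

definition wdeg :: "('v \<Rightarrow> 'v \<Rightarrow> real) \<Rightarrow> ('v \<Rightarrow> real) \<Rightarrow> 'v \<Rightarrow> real" where
  "wdeg E m x = (\<Sum>y\<in>{y. adj E x y}. E x y) / (m x)\<^sup>2"

definition Lambda :: "('v \<Rightarrow> 'v \<Rightarrow> real) \<Rightarrow> ('v \<Rightarrow> 'v \<Rightarrow> real) \<Rightarrow> ('v \<Rightarrow> real) \<Rightarrow> 'v \<Rightarrow> real" where
  "Lambda E E0 m x = (\<Sum>y\<in>{y. adj E x y \<or> adj E0 x y}. \<bar>E x y - E0 x y\<bar>) / (m x)\<^sup>2"

definition Cc :: "('v \<Rightarrow> complex) set" where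
  "Cc = {f. finite {x. f x \<noteq> 0}}"

definition ell2 :: "('v \<Rightarrow> real) \<Rightarrow> ('v \<Rightarrow> complex) set" where
  "ell2 m = {f. (\<lambda>x. (m x)\<^sup>2 * (cmod (f x))\<^sup>2) summable_on UNIV}"

definition ell2_ip :: "('v \<Rightarrow> real) \<Rightarrow> ('v \<Rightarrow> complex) \<Rightarrow> ('v \<Rightarrow> complex) \<Rightarrow> complex" where
  "ell2_ip m f g = (\<Sum>\<^sub>\<infinity>x. complex_of_real ((m x)\<^sup>2) * (cnj (f x) * g x))"

definition ell2_norm :: "('v \<Rightarrow> real) \<Rightarrow> ('v \<Rightarrow> complex) \<Rightarrow> real" where
  "ell2_norm m f = sqrt (\<Sum>\<^sub>\<infinity>x. (m x)\<^sup>2 * (cmod (f x))\<^sup>2)"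

definition smul :: "complex \<Rightarrow> ('v \<Rightarrow> complex) \<Rightarrow> 'v \<Rightarrow> complex" where
  "smul c f = (\<lambda>x. c * f x)"

definition mlap :: "('v \<Rightarrow> 'v \<Rightarrow> real) \<Rightarrow> ('v \<Rightarrow> real) \<Rightarrow> ('v \<Rightarrow> 'v \<Rightarrow> real)
    \<Rightarrow> ('v \<Rightarrow> complex) \<Rightarrow> 'v \<Rightarrow> complex" where
  "mlap E m th f x =
     (\<Sum>y\<in>{y. adj E x y}. complex_of_real (E x y) * (f x - cis (th x y) * f y))
       / complex_of_real ((m x)\<^sup>2)"

definition schr_form :: "('v \<Rightarrow> 'v \<Rightarrow> real) \<Rightarrow> ('v \<Rightarrow> real) \<Rightarrow> ('v \<Rightarrow> 'v \<Rightarrow> real)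
    \<Rightarrow> ('v \<Rightarrow> real) \<Rightarrow> ('v \<Rightarrow> complex) \<Rightarrow> ('v \<Rightarrow> complex) \<Rightarrow> complex" where
  "schr_form E m th V f g =
     ell2_ip m f (\<lambda>x. mlap E m th g x + complex_of_real (V x) * g x)"

definition form_approx :: "('v \<Rightarrow> real) \<Rightarrow> (('v \<Rightarrow> complex) \<Rightarrow> ('v \<Rightarrow> complex) \<Rightarrow> complex)
    \<Rightarrow> (nat \<Rightarrow> 'v \<Rightarrow> complex) \<Rightarrow> ('v \<Rightarrow> complex) \<Rightarrow> bool" where
  "form_approx m s u f \<longleftrightarrow> (\<forall>n. u n \<in> Cc) \<and> f \<in> ell2 m \<and>
     (\<lambda>n. ell2_norm m (u n - f)) \<longlonglongrightarrow> 0 \<and>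
     (\<forall>e>0. \<exists>N. \<forall>n\<ge>N. \<forall>k\<ge>N. cmod (s (u n - u k) (u n - u k)) < e)"

definition form_dom :: "('v \<Rightarrow> real) \<Rightarrow> (('v \<Rightarrow> complex) \<Rightarrow> ('v \<Rightarrow> complex) \<Rightarrow> complex)
    \<Rightarrow> ('v \<Rightarrow> complex) set" where
  "form_dom m s = {f. \<exists>u. form_approx m s u f}"

definition form_closure_val :: "('v \<Rightarrow> real) \<Rightarrow> (('v \<Rightarrow> complex) \<Rightarrow> ('v \<Rightarrow> complex) \<Rightarrow> complex)
    \<Rightarrow> ('v \<Rightarrow> complex) \<Rightarrow> ('v \<Rightarrow> complex) \<Rightarrow> complex \<Rightarrow> bool" where
  "form_closure_val m s h f z \<longleftrightarrow>
     (\<exists>u w. form_approx m s u h \<and> form_approx m s w f \<and> (\<lambda>n. s (u n) (w n)) \<longlonglongrightarrow> z)"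

text \<open>Friedrichs extension: the operator associated with the closure of the form.
  An operator is represented by its graph: A f g means f in D(A) and A f = g.\<close>
definition friedrichs :: "('v \<Rightarrow> real) \<Rightarrow> (('v \<Rightarrow> complex) \<Rightarrow> ('v \<Rightarrow> complex) \<Rightarrow> complex)
    \<Rightarrow> ('v \<Rightarrow> complex) \<Rightarrow> ('v \<Rightarrow> complex) \<Rightarrow> bool" where
  "friedrichs m s f g \<longleftrightarrow> f \<in> form_dom m s \<and> g \<in> ell2 m \<and>
     (\<forall>h z. h \<in> form_dom m s \<longrightarrow> form_closure_val m s h f z \<longrightarrow> z = ell2_ip m h g)"

definition mult_op :: "('v \<Rightarrow> real) \<Rightarrow> ('v \<Rightarrow> real) \<Rightarrow> ('v \<Rightarrow> complex) \<Rightarrow> ('v \<Rightarrow> complex) \<Rightarrow> bool" where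
  "mult_op m W f g \<longleftrightarrow> f \<in> ell2 m \<and> g \<in> ell2 m \<and> g = (\<lambda>x. complex_of_real (W x) * f x)"

definition op_dom :: "(('v \<Rightarrow> complex) \<Rightarrow> ('v \<Rightarrow> complex) \<Rightarrow> bool) \<Rightarrow> ('v \<Rightarrow> complex) set" where
  "op_dom A = {f. \<exists>g. A f g}"

definition op_shift :: "(('v \<Rightarrow> complex) \<Rightarrow> ('v \<Rightarrow> complex) \<Rightarrow> bool) \<Rightarrow> real
    \<Rightarrow> ('v \<Rightarrow> complex) \<Rightarrow> ('v \<Rightarrow> complex) \<Rightarrow> bool" where
  "op_shift A c f g \<longleftrightarrow> A f (g - smul (complex_of_real c) f)"

definition op_adjoint :: "('v \<Rightarrow> real) \<Rightarrow> (('v \<Rightarrow> complex) \<Rightarrow> ('v \<Rightarrow> complex) \<Rightarrow> bool)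
    \<Rightarrow> ('v \<Rightarrow> complex) \<Rightarrow> ('v \<Rightarrow> complex) \<Rightarrow> bool" where
  "op_adjoint m A f g \<longleftrightarrow> f \<in> ell2 m \<and> g \<in> ell2 m \<and>
     (\<forall>u a. A u a \<longrightarrow> ell2_ip m a f = ell2_ip m u g)"

definition self_adjoint_op :: "('v \<Rightarrow> real) \<Rightarrow> (('v \<Rightarrow> complex) \<Rightarrow> ('v \<Rightarrow> complex) \<Rightarrow> bool) \<Rightarrow> bool" where
  "self_adjoint_op m A \<longleftrightarrow> (\<forall>f g. A f g \<longleftrightarrow> op_adjoint m A f g)"

definition op_sqrt :: "('v \<Rightarrow> real) \<Rightarrow> (('v \<Rightarrow> complex) \<Rightarrow> ('v \<Rightarrow> complex) \<Rightarrow> bool)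
    \<Rightarrow> (('v \<Rightarrow> complex) \<Rightarrow> ('v \<Rightarrow> complex) \<Rightarrow> bool) \<Rightarrow> bool" where
  "op_sqrt m S T \<longleftrightarrow> self_adjoint_op m S \<and> (\<forall>f g. S f g \<longrightarrow> 0 \<le> Re (ell2_ip m f g)) \<and>
     (\<forall>f g. T f g \<longleftrightarrow> (\<exists>h. S f h \<and> S h g))"

definition op_resolvent_set :: "('v \<Rightarrow> real) \<Rightarrow> (('v \<Rightarrow> complex) \<Rightarrow> ('v \<Rightarrow> complex) \<Rightarrow> bool)
    \<Rightarrow> complex set" where
  "op_resolvent_set m A = {l. (\<forall>g\<in>ell2 m. \<exists>!f. \<exists>a. A f a \<and> a - smul l f = g) \<and>
     (\<exists>K. \<forall>f a. A f a \<longrightarrow> ell2_norm m f \<le> K * ell2_norm m (a - smul l f))}"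

definition op_spectrum :: "('v \<Rightarrow> real) \<Rightarrow> (('v \<Rightarrow> complex) \<Rightarrow> ('v \<Rightarrow> complex) \<Rightarrow> bool)
    \<Rightarrow> complex set" where
  "op_spectrum m A = - op_resolvent_set m A"

text \<open>The eigenspace of l is infinite-dimensional iff it contains an infinite orthonormal sequence.\<close>
definition infinite_multiplicity :: "('v \<Rightarrow> real) \<Rightarrow> (('v \<Rightarrow> complex) \<Rightarrow> ('v \<Rightarrow> complex) \<Rightarrow> bool)
    \<Rightarrow> complex \<Rightarrow> bool" where
  "infinite_multiplicity m A l \<longleftrightarrow> (\<exists>F::nat \<Rightarrow> 'v \<Rightarrow> complex.
     (\<forall>i. A (F i) (smul l (F i))) \<and> (\<forall>i j. ell2_ip m (F i) (F j) = (if i = j then 1 else 0)))"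

text \<open>Essential spectrum (of a self-adjoint operator): spectrum minus the isolated
  eigenvalues of finite multiplicity.\<close>
definition op_ess_spectrum :: "('v \<Rightarrow> real) \<Rightarrow> (('v \<Rightarrow> complex) \<Rightarrow> ('v \<Rightarrow> complex) \<Rightarrow> bool)
    \<Rightarrow> complex set" where
  "op_ess_spectrum m A = {l \<in> op_spectrum m A. l islimpt op_spectrum m A \<or> infinite_multiplicity m A l}"

definition eigenvalue_N :: "('v \<Rightarrow> real) \<Rightarrow> (('v \<Rightarrow> complex) \<Rightarrow> ('v \<Rightarrow> complex) \<Rightarrow> bool)
    \<Rightarrow> nat \<Rightarrow> real" where
  "eigenvalue_N m A N = Inf {mu. \<exists>F::nat \<Rightarrow> 'v \<Rightarrow> complex.
     (\<forall>i<N. \<forall>j<N. ell2_ip m (F i) (F j) = (if i = j then 1 else 0)) \<and>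
     (\<forall>i<N. \<exists>nu::real. nu \<le> mu \<and> A (F i) (smul (complex_of_real nu) (F i)))}"

end

theory Submission
  imports Defs "HOL-Complex_Analysis.Great_Picard"
begin

text \<open>Write \<open>d\<close> for the weighted degree of the tree. Orienting the tree towards a root and using AM-GM,
  the off-diagonal part of the form is bounded by \<open>\<epsilon> d + c\<close>, and the perturbation by \<open>o(1 + d)\<close>;
  so every form in question is comparable with \<open>d\<close> and has the weighted space with weight
  \<open>m\<^sup>2 (1 + d)\<close> as its domain. On that space, identified with unweighted \<open>\<ell>\<^sup>2\<close>, the shifted form is a bounded
  coercive operator \<open>B\<close>, and the resolvent of the Friedrichs extension is \<open>T = P B\<^sup>-\<^sup>1 P\<close> with \<open>P\<close> the multiplication by
  \<open>(1 + d)\<^sup>-\<^sup>1\<^sup>/\<^sup>2\<close>. The domain of the square root of the operator is the range of \<open>T\<^sup>1\<^sup>/\<^sup>2\<close>, which is the range of \<open>P\<close>.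
  The essential spectrum is characterised by singular Weyl sequences of \<open>T\<close>; it is unchanged because the difference of two
  resolvents is completely continuous, and because a magnetic potential on a tree can be gauged away.
  If \<open>d \<rightarrow> \<infinity>\<close>, then \<open>T\<close> is compact and the form inequalities give the eigenvalue asymptotics by
  the min-max principle; otherwise \<open>T\<close> is not compact and has a Weyl sequence.\<close>

section \<open>Bounded symmetric operators on a real Hilbert space\<close>

text \<open>No spectral theorem is used. The complex space \<open>'v l2\<close> is handled as a real
  Hilbert space whose inner product is the real part of \<open>cip\<close>; complex scalars act as
  the operators \<open>cscale c\<close>, and imaginary parts are recovered by testing against
  \<open>cscale \<i> f\<close>. Spectral information is extracted from quadratic forms and from
  factoring quadratic polynomials in an operator. The operators to be compared are unbounded and
  their operator domains may differ. Their form domains agree, so all resolvents factor through the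
  same \<open>P\<close>, and a difference of forms becomes a bounded operator between two
  resolvents. The spectral parameter \<open>l\<close> is replaced by \<open>t = 1 / (l + C)\<close>;
  the value \<open>t = 0\<close> is the image of infinity and is excluded throughout. One shift
  \<open>C\<close> serves both operators of (c), so that their values of \<open>t\<close> can be
  compared. The potentials \<open>th\<close> and \<open>th0\<close> are unrelated, so the forms of
  \<open>H\<close> and \<open>D0\<close> need not be close to each other. A third operator, with the
  tree weights \<open>E0\<close> and the potential \<open>th\<close>, is interposed: it differs from
  \<open>H\<close> by a kernel that decays at infinity, and it is gauge equivalent to
  \<open>D0\<close>.\<close>

definition bsym :: "('a::real_inner \<Rightarrow> 'a) \<Rightarrow> bool" where
  "bsym T \<longleftrightarrow> bounded_linear T \<and> (\<forall>x y. inner (T x) y = inner x (T y))"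

lemma bsymD: "bsym T \<Longrightarrow> inner (T x) y = inner x (T y)"
  by (simp add: bsym_def)

lemma bsym_bounded_linear: "bsym T \<Longrightarrow> bounded_linear T"
  by (simp add: bsym_def)

lemma bsym_shift: "bsym T \<Longrightarrow> bsym (\<lambda>x. T x - k *\<^sub>R x)"
  unfolding bsym_def
  by (auto intro!: bounded_linear_sub bounded_linear_scaleR_right bounded_linear_ident
      simp: inner_diff_left inner_diff_right)

lemma bsym_comp_self: "bsym T \<Longrightarrow> bsym (\<lambda>x. T (T x))"
  unfolding bsym_def by (auto intro: bounded_linear_compose)

lemma quadratic_nonneg_discriminant:
  fixes a b c :: real
  assumes q: "\<And>t. 0 \<le> a + 2 * t * b + t\<^sup>2 * c"
  shows "b\<^sup>2 \<le> a * c"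
proof (cases "c = 0")
  case True
  have "b = 0"
  proof (rule ccontr)
    assume "b \<noteq> 0"
    then have "a + 2 * (- (a + 1) / (2 * b)) * b = - 1" by (simp add: field_simps)
    then show False using q[of "- (a + 1) / (2 * b)"] True by simp
  qed
  then show ?thesis using True by simp
next
  case False
  have "0 \<le> c"
  proof (rule ccontr)
    assume c: "\<not> 0 \<le> c"
    have a: "0 \<le> a" using q[of 0] by simp
    \<comment> \<open>Chosen so that \<open>t * (- c)\<close> exceeds
      \<open>a + 2 * \<bar>b\<bar>\<close> by \<open>- c\<close>; as \<open>t >= 1\<close>, the
      quadratic term then outweighs the other two.\<close>
    define t where "t = 1 + (a + 2 * \<bar>b\<bar>) / (- c)"
    have t1: "1 \<le> t" using a c by (simp add: t_def divide_nonneg_neg)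
    have "t * (- c) = - c + a + 2 * \<bar>b\<bar>" using c by (simp add: t_def field_simps)
    moreover have "t\<^sup>2 * c = - (t * (t * (- c)))" by (simp add: power2_eq_square)
    ultimately have "t\<^sup>2 * c = - (t * (- c + a + 2 * \<bar>b\<bar>))" by simp
    moreover have "2 * t * b \<le> t * (2 * \<bar>b\<bar>)"
      using t1 by (simp add: mult_left_mono)
    moreover have "a \<le> t * a" using t1 a by (simp add: mult_le_cancel_right1)
    moreover have "0 < t * (- c)" using t1 c by (intro mult_pos_pos) auto
    ultimately have "a + 2 * t * b + t\<^sup>2 * c < 0" by (simp add: algebra_simps)
    then show False using q[of t] by simp
  qed
  then have c: "0 < c" using False by simp
  \<comment> \<open>The minimiser \<open>t = - b / c\<close> of the quadratic.\<close>
  have "0 \<le> a + 2 * (- b / c) * b + (- b / c)\<^sup>2 * c" by (rule q)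
  also have "\<dots> = (a * c - b\<^sup>2) / c" using c by (simp add: field_simps power2_eq_square)
  finally show ?thesis using c by (simp add: zero_le_divide_iff)
qed

text \<open>A positive \<open>T\<close> makes \<open>inner (T x) y\<close> a semi-inner product; its
  nonnegativity along the line \<open>x + t y\<close> bounds the discriminant.\<close>

lemma bsym_Cauchy_Schwarz:
  assumes T: "bsym T" and pos: "\<And>x. 0 \<le> inner (T x) x"
  shows "(inner (T x) y)\<^sup>2 \<le> inner (T x) x * inner (T y) y"
proof (rule quadratic_nonneg_discriminant)
  fix t
  interpret T: bounded_linear T using T by (rule bsym_bounded_linear)
  have "inner (T y) x = inner (T x) y" using bsymD[OF T, of y x] by (simp add: inner_commute)
  then have "inner (T (x + t *\<^sub>R y)) (x + t *\<^sub>R y)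
      = inner (T x) x + 2 * t * inner (T x) y + t\<^sup>2 * inner (T y) y"
    by (simp add: T.add T.scaleR inner_add_left inner_add_right power2_eq_square algebra_simps)
  then show "0 \<le> inner (T x) x + 2 * t * inner (T x) y + t\<^sup>2 * inner (T y) y"
    using pos[of "x + t *\<^sub>R y"] by simp
qed

text \<open>Cauchy-Schwarz for the form of \<open>T\<close> with \<open>y = T x\<close>. It turns
  vectors on which the form is almost zero into almost kernel vectors.\<close>

lemma bsym_nonneg_norm_sq_le:
  assumes T: "bsym T" and pos: "\<And>x. 0 \<le> inner (T x) x" and M: "\<And>x. norm (T x) \<le> M * norm x"
  shows "(norm (T x))\<^sup>2 \<le> M * inner (T x) x"
proof (cases "T x = 0")
  case False
  have "(norm (T x))\<^sup>2 * (norm (T x))\<^sup>2 \<le> inner (T x) x * inner (T (T x)) (T x)"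
    using bsym_Cauchy_Schwarz[OF T pos, of x "T x"] by (simp add: dot_square_norm power2_eq_square)
  also have "\<dots> \<le> inner (T x) x * (M * (norm (T x))\<^sup>2)"
  proof (rule mult_left_mono[OF _ pos])
    have "inner (T (T x)) (T x) \<le> norm (T (T x)) * norm (T x)" by (rule norm_cauchy_schwarz)
    also have "\<dots> \<le> M * norm (T x) * norm (T x)" by (simp add: M mult_right_mono)
    finally show "inner (T (T x)) (T x) \<le> M * (norm (T x))\<^sup>2" by (simp add: power2_eq_square mult.assoc)
  qed
  finally have "(norm (T x))\<^sup>2 * (norm (T x))\<^sup>2 \<le> (M * inner (T x) x) * (norm (T x))\<^sup>2"
    by (simp add: algebra_simps)
  then show ?thesis by (rule mult_right_le_imp_le) (use False in simp)
qed (simp add: pos)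

lemma bsym_norm_le:
  assumes T: "bsym T" and pos: "\<And>x. 0 \<le> inner (T x) x" and le: "\<And>x. inner (T x) x \<le> (norm x)\<^sup>2"
  shows "norm (T x) \<le> norm x"
proof (cases "T x = 0")
  case False
  have "(norm (T x))\<^sup>2 * (norm (T x))\<^sup>2 \<le> inner (T x) x * inner (T (T x)) (T x)"
    using bsym_Cauchy_Schwarz[OF T pos, of x "T x"] by (simp add: dot_square_norm power2_eq_square)
  also have "\<dots> \<le> (norm x)\<^sup>2 * (norm (T x))\<^sup>2"
    by (intro mult_mono le pos) auto
  finally have "(norm (T x))\<^sup>2 \<le> (norm x)\<^sup>2"
    by (rule mult_right_le_imp_le) (use False in simp)
  then show ?thesis by simp
qed simp

section \<open>Inverting coercive and bounded below operators\<close>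

text \<open>A fixed point of \<open>x + t (y - A x)\<close> solves \<open>A x = y\<close>, and for
  small \<open>t\<close> coercivity makes this map a contraction.\<close>

lemma lax_milgram:
  fixes A :: "'a::{real_inner, banach} \<Rightarrow> 'a"
  assumes A: "bounded_linear A" and c: "0 < c" and coer: "\<And>x. c * (norm x)\<^sup>2 \<le> inner (A x) x"
  shows "bij A"
proof -
  interpret A: bounded_linear A by fact
  obtain M0 where M0: "\<And>x. norm (A x) \<le> norm x * M0" using A.bounded by blast
  \<comment> \<open>Enlarged so that \<open>c <= M\<close>, which keeps the contraction factor real,
    and \<open>1 <= M\<close>, which allows division.\<close>
  define M where "M = max (max M0 c) 1"
  have M: "norm (A x) \<le> M * norm x" for x
    by (rule order_trans[OF M0]) (simp add: M_def mult.commute[of _ "norm x"] mult_left_mono)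
  have M1: "1 \<le> M" "c \<le> M" by (auto simp: M_def)
  \<comment> \<open>Minimises \<open>1 - 2 t c + t^2 M^2\<close>, the bound for the squared
    contraction factor; the minimum is \<open>q\<close>.\<close>
  define t where "t = c / M\<^sup>2"
  have t: "0 < t" using c M1 by (simp add: t_def)
  define q where "q = 1 - c\<^sup>2 / M\<^sup>2"
  have "c\<^sup>2 \<le> M\<^sup>2" using M1 c by (simp add: power_mono)
  then have q: "0 \<le> q" "q < 1" using M1 c by (auto simp: q_def divide_le_eq_1)
  have contr: "norm (x - t *\<^sub>R A x) \<le> sqrt q * norm x" for x
  proof -
    have "(norm (x - t *\<^sub>R A x))\<^sup>2 = (norm x)\<^sup>2 - 2 * t * inner (A x) x + t\<^sup>2 * (norm (A x))\<^sup>2"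
      unfolding power2_norm_eq_inner
      by (simp add: inner_diff_left inner_diff_right inner_commute power2_eq_square algebra_simps)
    also have "\<dots> \<le> (norm x)\<^sup>2 - 2 * t * (c * (norm x)\<^sup>2) + t\<^sup>2 * (M * norm x)\<^sup>2"
      using t by (intro add_mono diff_mono mult_left_mono coer power_mono M) auto
    also have "\<dots> = q * (norm x)\<^sup>2"
      using M1 by (simp add: q_def t_def field_simps power2_eq_square)
    finally have "norm (x - t *\<^sub>R A x) \<le> sqrt (q * (norm x)\<^sup>2)"
      by (simp add: real_le_rsqrt)
    then show ?thesis by (simp add: real_sqrt_mult)
  qed
  have sq: "0 \<le> sqrt q" "sqrt q < 1" using q by auto
  have "\<exists>!x. A x = y" for y
  proof -
    have "\<exists>!x. x + t *\<^sub>R (y - A x) = x"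
    proof (rule banach_fix_type[OF sq], intro allI)
      fix x x'
      have "(x + t *\<^sub>R (y - A x)) - (x' + t *\<^sub>R (y - A x')) = (x - x') - t *\<^sub>R A (x - x')"
        by (simp add: A.diff algebra_simps)
      then show "dist (x + t *\<^sub>R (y - A x)) (x' + t *\<^sub>R (y - A x')) \<le> sqrt q * dist x x'"
        using contr[of "x - x'"] unfolding dist_norm by metis
    qed
    moreover have "x + t *\<^sub>R (y - A x) = x \<longleftrightarrow> A x = y" for x using t by auto
    ultimately show ?thesis by simp
  qed
  then show ?thesis by (simp add: bij_iff)
qed

lemma bsym_inv:
  fixes A :: "'a::{real_inner, banach} \<Rightarrow> 'a"
  assumes A: "bsym A" and b: "bij A" and c: "0 < c" and low: "\<And>x. c * norm x \<le> norm (A x)"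
  shows "bsym (inv A)"
proof -
  interpret A: bounded_linear A using A by (rule bsym_bounded_linear)
  have iA: "A (inv A y) = y" for y using b by (simp add: bij_is_surj surj_f_inv_f)
  have Ai: "inv A (A y) = y" for y using b by (simp add: bij_is_inj)
  have lin: "bounded_linear (inv A)"
  proof (rule bounded_linear_intro[where K = "1 / c"])
    fix x y show "inv A (x + y) = inv A x + inv A y"
      using Ai[of "inv A x + inv A y"] by (simp add: A.add iA)
  next
    fix r x show "inv A (r *\<^sub>R x) = r *\<^sub>R inv A x"
      using Ai[of "r *\<^sub>R inv A x"] by (simp add: A.scaleR iA)
  next
    fix x show "norm (inv A x) \<le> norm x * (1 / c)"
      using low[of "inv A x"] c by (simp add: iA field_simps)
  qed
  have "inner (inv A x) y = inner x (inv A y)" for x y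
    using bsymD[OF A, of "inv A x" "inv A y"] by (simp add: iA)
  then show ?thesis using lin by (simp add: bsym_def)
qed

text \<open>By symmetry \<open>inner (S (S x)) x\<close> is the square of \<open>norm (S x)\<close>,
  so \<open>S\<close> composed with itself is coercive; its bijectivity passes to
  \<open>S\<close>.\<close>

lemma bsym_bounded_below_bij:
  fixes S :: "'a::{real_inner, banach} \<Rightarrow> 'a"
  assumes S: "bsym S" and c: "0 < c" and low: "\<And>x. c * norm x \<le> norm (S x)"
  shows "bij S"
proof -
  have "bij (\<lambda>x. S (S x))"
  proof (rule lax_milgram[where c = "c\<^sup>2"])
    fix x
    have "c\<^sup>2 * (norm x)\<^sup>2 \<le> (norm (S x))\<^sup>2"
      using power_mono[OF low, of x 2] c by (simp add: power_mult_distrib)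
    then show "c\<^sup>2 * (norm x)\<^sup>2 \<le> inner (S (S x)) x"
      using bsymD[OF S, of "S x" x] by (simp add: power2_norm_eq_inner)
  qed (use c bsym_bounded_linear[OF bsym_comp_self[OF S]] in auto)
  then show ?thesis
    unfolding bij_def surj_def inj_def by metis
qed

lemma tendsto_zero_of_norm_sq_le:
  fixes h :: "nat \<Rightarrow> 'a::real_normed_vector"
  assumes le: "\<And>n. (norm (h n))\<^sup>2 \<le> c n" and c: "c \<longlonglongrightarrow> 0"
  shows "h \<longlonglongrightarrow> 0"
proof (rule Lim_null_comparison)
  have "norm (h n) \<le> sqrt (c n)" for n using le[of n] by (rule real_le_rsqrt)
  then show "\<forall>\<^sub>F n in sequentially. norm (h n) \<le> sqrt (c n)" by simp
  show "(\<lambda>n. sqrt (c n)) \<longlonglongrightarrow> 0" using tendsto_real_sqrt[OF c] by simp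
qed

section \<open>Bottom of a form, spectral gaps and distance to the kernel\<close>

text \<open>Here \<open>k\<close> is the infimum of the form on the unit sphere. Since
  \<open>P - k\<close> is nonnegative, a minimising sequence consists of approximate eigenvectors by
  \<open>bsym_nonneg_norm_sq_le\<close>.\<close>

lemma bsym_inf_approx:
  fixes P :: "'a::real_inner \<Rightarrow> 'a"
  assumes P: "bsym P" and ex: "\<exists>x::'a. x \<noteq> 0"
  obtains k f where "\<And>x. k * (norm x)\<^sup>2 \<le> inner (P x) x" and "\<And>n::nat. norm (f n) = 1"
    and "(\<lambda>n. P (f n) - k *\<^sub>R f n) \<longlonglongrightarrow> 0"
proof -
  interpret P: bounded_linear P using P by (rule bsym_bounded_linear)
  obtain M where M: "\<And>x. norm (P x) \<le> norm x * M" "0 < M" using P.pos_bounded by blast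
  define X where "X = {inner (P x) x | x. norm x = 1}"
  obtain x0 :: 'a where "x0 \<noteq> 0" using ex by blast
  then have "norm (sgn x0) = 1" by (simp add: norm_sgn)
  then have ne: "X \<noteq> {}" by (auto simp: X_def)
  have bd: "bdd_below X"
  proof (rule bdd_belowI)
    fix r assume "r \<in> X"
    then obtain x where x: "r = inner (P x) x" "norm x = 1" by (auto simp: X_def)
    have "\<bar>inner (P x) x\<bar> \<le> norm (P x) * norm x" by (rule Cauchy_Schwarz_ineq2)
    then show "- M \<le> r" using M(1)[of x] x by simp
  qed
  define k where "k = Inf X"
  have low: "k * (norm x)\<^sup>2 \<le> inner (P x) x" for x
  proof (cases "x = 0")
    case False
    have "inner (P (sgn x)) (sgn x) \<in> X" using False by (auto simp: X_def norm_sgn)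
    then have "k \<le> inner (P (sgn x)) (sgn x)" unfolding k_def by (rule cInf_lower[OF _ bd])
    also have "\<dots> = inner (P x) x / (norm x)\<^sup>2"
      by (simp add: sgn_div_norm P.scaleR power2_eq_square field_simps)
    finally show ?thesis using False by (simp add: field_simps)
  qed (simp add: P.zero)
  have "\<exists>x. norm x = 1 \<and> inner (P x) x < k + 1 / real (Suc n)" for n
  proof -
    have "Inf X < k + 1 / real (Suc n)" by (simp add: k_def)
    then show ?thesis using cInf_less_iff[OF ne bd] by (auto simp: X_def)
  qed
  then obtain f where f: "\<And>n. norm (f n) = 1" "\<And>n. inner (P (f n)) (f n) < k + 1 / real (Suc n)"
    by metis
  let ?P = "\<lambda>x. P x - k *\<^sub>R x"
  have le: "(norm (?P (f n)))\<^sup>2 \<le> (M + \<bar>k\<bar>) * (1 / real (Suc n))" for n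
  proof -
    have "(norm (?P (f n)))\<^sup>2 \<le> (M + \<bar>k\<bar>) * inner (?P (f n)) (f n)"
    proof (rule bsym_nonneg_norm_sq_le[OF bsym_shift[OF P]])
      fix x show "0 \<le> inner (P x - k *\<^sub>R x) x"
        using low[of x] by (simp add: inner_diff_left power2_norm_eq_inner)
      show "norm (P x - k *\<^sub>R x) \<le> (M + \<bar>k\<bar>) * norm x"
        using norm_triangle_ineq4[of "P x" "k *\<^sub>R x"] M(1)[of x] by (simp add: algebra_simps)
    qed
    also have "inner (?P (f n)) (f n) \<le> 1 / real (Suc n)"
      using f(2)[of n] f(1)[of n] by (simp add: inner_diff_left dot_square_norm)
    finally show ?thesis using M by (simp add: mult_left_mono)
  qed
  have "(\<lambda>n. 1 / real (Suc n)) \<longlonglongrightarrow> 0"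
    using LIMSEQ_inverse_real_of_nat by (simp only: inverse_eq_divide)
  then have "(\<lambda>n. (M + \<bar>k\<bar>) * (1 / real (Suc n))) \<longlonglongrightarrow> 0"
    by (rule tendsto_mult_right_zero)
  with le have "(\<lambda>n. ?P (f n)) \<longlonglongrightarrow> 0" by (rule tendsto_zero_of_norm_sq_le)
  with low f(1) show ?thesis by (rule that)
qed

text \<open>Otherwise \<open>Y (Y - b)\<close> has a negative bottom \<open>k\<close> of its spectrum; but \<open>y\<^sup>2 - b y - k\<close> is positive
  or factors into \<open>(y - t1) (y - t2)\<close> with roots in the gap.\<close>

lemma bsym_spectral_gap:
  fixes Y :: "'a::real_inner \<Rightarrow> 'a"
  assumes Y: "bsym Y" and b: "0 < b"
    and gap: "\<And>t. 0 < t \<Longrightarrow> t < b \<Longrightarrow> \<exists>c>0. \<forall>x. c * norm x \<le> norm (Y x - t *\<^sub>R x)"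
  shows "b * inner (Y x) x \<le> (norm (Y x))\<^sup>2"
proof (cases "x = 0")
  case True
  interpret Y: bounded_linear Y using Y by (rule bsym_bounded_linear)
  show ?thesis using True by (simp add: Y.zero)
next
  case False
  interpret Y: bounded_linear Y using Y by (rule bsym_bounded_linear)
  let ?P = "\<lambda>x. Y (Y x) - b *\<^sub>R Y x"
  have P: "bsym ?P"
    unfolding bsym_def
  proof (intro conjI allI)
    show "bounded_linear ?P"
      by (intro bounded_linear_sub bounded_linear_compose[OF Y.bounded_linear_axioms]
          bounded_linear_compose[OF bounded_linear_scaleR_right] Y.bounded_linear_axioms)
  qed (simp add: inner_diff_left inner_diff_right bsymD[OF Y])
  obtain k f where k: "\<And>x. k * (norm x)\<^sup>2 \<le> inner (?P x) x" and f: "\<And>n::nat. norm (f n) = 1"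
    and lim: "(\<lambda>n. ?P (f n) - k *\<^sub>R f n) \<longlonglongrightarrow> 0"
    using bsym_inf_approx[OF P] False by blast
  \<comment> \<open>The number \<open>k\<close> is an approximate eigenvalue of
    \<open>Y (Y - b)\<close>, so no positive lower bound for the operator minus \<open>k\<close> can
    exist.\<close>
  have contra: False if "c > 0" and "\<And>x. c * norm x \<le> norm (?P x - k *\<^sub>R x)" for c
  proof -
    have "(\<lambda>n. norm (?P (f n) - k *\<^sub>R f n)) \<longlonglongrightarrow> 0" using lim by (simp add: tendsto_norm_zero_iff)
    moreover have "\<forall>\<^sub>F n in sequentially. c \<le> norm (?P (f n) - k *\<^sub>R f n)"
      using that(2) f by (metis (no_types, lifting) eventuallyI mult.right_neutral)
    ultimately have "c \<le> 0"
      by (intro tendsto_lowerbound[where F = sequentially]) auto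
    with that(1) show False by simp
  qed
  have "0 \<le> k"
  proof (rule ccontr)
    assume "\<not> 0 \<le> k"
    then have k0: "k < 0" by simp
    show False
    proof (cases "0 \<le> b\<^sup>2 + 4 * k")
      case True
      \<comment> \<open>The roots of \<open>y^2 - b y - k\<close> are \<open>(b + r) / 2\<close> and
        \<open>(b - r) / 2\<close>; \<open>k < 0\<close> gives \<open>r < b\<close>, which places
        both strictly between 0 and \<open>b\<close>.\<close>
      define r where "r = sqrt (b\<^sup>2 + 4 * k)"
      have r2: "r\<^sup>2 = b\<^sup>2 + 4 * k" using True by (simp add: r_def)
      have "r < b" unfolding r_def using k0 b by (intro real_less_lsqrt) auto
      moreover have "0 \<le> r" using True by (simp add: r_def)
      ultimately have t: "0 < (b + r) / 2" "(b + r) / 2 < b" "0 < (b - r) / 2" "(b - r) / 2 < b"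
        using b by auto
      obtain c1 where c1: "c1 > 0" "\<And>x. c1 * norm x \<le> norm (Y x - ((b + r) / 2) *\<^sub>R x)"
        using gap[OF t(1,2)] by blast
      obtain c2 where c2: "c2 > 0" "\<And>x. c2 * norm x \<le> norm (Y x - ((b - r) / 2) *\<^sub>R x)"
        using gap[OF t(3,4)] by blast
      have sum: "(b + r) / 2 + (b - r) / 2 = b" by (simp add: field_simps)
      have "(b + r) * (b - r) = - (4 * k)"
        using r2 by (simp add: power2_eq_square algebra_simps)
      then have prod: "((b + r) / 2) * ((b - r) / 2) = - k" by simp
      have "c2 * c1 * norm x \<le> norm (?P x - k *\<^sub>R x)" for x
      proof -
        have "c2 * c1 * norm x \<le> c2 * norm (Y x - ((b + r) / 2) *\<^sub>R x)"
          using c1(2)[of x] c2(1) by (simp add: mult.assoc)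
        also have "\<dots> \<le> norm (Y (Y x - ((b + r) / 2) *\<^sub>R x) - ((b - r) / 2) *\<^sub>R (Y x - ((b + r) / 2) *\<^sub>R x))"
          by (rule c2(2))
        also have "Y (Y x - ((b + r) / 2) *\<^sub>R x) - ((b - r) / 2) *\<^sub>R (Y x - ((b + r) / 2) *\<^sub>R x)
          = Y (Y x) - ((b + r) / 2 + (b - r) / 2) *\<^sub>R Y x + (((b + r) / 2) * ((b - r) / 2)) *\<^sub>R x"
          by (simp add: Y.diff Y.scaleR algebra_simps)
        also have "\<dots> = ?P x - k *\<^sub>R x" unfolding sum prod by simp
        finally show ?thesis .
      qed
      then show False using contra[of "c2 * c1"] c1 c2 by simp
    next
      case neg: False
      \<comment> \<open>Completing the square: \<open>y^2 - b y - k\<close> equals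
        \<open>(y - b/2)^2 + e\<close>.\<close>
      define e where "e = - k - b\<^sup>2 / 4"
      have e: "0 < e" using neg by (simp add: e_def)
      have "e * norm x \<le> norm (?P x - k *\<^sub>R x)" for x
      proof (cases "x = 0")
        case False
        have "inner (?P x - k *\<^sub>R x) x = (norm (Y x - (b / 2) *\<^sub>R x))\<^sup>2 + e * (norm x)\<^sup>2"
          unfolding power2_norm_eq_inner
          by (simp add: e_def inner_diff_left inner_diff_right bsymD[OF Y]
              power2_eq_square algebra_simps)
        then have "e * (norm x)\<^sup>2 \<le> inner (?P x - k *\<^sub>R x) x" by simp
        also have "\<dots> \<le> norm (?P x - k *\<^sub>R x) * norm x" by (rule norm_cauchy_schwarz)
        finally show ?thesis using False by (simp add: power2_eq_square)
      qed simp
      then show False using contra[of e] e by simp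
    qed
  qed
  then have "0 \<le> inner (?P x) x" using k[of x] by (meson order_trans mult_nonneg_nonneg zero_le_power2)
  then show ?thesis by (simp add: inner_diff_left bsymD[OF Y] power2_norm_eq_inner)
qed

text \<open>The iteration \<open>x \<mapsto> x - S\<^sup>2 x / M\<^sup>2\<close> contracts the range of \<open>S\<close> and fixes its kernel.\<close>

lemma bsym_dist_kernel:
  fixes S :: "'a::{real_inner, banach} \<Rightarrow> 'a"
  assumes S: "bsym S" and d: "0 < d" and gap: "\<And>x. d * norm (S x) \<le> norm (S (S x))"
  obtains K where "\<And>x. \<exists>e. S e = 0 \<and> norm (x - e) \<le> K * norm (S x)"
proof -
  interpret S: bounded_linear S using S by (rule bsym_bounded_linear)
  obtain M0 where M0: "\<And>x. norm (S x) \<le> norm x * M0" using S.bounded by blast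
  define M where "M = max (max M0 d) 1"
  have M: "norm (S x) \<le> M * norm x" for x
    by (rule order_trans[OF M0]) (simp add: M_def mult.commute[of _ "norm x"] mult_left_mono)
  have M1: "1 \<le> M" "d \<le> M" by (auto simp: M_def)
  define Z where "Z x = x - (1 / M\<^sup>2) *\<^sub>R S (S x)" for x
  have SZ: "S (Z x) = Z (S x)" for x by (simp add: Z_def S.diff S.scaleR)
  \<comment> \<open>On the range of \<open>S\<close> the hypothesis bounds \<open>norm (S g)\<close>
    below by \<open>d * norm g\<close>; inserted into the expansion of the squared norm of
    \<open>Z g\<close>, this leaves the factor \<open>1 - d^2 / M^2\<close>.\<close>
  define q where "q = sqrt (1 - d\<^sup>2 / M\<^sup>2)"
  have "d\<^sup>2 \<le> M\<^sup>2" using M1 d by (simp add: power_mono)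
  then have q: "0 \<le> q" "q < 1" and q2: "q\<^sup>2 = 1 - d\<^sup>2 / M\<^sup>2"
    using M1 d by (auto simp: q_def divide_le_eq_1)
  have contr: "norm (Z (S x)) \<le> q * norm (S x)" for x
  proof -
    let ?g = "S x"
    have "(norm (Z ?g))\<^sup>2 = (norm ?g)\<^sup>2 - 2 / M\<^sup>2 * (norm (S ?g))\<^sup>2 + (1 / M\<^sup>2)\<^sup>2 * (norm (S (S ?g)))\<^sup>2"
      unfolding Z_def power2_norm_eq_inner
      by (simp add: inner_diff_left inner_diff_right bsymD[OF S] power2_eq_square algebra_simps)
    also have "\<dots> \<le> (norm ?g)\<^sup>2 - 2 / M\<^sup>2 * (norm (S ?g))\<^sup>2 + (1 / M\<^sup>2)\<^sup>2 * (M * norm (S ?g))\<^sup>2"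
      by (intro add_mono mult_left_mono power_mono M) auto
    also have "\<dots> = (norm ?g)\<^sup>2 - 1 / M\<^sup>2 * (norm (S ?g))\<^sup>2"
      using M1 by (simp add: field_simps power2_eq_square)
    also have "\<dots> \<le> (norm ?g)\<^sup>2 - 1 / M\<^sup>2 * (d * norm ?g)\<^sup>2"
      using d by (intro diff_mono mult_left_mono power_mono gap) auto
    also have "\<dots> = (q * norm ?g)\<^sup>2" by (simp add: power_mult_distrib q2 algebra_simps)
    finally show ?thesis using q by (meson mult_nonneg_nonneg norm_ge_zero power2_le_imp_le)
  qed
  \<comment> \<open>Sum of the geometric series that bounds the steps of the iteration, divided by
    \<open>norm (S x)\<close>.\<close>
  define K where "K = (1 / M) / (1 - q)"
  have "\<exists>e. S e = 0 \<and> norm (x - e) \<le> K * norm (S x)" for x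
  proof -
    define f where "f n = (Z ^^ n) x" for n
    have fS: "f (Suc n) = Z (f n)" for n by (simp add: f_def)
    have Sf: "norm (S (f n)) \<le> q ^ n * norm (S x)" for n
    proof (induction n)
      case (Suc n)
      have "norm (S (f (Suc n))) \<le> q * norm (S (f n))" by (simp add: fS SZ contr)
      also have "\<dots> \<le> q * (q ^ n * norm (S x))" using Suc q by (intro mult_left_mono) auto
      finally show ?case by simp
    qed (simp add: f_def)
    have step: "norm (f n - f (Suc n)) \<le> (1 / M * norm (S x)) * q ^ n" for n
    proof -
      have "norm (f n - f (Suc n)) = 1 / M\<^sup>2 * norm (S (S (f n)))" by (simp add: fS Z_def)
      also have "\<dots> \<le> 1 / M\<^sup>2 * (M * norm (S (f n)))" by (intro mult_left_mono M) auto
      also have "\<dots> = 1 / M * norm (S (f n))" using M1 by (simp add: power2_eq_square)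
      also have "\<dots> \<le> 1 / M * (q ^ n * norm (S x))" using M1 by (intro mult_left_mono Sf) auto
      finally show ?thesis by (simp add: mult_ac)
    qed
    have geo: "(\<lambda>n. (1 / M * norm (S x)) * q ^ n) sums ((1 / M * norm (S x)) * (1 / (1 - q)))"
      using q by (intro sums_mult geometric_sums) auto
    have sm: "summable (\<lambda>n. norm (f n - f (Suc n)))"
      by (rule summable_comparison_test'[OF sums_summable[OF geo], of 0]) (use step in auto)
    then have sm': "summable (\<lambda>n. f n - f (Suc n))" by (rule summable_norm_cancel)
    define e where "e = x - (\<Sum>n. f n - f (Suc n))"
    have "(\<lambda>n. \<Sum>k<n. f k - f (Suc k)) \<longlonglongrightarrow> (\<Sum>n. f n - f (Suc n))"
      using sm' by (rule summable_LIMSEQ)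
    then have "(\<lambda>n. x - f n) \<longlonglongrightarrow> (\<Sum>n. f n - f (Suc n))"
      unfolding sum_lessThan_telescope' by (simp add: f_def)
    then have "(\<lambda>n. x - (x - f n)) \<longlonglongrightarrow> e" unfolding e_def by (intro tendsto_diff tendsto_const)
    then have fe: "f \<longlonglongrightarrow> e" by simp
    have "(\<lambda>n. S (f n)) \<longlonglongrightarrow> S e" using fe by (rule S.tendsto)
    moreover have "(\<lambda>n. S (f n)) \<longlonglongrightarrow> 0"
    proof (rule Lim_null_comparison[OF always_eventually])
      show "\<forall>n. norm (S (f n)) \<le> q ^ n * norm (S x)" using Sf by simp
      show "(\<lambda>n. q ^ n * norm (S x)) \<longlonglongrightarrow> 0"
        using q by (intro tendsto_mult_left_zero LIMSEQ_power_zero) auto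
    qed
    ultimately have "S e = 0" by (rule LIMSEQ_unique)
    moreover have "norm (x - e) \<le> K * norm (S x)"
    proof -
      have "norm (x - e) \<le> (\<Sum>n. norm (f n - f (Suc n)))"
        unfolding e_def using summable_norm[OF sm] by simp
      also have "\<dots> \<le> (\<Sum>n. (1 / M * norm (S x)) * q ^ n)"
        by (rule suminf_le[OF step sm sums_summable[OF geo]])
      also have "\<dots> = K * norm (S x)" using sums_unique[OF geo] by (simp add: K_def)
      finally show ?thesis .
    qed
    ultimately show ?thesis by blast
  qed
  then show ?thesis by (rule that)
qed

section \<open>Square root of a positive contraction\<close>

text \<open>The commutation clause is included so that the root of a complex linear operator is
  complex linear: take for \<open>U\<close> multiplication by a complex scalar.\<close>

lemma bsym_sqrt:
  fixes T :: "'a::{real_inner, banach} \<Rightarrow> 'a"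
  assumes T: "bsym T" and pos: "\<And>x. 0 \<le> inner (T x) x" and le: "\<And>x. inner (T x) x \<le> (norm x)\<^sup>2"
  obtains R where "bsym R" "\<And>x. 0 \<le> inner (R x) x" "\<And>x. R (R x) = T x"
    "\<And>U x. bounded_linear U \<Longrightarrow> (\<And>x. U (T x) = T (U x)) \<Longrightarrow> U (R x) = R (U x)"
proof -
  define A where "A x = x - T x" for x
  have A: "bsym A"
    using T unfolding bsym_def A_def
    by (auto intro!: bounded_linear_sub bounded_linear_ident simp: inner_diff_left inner_diff_right)
  interpret A: bounded_linear A using A by (rule bsym_bounded_linear)
  have nA: "norm (A x) \<le> norm x" for x
    by (rule bsym_norm_le[OF A])
      (use pos le in \<open>simp_all add: A_def inner_diff_left power2_norm_eq_inner\<close>)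
  text \<open>The iteration \<open>X \<mapsto> (A + X\<^sup>2) / 2\<close> is majorised by the scalar one with \<open>A = 1\<close>,
    which increases to the fixed point 1; its limit satisfies \<open>(1 - X)\<^sup>2 = T\<close>.\<close>
  define X where "X = rec_nat (\<lambda>x::'a. 0::'a) (\<lambda>_ Y x. (1/2) *\<^sub>R (A x + Y (Y x)))"
  have X0: "X 0 x = 0" and XS: "X (Suc n) x = (1/2) *\<^sub>R (A x + X n (X n x))" for n x
    by (simp_all add: X_def)
  define r where "r = rec_nat (0::real) (\<lambda>_ y. (1 + y\<^sup>2) / 2)"
  have r0: "r 0 = 0" and rS: "r (Suc n) = (1 + (r n)\<^sup>2) / 2" for n by (simp_all add: r_def)
  have r_bd: "0 \<le> r n \<and> r n \<le> 1" for n
  proof (induction n)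
    case (Suc n)
    then have "(r n)\<^sup>2 \<le> 1" by (simp add: power_le_one)
    then show ?case by (simp add: rS)
  qed (simp add: r0)
  have r_inc: "r n \<le> r (Suc n)" for n
    using zero_le_power2[of "1 - r n"] by (simp add: rS power2_eq_square algebra_simps)
  have Xbl: "bounded_linear (X n)" for n
  proof (induction n)
    case 0
    then show ?case by (simp add: X0[abs_def] bounded_linear_zero)
  next
    case (Suc n)
    have "bounded_linear (\<lambda>x. (1/2) *\<^sub>R (A x + X n (X n x)))"
      by (intro bounded_linear_compose[OF bounded_linear_scaleR_right] bounded_linear_add
          A.bounded_linear_axioms bounded_linear_compose[OF Suc Suc])
    then show ?case by (simp add: XS[abs_def])
  qed
  have Xsym: "inner (X n x) y = inner x (X n y)" for n x y
  proof (induction n arbitrary: x y)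
    case (Suc n)
    then show ?case by (simp add: XS inner_add_left inner_add_right bsymD[OF A])
  qed (simp add: X0)
  have comm: "U (X n x) = X n (U x)"
    if U: "bounded_linear U" and UA: "\<And>x. U (A x) = A (U x)" for U n x
  proof (induction n arbitrary: x)
    case 0
    show ?case by (simp add: X0 linear_0[OF bounded_linear.linear[OF U]])
  next
    case (Suc n)
    interpret U: bounded_linear U by (rule U)
    show ?case by (simp add: XS U.scaleR U.add UA Suc)
  qed
  have XA: "X n (A x) = A (X n x)" for n x
    using comm[OF A.bounded_linear_axioms, of n x] by simp
  have XX: "X k (X n x) = X n (X k x)" for k n x
    by (rule comm[OF Xbl]) (rule XA)
  have Xn: "norm (X n x) \<le> r n * norm x" for n x
  proof (induction n arbitrary: x)
    case (Suc n)
    have "norm (X n (X n x)) \<le> r n * (r n * norm x)"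
      using Suc[of "X n x"] Suc[of x] r_bd[of n] by (meson mult_left_mono order_trans)
    then have "norm (A x + X n (X n x)) \<le> norm x + r n * (r n * norm x)"
      using norm_triangle_ineq[of "A x" "X n (X n x)"] nA[of x] by linarith
    then have "norm (X (Suc n) x) \<le> (1/2) * (norm x + r n * (r n * norm x))" 
      unfolding XS norm_scaleR by simp
    then show ?case by (simp add: rS power2_eq_square algebra_simps)
  qed (simp add: X0 r0)
  have Xle: "norm (X n x) \<le> norm x" for n x
    using Xn[of n x] r_bd[of n] by (meson mult_left_le_one_le norm_ge_zero order_trans)
  have Xd: "norm (X (Suc n) x - X n x) \<le> (r (Suc n) - r n) * norm x" for n x
  proof (induction n arbitrary: x)
    case 0
    show ?case using nA[of x] by (simp add: X0 XS rS r0)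
  next
    case (Suc n)
    interpret Xn: bounded_linear "X n" by (rule Xbl)
    interpret XSn: bounded_linear "X (Suc n)" by (rule Xbl)
    let ?s = "X (Suc n) x + X n x"
    \<comment> \<open>The iterates commute, so the difference of their squares factors into
      difference times sum; the induction hypothesis is then applied to the vector
      \<open>?s\<close>.\<close>
    have "X (Suc n) ?s - X n ?s = X (Suc n) (X (Suc n) x) - X n (X n x)"
      using XX[of "Suc n" n x] by (simp add: Xn.add XSn.add)
    then have "X (Suc (Suc n)) x - X (Suc n) x = (1/2) *\<^sub>R (X (Suc n) ?s - X n ?s)"
      by (simp only: XS[of "Suc n"] XS[of n x]) (simp add: algebra_simps)
    then have "norm (X (Suc (Suc n)) x - X (Suc n) x) = (1/2) * norm (X (Suc n) ?s - X n ?s)"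
      by simp
    also have "\<dots> \<le> (1/2) * ((r (Suc n) - r n) * norm ?s)"
      by (intro mult_left_mono Suc) auto
    also have "\<dots> \<le> (1/2) * ((r (Suc n) - r n) * ((r (Suc n) + r n) * norm x))"
      using norm_triangle_ineq[of "X (Suc n) x" "X n x"] Xn[of "Suc n" x] Xn[of n x] r_inc[of n]
      by (intro mult_left_mono) (auto simp: distrib_right intro: order_trans)
    also have "\<dots> = (r (Suc (Suc n)) - r (Suc n)) * norm x"
    proof -
      have "r (Suc (Suc n)) - r (Suc n) = ((r (Suc n))\<^sup>2 - (r n)\<^sup>2) / 2"
        by (simp add: rS[of "Suc n"] rS[of n] field_simps)
      then show ?thesis by (simp only:) (simp add: power2_eq_square algebra_simps)
    qed
    finally show ?case .
  qed
  have "convergent (\<lambda>n. X n x)" for x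
  proof -
    have "incseq r" using r_inc by (rule incseq_SucI)
    then have "convergent r" using r_bd by (intro Bseq_mono_convergent BseqI'[of _ 1]) (auto simp: incseq_def)
    then have "summable (\<lambda>n. r (Suc n) - r n)"
      by (metis convergent_def telescope_summable)
    then have "summable (\<lambda>n. (r (Suc n) - r n) * norm x)" by (rule summable_mult2)
    then have "summable (\<lambda>n. X (Suc n) x - X n x)"
      by (rule summable_comparison_test'[of _ 0]) (use Xd in auto)
    then have "convergent (\<lambda>n. \<Sum>k<n. X (Suc k) x - X k x)" by (simp add: summable_iff_convergent)
    then have "convergent (\<lambda>n. X n x - X 0 x)"
      by (simp only: sum_lessThan_telescope[of "\<lambda>k. X k x"])
    then show ?thesis by (simp add: X0)
  qed
  then obtain Y where Y: "\<And>x. (\<lambda>n. X n x) \<longlonglongrightarrow> Y x" unfolding convergent_def by metis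
  have Yle: "norm (Y x) \<le> norm x" for x
    by (rule LIMSEQ_le_const2[OF tendsto_norm[OF Y]]) (use Xle in auto)
  have Ybl: "bounded_linear Y"
  proof (rule bounded_linear_intro[where K = 1])
    fix x y
    have "(\<lambda>n. X n (x + y)) \<longlonglongrightarrow> Y x + Y y"
      using tendsto_add[OF Y[of x] Y[of y]]
      by (simp add: linear_add[OF bounded_linear.linear[OF Xbl]])
    then show "Y (x + y) = Y x + Y y" using Y LIMSEQ_unique by blast
  next
    fix c x
    have "(\<lambda>n. X n (c *\<^sub>R x)) \<longlonglongrightarrow> c *\<^sub>R Y x"
      using tendsto_scaleR[OF tendsto_const Y[of x]]
      by (simp add: linear_scale[OF bounded_linear.linear[OF Xbl]])
    then show "Y (c *\<^sub>R x) = c *\<^sub>R Y x" using Y LIMSEQ_unique by blast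
  qed (simp add: Yle)
  interpret Y: bounded_linear Y by (rule Ybl)
  have YY: "Y x = (1/2) *\<^sub>R (A x + Y (Y x))" for x
  proof -
    \<comment> \<open>To square the limit, write \<open>X n (X n x)\<close> as
      \<open>X n (X n x - Y x) + X n (Y x)\<close>; the iterates are contractions, so the first
      summand vanishes in the limit.\<close>
    have "(\<lambda>n. X n (X n x - Y x)) \<longlonglongrightarrow> 0"
    proof (rule Lim_null_comparison[OF always_eventually])
      show "\<forall>n. norm (X n (X n x - Y x)) \<le> norm (X n x - Y x)" using Xle by simp
      show "(\<lambda>n. norm (X n x - Y x)) \<longlonglongrightarrow> 0"
        using Y[of x] by (simp add: LIM_zero tendsto_norm_zero)
    qed
    from tendsto_add[OF this Y[of "Y x"]] have "(\<lambda>n. X n (X n x)) \<longlonglongrightarrow> Y (Y x)"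
      by (simp add: linear_diff[OF bounded_linear.linear[OF Xbl]])
    then have "(\<lambda>n. X (Suc n) x) \<longlonglongrightarrow> (1/2) *\<^sub>R (A x + Y (Y x))"
      unfolding XS by (intro tendsto_intros)
    then show ?thesis using LIMSEQ_Suc[OF Y[of x]] LIMSEQ_unique by blast
  qed
  define R where "R x = x - Y x" for x
  show ?thesis
  proof (rule that[of R])
    have "inner (Y x) y = inner x (Y y)" for x y
    proof (rule LIMSEQ_unique)
      show "(\<lambda>n. inner (X n x) y) \<longlonglongrightarrow> inner (Y x) y" by (intro tendsto_intros Y)
      show "(\<lambda>n. inner (X n x) y) \<longlonglongrightarrow> inner x (Y y)" unfolding Xsym by (intro tendsto_intros Y)
    qed
    then show "bsym R"
      unfolding bsym_def R_def
      by (auto intro!: bounded_linear_sub bounded_linear_ident Ybl simp: inner_diff_left inner_diff_right)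
    show "0 \<le> inner (R x) x" for x
    proof -
      have "inner (Y x) x \<le> norm (Y x) * norm x" by (rule norm_cauchy_schwarz)
      also have "\<dots> \<le> norm x * norm x" by (intro mult_right_mono Yle) auto
      finally show ?thesis by (simp add: R_def inner_diff_left dot_square_norm power2_eq_square)
    qed
    show "R (R x) = T x" for x
    proof -
      have "2 *\<^sub>R Y x = 2 *\<^sub>R ((1/2) *\<^sub>R (A x + Y (Y x)))" by (rule arg_cong[OF YY])
      then have "Y x + Y x = A x + Y (Y x)" by (simp add: scaleR_2)
      then show ?thesis by (simp add: R_def Y.diff A_def algebra_simps)
    qed
    show "U (R x) = R (U x)" if U: "bounded_linear U" and UT: "\<And>x. U (T x) = T (U x)" for U x
    proof -
      interpret U: bounded_linear U by (rule U)
      have UA: "U (A x) = A (U x)" for x by (simp add: A_def U.diff UT)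
      have "(\<lambda>n. U (X n x)) \<longlonglongrightarrow> U (Y x)" by (intro U.tendsto Y)
      moreover have "(\<lambda>n. U (X n x)) \<longlonglongrightarrow> Y (U x)" unfolding comm[OF U UA] by (rule Y)
      ultimately have "U (Y x) = Y (U x)" by (rule LIMSEQ_unique)
      then show ?thesis by (simp add: R_def U.diff)
    qed
  qed
qed

section \<open>The Hilbert space of square summable functions\<close>

typedef 'v l2 = "{f :: 'v \<Rightarrow> complex. (\<lambda>x. (cmod (f x))\<^sup>2) summable_on UNIV}"
  morphisms coord Abs_l2
  by (rule exI[of _ "\<lambda>_. 0"]) simp

lemma sq_summable_iff:
  "(\<lambda>x. (cmod (f x))\<^sup>2) summable_on UNIV \<longleftrightarrow> (\<exists>b. \<forall>S. finite S \<longrightarrow> (\<Sum>x\<in>S. (cmod (f x))\<^sup>2) \<le> b)"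
proof
  assume s: "(\<lambda>x. (cmod (f x))\<^sup>2) summable_on UNIV"
  show "\<exists>b. \<forall>S. finite S \<longrightarrow> (\<Sum>x\<in>S. (cmod (f x))\<^sup>2) \<le> b"
    by (intro exI[of _ "infsum (\<lambda>x. (cmod (f x))\<^sup>2) UNIV"] allI impI finite_sum_le_infsum[OF s]) auto
next
  assume "\<exists>b. \<forall>S. finite S \<longrightarrow> (\<Sum>x\<in>S. (cmod (f x))\<^sup>2) \<le> b"
  then show "(\<lambda>x. (cmod (f x))\<^sup>2) summable_on UNIV"
    by (intro nonneg_bdd_above_summable_on) (auto simp: bdd_above_def)
qed

lemma cmod_add_sq_le: "(cmod (a + b))\<^sup>2 \<le> 2 * (cmod a)\<^sup>2 + 2 * (cmod b)\<^sup>2"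
proof -
  have "(cmod (a + b))\<^sup>2 \<le> (cmod a + cmod b)\<^sup>2" by (intro power_mono norm_triangle_ineq) auto
  then show ?thesis using zero_le_power2[of "cmod a - cmod b"] by (simp add: power2_eq_square algebra_simps)
qed

lemma sq_summable_add:
  assumes "(\<lambda>x. (cmod (f x))\<^sup>2) summable_on UNIV" "(\<lambda>x. (cmod (g x))\<^sup>2) summable_on UNIV"
  shows "(\<lambda>x. (cmod (f x + g x))\<^sup>2) summable_on UNIV"
  by (rule summable_on_comparison_test[OF summable_on_add[OF summable_on_cmult_right[OF assms(1), of 2]
          summable_on_cmult_right[OF assms(2), of 2]]]) (auto simp: cmod_add_sq_le)

lemma sq_summable_cmult:
  assumes "(\<lambda>x. (cmod (f x))\<^sup>2) summable_on UNIV"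
  shows "(\<lambda>x. (cmod (c * f x))\<^sup>2) summable_on UNIV"
  using summable_on_cmult_right[OF assms, of "(cmod c)\<^sup>2"] by (simp add: norm_mult power_mult_distrib)

lemma sq_summable_prod:
  assumes "(\<lambda>x. (cmod (f x))\<^sup>2) summable_on UNIV" "(\<lambda>x. (cmod (g x))\<^sup>2) summable_on UNIV"
  shows "(\<lambda>x. cnj (f x) * g x) summable_on UNIV"
proof (rule abs_summable_summable, rule summable_on_comparison_test[OF summable_on_add[OF assms]])
  fix x
  show "norm (cnj (f x) * g x) \<le> (cmod (f x))\<^sup>2 + (cmod (g x))\<^sup>2"
    using sum_squares_bound[of "cmod (f x)" "cmod (g x)"]
      mult_nonneg_nonneg[OF norm_ge_zero[of "f x"] norm_ge_zero[of "g x"]]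
    unfolding norm_mult complex_mod_cnj by linarith
qed auto

setup_lifting type_definition_l2

instantiation l2 :: (type) real_vector
begin

lift_definition zero_l2 :: "'a l2" is "\<lambda>_. 0" by simp
lift_definition plus_l2 :: "'a l2 \<Rightarrow> 'a l2 \<Rightarrow> 'a l2" is "\<lambda>f g x. f x + g x" by (rule sq_summable_add)
lift_definition uminus_l2 :: "'a l2 \<Rightarrow> 'a l2" is "\<lambda>f x. - f x" by simp
lift_definition minus_l2 :: "'a l2 \<Rightarrow> 'a l2 \<Rightarrow> 'a l2" is "\<lambda>f g x. f x - g x"
  using sq_summable_add[of _ "\<lambda>x. - _ x"] by simp
lift_definition scaleR_l2 :: "real \<Rightarrow> 'a l2 \<Rightarrow> 'a l2" is "\<lambda>r f x. of_real r * f x"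
  by (rule sq_summable_cmult)

instance
proof
  fix f g h :: "'a l2" and a b :: real
  show "f + g + h = f + (g + h)" by transfer (simp add: add.assoc)
  show "f + g = g + f" by transfer (simp add: add.commute)
  show "0 + f = f" by transfer simp
  show "- f + f = 0" by transfer simp
  show "f - g = f + - g" by transfer simp
  show "a *\<^sub>R (f + g) = a *\<^sub>R f + a *\<^sub>R g" by transfer (simp add: algebra_simps)
  show "(a + b) *\<^sub>R f = a *\<^sub>R f + b *\<^sub>R f" by transfer (simp add: algebra_simps)
  show "a *\<^sub>R b *\<^sub>R f = (a * b) *\<^sub>R f" by transfer (simp add: algebra_simps)
  show "1 *\<^sub>R f = f" by transfer simp
qed

end

instantiation l2 :: (type) real_inner
begin

lift_definition inner_l2 :: "'a l2 \<Rightarrow> 'a l2 \<Rightarrow> real" is "\<lambda>f g. \<Sum>\<^sub>\<infinity>x. Re (cnj (f x) * g x)" .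
definition norm_l2 :: "'a l2 \<Rightarrow> real" where "norm_l2 f = sqrt (inner f f)"
definition dist_l2 :: "'a l2 \<Rightarrow> 'a l2 \<Rightarrow> real" where "dist_l2 f g = norm (f - g)"
definition sgn_l2 :: "'a l2 \<Rightarrow> 'a l2" where "sgn_l2 f = inverse (norm f) *\<^sub>R f"
definition uniformity_l2 :: "('a l2 \<times> 'a l2) filter" where
  "uniformity_l2 = (INF e\<in>{0<..}. principal {(x, y). dist x y < e})"
definition open_l2 :: "'a l2 set \<Rightarrow> bool" where
  "open_l2 U = (\<forall>x\<in>U. eventually (\<lambda>(x', y). x' = x \<longrightarrow> y \<in> U) uniformity)"

instance
proof
  fix f g h :: "'a l2" and a b :: real
  show "inner f g = inner g f"
    by transfer (rule infsum_cong, simp add: mult.commute)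
  show "inner (f + g) h = inner f h + inner g h"
  proof (transfer, goal_cases)
    case (1 f g h)
    have "(\<Sum>\<^sub>\<infinity>x. Re (cnj (f x + g x) * h x)) = (\<Sum>\<^sub>\<infinity>x. Re (cnj (f x) * h x) + Re (cnj (g x) * h x))"
      by (rule infsum_cong) (simp add: algebra_simps)
    also have "\<dots> = (\<Sum>\<^sub>\<infinity>x. Re (cnj (f x) * h x)) + (\<Sum>\<^sub>\<infinity>x. Re (cnj (g x) * h x))"
      using 1 by (intro infsum_add summable_on_Re sq_summable_prod) auto
    finally show ?case .
  qed
  show "inner (a *\<^sub>R f) g = a * inner f g"
  proof (transfer, goal_cases)
    case (1 a f g)
    have "(\<Sum>\<^sub>\<infinity>x. Re (cnj (of_real a * f x) * g x)) = (\<Sum>\<^sub>\<infinity>x. a * Re (cnj (f x) * g x))"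
      by (rule infsum_cong) (simp add: algebra_simps)
    then show ?case by (simp add: infsum_cmult_right')
  qed
  show "0 \<le> inner f f"
    by transfer (rule infsum_nonneg, simp)
  show "inner f f = 0 \<longleftrightarrow> f = 0"
  proof (transfer, goal_cases)
    case (1 f)
    have eq: "Re (cnj (f x) * f x) = (cmod (f x))\<^sup>2" for x
      unfolding cmod_power2 by (simp add: power2_eq_square)
    show ?case unfolding eq
    proof
      assume "(\<Sum>\<^sub>\<infinity>x. (cmod (f x))\<^sup>2) = 0"
      then have "(cmod (f x))\<^sup>2 = 0" for x
        using nonneg_infsum_le_0D[of "\<lambda>x. (cmod (f x))\<^sup>2" UNIV x] 1 by simp
      then show "f = (\<lambda>_. 0)" by (intro ext) simp
    qed simp
  qed
  show "norm f = sqrt (inner f f)" by (rule norm_l2_def)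
  show "dist f g = norm (f - g)" by (rule dist_l2_def)
  show "sgn f = f /\<^sub>R norm f" by (rule sgn_l2_def)
  show "uniformity = (INF e\<in>{0<..}. principal {(x::'a l2, y). dist x y < e})" by (rule uniformity_l2_def)
  show "open U \<longleftrightarrow> (\<forall>x\<in>U. \<forall>\<^sub>F (x', y) in uniformity. x' = x \<longrightarrow> y \<in> U)" for U :: "'a l2 set"
    by (rule open_l2_def)
qed

end

lift_definition cscale :: "complex \<Rightarrow> 'v l2 \<Rightarrow> 'v l2" is "\<lambda>c f x. c * f x" by (rule sq_summable_cmult)
lift_definition cip :: "'v l2 \<Rightarrow> 'v l2 \<Rightarrow> complex" is "\<lambda>f g. \<Sum>\<^sub>\<infinity>x. cnj (f x) * g x" .
lift_definition basis :: "'v \<Rightarrow> 'v l2" is "\<lambda>x y. if y = x then 1 else 0"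
  by (rule finite_nonzero_values_imp_summable_on, rule finite_subset[of _ "{_}"]) auto
lift_definition trunc :: "'v set \<Rightarrow> 'v l2 \<Rightarrow> 'v l2" is "\<lambda>S f x. if x \<in> S then f x else 0"
  by (rule summable_on_comparison_test) auto

lemma coord_simps [simp]:
  "coord 0 x = 0" "coord (f + g) x = coord f x + coord g x" "coord (f - g) x = coord f x - coord g x"
  "coord (- f) x = - coord f x" "coord (r *\<^sub>R f) x = of_real r * coord f x"
  "coord (cscale c f) x = c * coord f x" "coord (basis y) x = (if x = y then 1 else 0)"
  "coord (trunc S f) x = (if x \<in> S then coord f x else 0)"
  by (transfer, simp)+

lemma coord_sum [simp]: "coord (sum f A) x = (\<Sum>a\<in>A. coord (f a) x)"
  by (induction A rule: infinite_finite_induct) auto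

lemma l2_eqI: "(\<And>x. coord f x = coord g x) \<Longrightarrow> f = g"
  by transfer auto

lemma coord_Abs_l2: "(\<lambda>x. (cmod (f x))\<^sup>2) summable_on UNIV \<Longrightarrow> coord (Abs_l2 f) = f"
  by (simp add: Abs_l2_inverse)

lemma coord_summable: "(\<lambda>x. (cmod (coord f x))\<^sup>2) summable_on UNIV"
  using coord[of f] by simp

lemma cip_summable: "(\<lambda>x. cnj (coord f x) * coord g x) summable_on UNIV"
  by (intro sq_summable_prod coord_summable)

lemma cip_eq: "cip f g = (\<Sum>\<^sub>\<infinity>x. cnj (coord f x) * coord g x)"
  by transfer simp

lemma Re_cip: "Re (cip f g) = inner f g"
  unfolding cip_eq inner_l2.rep_eq by (rule infsum_Re[symmetric]) (rule cip_summable)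

lemma cip_add_right: "cip f (g + h) = cip f g + cip f h"
  unfolding cip_eq using infsum_add[OF cip_summable[of f g] cip_summable[of f h]]
  by (simp add: algebra_simps)

lemma cip_cscale_right [simp]: "cip f (cscale c g) = c * cip f g"
  unfolding cip_eq coord_simps mult.left_commute[of _ c] by (rule infsum_cmult_right')

lemma cip_commute: "cip f g = cnj (cip g f)"
proof -
  have "cip f g = (\<Sum>\<^sub>\<infinity>x. cnj (cnj (coord g x) * coord f x))"
    unfolding cip_eq by (rule infsum_cong) (simp add: mult.commute)
  also have "\<dots> = cnj (cip g f)" unfolding cip_eq by (rule infsum_cnj)
  finally show ?thesis .
qed

lemma cip_cscale_left [simp]: "cip (cscale c f) g = cnj c * cip f g"
  by (metis cip_commute cip_cscale_right complex_cnj_mult complex_cnj_cnj)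

lemma cip_add_left: "cip (f + g) h = cip f h + cip g h"
  by (metis cip_add_right cip_commute complex_cnj_add)

lemma cscale_of_real: "cscale (of_real r) f = r *\<^sub>R f"
  by (rule l2_eqI) simp

lemma cip_diff_right: "cip f (g - h) = cip f g - cip f h"
  using cip_add_right[of f "g - h" h] by simp

lemma cip_zero_right: "cip f 0 = 0"
  using cip_diff_right[of f 0 0] by simp

lemma cip_sum_right: "cip f (sum g A) = (\<Sum>a\<in>A. cip f (g a))"
  by (induction A rule: infinite_finite_induct) (simp_all add: cip_add_right cip_zero_right)

lemma cip_basis: "cip (basis x) f = coord f x"
proof -
  have "cip (basis x) f = (\<Sum>\<^sub>\<infinity>y\<in>{x}. coord f y)"
    unfolding cip_eq by (rule infsum_cong_neutral) auto
  then show ?thesis by simp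
qed

lemma Im_cip: "Im (cip f g) = inner (cscale \<i> f) g"
  by (simp flip: Re_cip)

lemma cip_self: "cip f f = of_real ((norm f)\<^sup>2)"
proof -
  have "Im (cip f f) = 0" using arg_cong[OF cip_commute[of f f], of Im] by simp
  then show ?thesis using Re_cip[of f f] by (simp add: complex_eq_iff power2_norm_eq_inner)
qed

lemma norm_l2_sq: "(norm f)\<^sup>2 = (\<Sum>\<^sub>\<infinity>x. (cmod (coord f x))\<^sup>2)"
proof -
  have "(norm f)\<^sup>2 = (\<Sum>\<^sub>\<infinity>x. Re (cnj (coord f x) * coord f x))"
    by (simp only: power2_norm_eq_inner inner_l2.rep_eq)
  also have "\<dots> = (\<Sum>\<^sub>\<infinity>x. (cmod (coord f x))\<^sup>2)"
    by (rule infsum_cong, unfold cmod_power2) (simp add: power2_eq_square)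
  finally show ?thesis .
qed

lemma norm_cscale [simp]: "norm (cscale c f) = cmod c * norm f"
proof -
  have "(norm (cscale c f))\<^sup>2 = (cmod c * norm f)\<^sup>2"
    unfolding norm_l2_sq power_mult_distrib
    by (simp add: norm_mult power_mult_distrib infsum_cmult_right')
  then show ?thesis by simp
qed

lemma norm_cip_le: "cmod (cip f g) \<le> norm f * norm g"
proof (cases "cip f g = 0")
  case False
  \<comment> \<open>The phase that makes the complex product real and nonnegative, so that the real
    Cauchy-Schwarz inequality applies.\<close>
  define u where "u = cnj (sgn (cip f g))"
  have "of_real (cmod (cip f g)) = u * cip f g"
    using False 
    by (simp add: u_def sgn_eq complex_norm_square[symmetric] power2_eq_square mult.commute[of "cnj _"])
  then have "cmod (cip f g) = Re (cip f (cscale u g))" by (metis Re_complex_of_real cip_cscale_right)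
  also have "\<dots> \<le> norm f * norm (cscale u g)" unfolding Re_cip by (rule norm_cauchy_schwarz)
  also have "\<dots> = norm f * norm g" using False by (simp add: u_def norm_sgn)
  finally show ?thesis .
qed simp

lemma sum_coord_le: "finite S \<Longrightarrow> (\<Sum>x\<in>S. (cmod (coord f x))\<^sup>2) \<le> (norm f)\<^sup>2"
  unfolding norm_l2_sq by (rule finite_sum_le_infsum[OF coord_summable]) auto

lemma norm_l2_leI:
  assumes "\<And>S. finite S \<Longrightarrow> (\<Sum>x\<in>S. (cmod (coord f x))\<^sup>2) \<le> b"
  shows "(norm f)\<^sup>2 \<le> b"
  unfolding norm_l2_sq by (rule infsum_le_finite_sums[OF coord_summable]) (use assms in auto)

lemma norm_basis [simp]: "norm (basis x) = 1"
proof -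
  have "(norm (basis x))\<^sup>2 = (1::real)" 
    using arg_cong[OF cip_basis[of x "basis x"], of Re] unfolding cip_self Re_complex_of_real by simp
  then show ?thesis using norm_ge_zero[of "basis x"] by (simp only: power2_eq_1_iff) linarith
qed

lemma cmod_coord_le: "cmod (coord f x) \<le> norm f"
  using norm_cip_le[of "basis x" f] by (simp add: cip_basis)

instance l2 :: (type) banach
proof
  fix X :: "nat \<Rightarrow> 'a l2" assume X: "Cauchy X"
  have "Cauchy (\<lambda>n. coord (X n) x)" for x
  proof (rule metric_CauchyI)
    fix e :: real assume "0 < e"
    then obtain N where N: "\<forall>m\<ge>N. \<forall>n\<ge>N. dist (X m) (X n) < e" using X by (meson metric_CauchyD)
    have "dist (coord (X m) x) (coord (X n) x) < e" if "m \<ge> N" "n \<ge> N" for m n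
    proof -
      have "dist (coord (X m) x) (coord (X n) x) \<le> dist (X m) (X n)"
        using cmod_coord_le[of "X m - X n" x] by (simp add: dist_norm)
      also have "\<dots> < e" using N that by blast
      finally show ?thesis .
    qed
    then show "\<exists>N. \<forall>m\<ge>N. \<forall>n\<ge>N. dist (coord (X m) x) (coord (X n) x) < e" by blast
  qed
  then obtain L where L: "\<And>x. (\<lambda>n. coord (X n) x) \<longlonglongrightarrow> L x"
    unfolding Cauchy_convergent_iff convergent_def by metis
  \<comment> \<open>The Cauchy estimate passes to the coordinatewise limit on each finite set with a
    bound independent of the set; this gives both membership of \<open>L\<close> and convergence in
    norm.\<close>
  have fin: "(\<Sum>x\<in>S. (cmod (coord (X n) x - L x))\<^sup>2) \<le> e\<^sup>2"
    if "finite S" and N: "\<forall>k\<ge>N. norm (X n - X k) \<le> e" for S n N e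
  proof (rule LIMSEQ_le_const2)
    show "(\<lambda>k. \<Sum>x\<in>S. (cmod (coord (X n) x - coord (X k) x))\<^sup>2)
       \<longlonglongrightarrow> (\<Sum>x\<in>S. (cmod (coord (X n) x - L x))\<^sup>2)"
      by (intro tendsto_intros L)
    have "(\<Sum>x\<in>S. (cmod (coord (X n) x - coord (X k) x))\<^sup>2) \<le> e\<^sup>2" if "k \<ge> N" for k
    proof -
      have "(norm (X n - X k))\<^sup>2 \<le> e\<^sup>2" using N that by (intro power_mono) auto
      then show ?thesis using sum_coord_le[OF \<open>finite S\<close>, of "X n - X k"] by simp
    qed
    then show "\<exists>N. \<forall>k\<ge>N. (\<Sum>x\<in>S. (cmod (coord (X n) x - coord (X k) x))\<^sup>2) \<le> e\<^sup>2" by blast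
  qed
  have tail: "\<exists>N. \<forall>n\<ge>N. \<forall>k\<ge>N. norm (X n - X k) \<le> e" if "0 < e" for e
    using metric_CauchyD[OF X that] by (auto simp: dist_norm intro: less_imp_le)
  obtain N1 where N1: "\<forall>n\<ge>N1. \<forall>k\<ge>N1. norm (X n - X k) \<le> 1" using tail[of 1] by auto
  have d: "(\<lambda>x. (cmod (L x - coord (X N1) x))\<^sup>2) summable_on UNIV"
    unfolding sq_summable_iff using fin[of _ N1 N1 1] N1 by (auto simp: norm_minus_commute)
  have "(\<lambda>x. (cmod (L x))\<^sup>2) summable_on UNIV"
    using sq_summable_add[OF d coord_summable[of "X N1"]] by simp
  then have cL: "coord (Abs_l2 L) = L" by (rule coord_Abs_l2)
  have "X \<longlonglongrightarrow> Abs_l2 L"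
  proof (rule metric_LIMSEQ_I)
    fix e :: real assume e: "0 < e"
    obtain N where N: "\<forall>n\<ge>N. \<forall>k\<ge>N. norm (X n - X k) \<le> e / 2" using tail[of "e / 2"] e by auto
    have "dist (X n) (Abs_l2 L) < e" if "n \<ge> N" for n
    proof -
      have "(norm (X n - Abs_l2 L))\<^sup>2 \<le> (e / 2)\<^sup>2"
        by (rule norm_l2_leI) (use fin[of _ N n "e / 2"] N that in \<open>auto simp: cL\<close>)
      then have "norm (X n - Abs_l2 L) \<le> e / 2" by (rule power2_le_imp_le) (use e in simp)
      then show ?thesis using e by (simp add: dist_norm)
    qed
    then show "\<exists>N. \<forall>n\<ge>N. dist (X n) (Abs_l2 L) < e" by blast
  qed
  then show "convergent X" by (auto simp: convergent_def)
qed

lemma bounded_linear_cscale: "bounded_linear (cscale c)"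
  by (rule bounded_linear_intro[where K = "cmod c"])
    (auto intro!: l2_eqI simp: algebra_simps)

lemma tendsto_cip:
  assumes "(f \<longlongrightarrow> a) F" "(g \<longlongrightarrow> b) F"
  shows "((\<lambda>n. cip (f n) (g n)) \<longlongrightarrow> cip a b) F"
  unfolding tendsto_complex_iff Re_cip Im_cip
  by (intro conjI tendsto_inner assms bounded_linear.tendsto[OF bounded_linear_cscale])

lemma cip_finite_support:
  assumes "finite S" "\<And>x. x \<notin> S \<Longrightarrow> coord f x = 0"
  shows "cip f g = (\<Sum>x\<in>S. cnj (coord f x) * coord g x)"
proof -
  have "cip f g = (\<Sum>\<^sub>\<infinity>x\<in>S. cnj (coord f x) * coord g x)"
    unfolding cip_eq by (rule infsum_cong_neutral) (use assms in auto)
  then show ?thesis using assms by simp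
qed

lemma trunc_approx:
  assumes "0 < e"
  obtains S where "finite S" "norm (f - trunc S f) < e"
proof -
  have "\<exists>S. finite S \<and> (norm f)\<^sup>2 - e\<^sup>2 / 2 < (\<Sum>x\<in>S. (cmod (coord f x))\<^sup>2)"
  proof (rule ccontr)
    assume "\<not> ?thesis"
    then have "(norm f)\<^sup>2 \<le> (norm f)\<^sup>2 - e\<^sup>2 / 2" by (intro norm_l2_leI) (auto simp: not_less)
    then show False using assms by simp
  qed
  then obtain S where S: "finite S" "(norm f)\<^sup>2 - e\<^sup>2 / 2 < (\<Sum>x\<in>S. (cmod (coord f x))\<^sup>2)" by blast
  have "(norm (f - trunc S f))\<^sup>2 \<le> e\<^sup>2 / 2"
  proof (rule norm_l2_leI)
    fix U :: "'a set" assume U: "finite U"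
    have "(\<Sum>x\<in>U. (cmod (coord (f - trunc S f) x))\<^sup>2) = (\<Sum>x\<in>U - S. (cmod (coord f x))\<^sup>2)"
      using U by (intro sum.mono_neutral_cong_right) auto
    also have "\<dots> = (\<Sum>x\<in>U \<union> S. (cmod (coord f x))\<^sup>2) - (\<Sum>x\<in>S. (cmod (coord f x))\<^sup>2)"
      using U S(1) sum.union_disjoint[of "U - S" S "\<lambda>x. (cmod (coord f x))\<^sup>2"] by (simp add: Diff_Int_distrib2 Int_commute)
    also have "\<dots> \<le> e\<^sup>2 / 2" using sum_coord_le[of "U \<union> S" f] U S by simp
    finally show "(\<Sum>x\<in>U. (cmod (coord (f - trunc S f) x))\<^sup>2) \<le> e\<^sup>2 / 2" .
  qed
  then have "(norm (f - trunc S f))\<^sup>2 < e\<^sup>2" using zero_less_power[OF assms, of 2] by linarith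
  then have "norm (f - trunc S f) < e" by (rule power2_less_imp_less) (use assms in simp)
  with S(1) show ?thesis by (rule that)
qed

lemma finite_support_dense:
  obtains u :: "nat \<Rightarrow> 'v l2" where "\<And>n. finite {x. coord (u n) x \<noteq> 0}" "u \<longlonglongrightarrow> f"
proof -
  have "\<exists>S. finite S \<and> norm (f - trunc S f) < 1 / real (Suc n)" for n
    using trunc_approx[of "1 / real (Suc n)" f] by auto
  then obtain S where S: "\<And>n. finite (S n)" "\<And>n. norm (f - trunc (S n) f) < 1 / real (Suc n)"
    by metis
  have "(\<lambda>n. trunc (S n) f - f) \<longlonglongrightarrow> 0"
  proof (rule Lim_null_comparison[OF always_eventually])
    show "\<forall>n. norm (trunc (S n) f - f) \<le> 1 / real (Suc n)"
      using S(2) by (simp add: norm_minus_commute less_imp_le)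
    show "(\<lambda>n. 1 / real (Suc n)) \<longlonglongrightarrow> 0"
      using LIMSEQ_inverse_real_of_nat by (simp only: inverse_eq_divide)
  qed
  then have lim: "(\<lambda>n. trunc (S n) f) \<longlonglongrightarrow> f" by (simp add: LIM_zero_iff)
  have "finite {x. coord (trunc (S n) f) x \<noteq> 0}" for n
    by (rule finite_subset[OF _ S(1)[of n]]) auto
  then show ?thesis using lim by (rule that)
qed

section \<open>Weak convergence and complete continuity\<close>

text \<open>Bounded coordinatewise null sequences are the weakly null ones, and complete continuity
  (weakly null to norm null) stands in for compactness.\<close>

definition wnull :: "(nat \<Rightarrow> 'v l2) \<Rightarrow> bool" where
  "wnull f \<longleftrightarrow> (\<exists>b. \<forall>n. norm (f n) \<le> b) \<and> (\<forall>x. (\<lambda>n. coord (f n) x) \<longlonglongrightarrow> 0)"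

definition ccont :: "('v l2 \<Rightarrow> 'v l2) \<Rightarrow> bool" where
  "ccont K \<longleftrightarrow> (\<forall>f. wnull f \<longrightarrow> (\<lambda>n. K (f n)) \<longlonglongrightarrow> 0)"

lemma wnull_cip:
  assumes "wnull f"
  shows "(\<lambda>n. cip g (f n)) \<longlonglongrightarrow> 0"
proof (rule LIMSEQ_I)
  obtain b where b: "\<And>n. norm (f n) \<le> b" and c: "\<And>x. (\<lambda>n. coord (f n) x) \<longlonglongrightarrow> 0"
    using assms unfolding wnull_def by blast
  have b0: "0 \<le> b" using b[of 0] norm_ge_zero order_trans by blast
  fix e :: real assume e: "0 < e"
  define d where "d = e / (2 * (b + 1))"
  have d: "0 < d" "d * b < e / 2"
    using e b0 by (auto simp: d_def field_simps)
  obtain S where S: "finite S" "norm (g - trunc S g) < d" using trunc_approx[OF d(1)] by blast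
  have "(\<lambda>n. \<Sum>x\<in>S. cnj (coord g x) * coord (f n) x) \<longlonglongrightarrow> (\<Sum>x\<in>S. cnj (coord g x) * 0)"
    by (intro tendsto_intros c)
  then have "(\<lambda>n. \<Sum>x\<in>S. cnj (coord g x) * coord (f n) x) \<longlonglongrightarrow> 0" by simp
  then obtain N where N: "\<And>n. n \<ge> N \<Longrightarrow> cmod (\<Sum>x\<in>S. cnj (coord g x) * coord (f n) x) < e / 2"
    using LIMSEQ_D[of _ 0 "e / 2"] e by auto
  have "norm (cip g (f n) - 0) < e" if "n \<ge> N" for n
  proof -
    have "g = trunc S g + (g - trunc S g)" by simp
    then have "cip g (f n) = cip (trunc S g) (f n) + cip (g - trunc S g) (f n)"
      by (metis cip_add_left)
    moreover have "cip (trunc S g) (f n) = (\<Sum>x\<in>S. cnj (coord g x) * coord (f n) x)"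
      by (subst cip_finite_support[OF S(1)]) auto
    moreover have "cmod (cip (g - trunc S g) (f n)) \<le> d * b" (is "cmod ?r \<le> _")
      by (rule order_trans[OF norm_cip_le], rule mult_mono) (use S b b0 d in auto)
    ultimately have "cmod (cip g (f n)) \<le> cmod (\<Sum>x\<in>S. cnj (coord g x) * coord (f n) x) + d * b"
      using norm_triangle_ineq[of "cip (trunc S g) (f n)" ?r] by simp
    then show ?thesis using N[OF that] d by simp
  qed
  then show "\<exists>N. \<forall>n\<ge>N. norm (cip g (f n) - 0) < e" by blast
qed

lemma wnull_inner: "wnull f \<Longrightarrow> (\<lambda>n. inner g (f n)) \<longlonglongrightarrow> 0"
  using tendsto_Re[OF wnull_cip] by (simp add: Re_cip)

lemma wnullI:
  assumes "\<And>n. norm (f n) \<le> b" and lim: "\<And>g. (\<lambda>n. inner g (f n)) \<longlonglongrightarrow> 0"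
  shows "wnull f"
proof -
  have "(\<lambda>n. coord (f n) x) \<longlonglongrightarrow> 0" for x
    unfolding cip_basis[symmetric] tendsto_complex_iff Re_cip Im_cip using lim by simp
  then show ?thesis using assms(1) unfolding wnull_def by blast
qed

lemma bsym_bound:
  assumes "bsym T"
  obtains M where "0 < M" "\<And>x. norm (T x) \<le> M * norm x"
  using bounded_linear.pos_bounded[OF bsym_bounded_linear[OF assms]] by (metis mult.commute)

lemma wnull_bsym:
  assumes T: "bsym T" and f: "wnull f"
  shows "wnull (\<lambda>n. T (f n))"
proof -
  obtain b where b: "\<And>n. norm (f n) \<le> b" using f unfolding wnull_def by blast
  obtain M where M: "0 < M" "\<And>x. norm (T x) \<le> M * norm x" using bsym_bound[OF T] by blast
  show ?thesis
  proof (rule wnullI)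
    fix n show "norm (T (f n)) \<le> M * b"
      using M(2)[of "f n"] b[of n] M(1) by (meson mult_left_mono less_imp_le order_trans)
  next
    fix g
    show "(\<lambda>n. inner g (T (f n))) \<longlonglongrightarrow> 0"
      using wnull_inner[OF f, of "T g"] by (simp add: bsymD[OF T])
  qed
qed

lemma wnull_perturb:
  assumes f: "wnull f" and d: "(\<lambda>n. g n - f n) \<longlonglongrightarrow> 0"
  shows "wnull g"
proof -
  obtain b where b: "\<And>n. norm (f n) \<le> b" using f unfolding wnull_def by blast
  have "Bseq (\<lambda>n. g n - f n)" using d by (intro convergent_imp_Bseq) (auto simp: convergent_def)
  then obtain K where K: "\<And>n. norm (g n - f n) \<le> K" unfolding Bseq_def by blast
  show ?thesis
  proof (rule wnullI)
    fix n show "norm (g n) \<le> K + b"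
      using norm_triangle_ineq[of "g n - f n" "f n"] K[of n] b[of n] by simp
  next
    fix h
    have "(\<lambda>n. inner h (g n - f n) + inner h (f n)) \<longlonglongrightarrow> inner h 0 + 0"
      by (intro tendsto_add tendsto_inner tendsto_const d wnull_inner f)
    then show "(\<lambda>n. inner h (g n)) \<longlonglongrightarrow> 0" by (simp add: inner_diff_right)
  qed
qed

text \<open>Countability of the vertex set gives a diagonal subsequence that converges in every
  coordinate; bounds on finite partial sums put the limit into the space.\<close>

lemma weak_compactness:
  fixes f :: "nat \<Rightarrow> 'v::countable l2"
  assumes b: "\<And>n. norm (f n) \<le> b"
  obtains r l where "strict_mono (r :: nat \<Rightarrow> nat)" "wnull (\<lambda>n. f (r n) - l)"
proof -
  have bd: "cmod (coord (f n) x) \<le> b" if "x \<in> UNIV" for n x by (rule order_trans[OF cmod_coord_le b])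
  have "\<exists>r. strict_mono (r::nat\<Rightarrow>nat) \<and> (\<forall>x. \<exists>l. (\<lambda>n. coord (f (r n)) x) \<longlonglongrightarrow> l)"
  proof (rule function_convergent_subsequence[of "UNIV :: 'v set" "\<lambda>n. coord (f n)" b, OF countableI_type bd])
    fix r assume "strict_mono (r::nat\<Rightarrow>nat)" "\<And>x. x \<in> UNIV \<Longrightarrow> \<exists>l. (\<lambda>n. coord (f (r n)) x) \<longlonglongrightarrow> l"
    then show ?thesis by (intro exI[of _ r]) simp
  qed
  then obtain r where r: "strict_mono (r::nat\<Rightarrow>nat)" "\<And>x. \<exists>l. (\<lambda>n. coord (f (r n)) x) \<longlonglongrightarrow> l"
    by blast
  then obtain L where L: "\<And>x. (\<lambda>n. coord (f (r n)) x) \<longlonglongrightarrow> L x" by metis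
  have fin: "(\<Sum>x\<in>S. (cmod (L x))\<^sup>2) \<le> b\<^sup>2" if S: "finite S" for S
  proof (rule LIMSEQ_le_const2)
    show "(\<lambda>n. \<Sum>x\<in>S. (cmod (coord (f (r n)) x))\<^sup>2) \<longlonglongrightarrow> (\<Sum>x\<in>S. (cmod (L x))\<^sup>2)"
      by (intro tendsto_intros L)
    have "(norm (f (r n)))\<^sup>2 \<le> b\<^sup>2" for n by (intro power_mono b) auto
    then show "\<exists>N. \<forall>n\<ge>N. (\<Sum>x\<in>S. (cmod (coord (f (r n)) x))\<^sup>2) \<le> b\<^sup>2"
      using order_trans[OF sum_coord_le[OF S]] by blast
  qed
  then have "(\<lambda>x. (cmod (L x))\<^sup>2) summable_on UNIV" unfolding sq_summable_iff by blast
  then have cL: "coord (Abs_l2 L) = L" by (rule coord_Abs_l2)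
  have "wnull (\<lambda>n. f (r n) - Abs_l2 L)"
    unfolding wnull_def
  proof (intro conjI allI exI)
    fix n show "norm (f (r n) - Abs_l2 L) \<le> b + norm (Abs_l2 L)"
      using norm_triangle_ineq4[of "f (r n)" "Abs_l2 L"] b[of "r n"] by linarith
  next
    fix x show "(\<lambda>n. coord (f (r n) - Abs_l2 L) x) \<longlonglongrightarrow> 0"
      using L[of x] by (simp add: cL LIM_zero)
  qed
  with r(1) show ?thesis by (rule that)
qed

text \<open>Douglas' range inclusion: regularise the equation \<open>P h = R g\<close> by \<open>P\<^sup>2 + 1/n\<close> and take a weak limit.\<close>

lemma bsym_range_subset:
  fixes P R :: "'v::countable l2 \<Rightarrow> 'v l2"
  assumes R: "bsym R" and P: "bsym P" and K: "\<And>x. norm (R x) \<le> K * norm (P x)"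
  shows "range R \<subseteq> range P"
proof clarify
  fix g0
  interpret P: bounded_linear P using P by (rule bsym_bounded_linear)
  define f where "f = R g0"
  define h where "h = (\<lambda>n::nat. 1 / real (Suc n))"
  have h0: "0 < h n" for n by (simp add: h_def)
  have "\<exists>k. P (P k) + h n *\<^sub>R k = f" for n
  proof -
    have "bij (\<lambda>k. P (P k) + h n *\<^sub>R k)"
    proof (rule lax_milgram[where c = "h n"])
      show "bounded_linear (\<lambda>k. P (P k) + h n *\<^sub>R k)"
        by (intro bounded_linear_add bounded_linear_compose[OF P.bounded_linear_axioms]
            P.bounded_linear_axioms bounded_linear_scaleR_right)
      fix k show "h n * (norm k)\<^sup>2 \<le> inner (P (P k) + h n *\<^sub>R k) k"
        using bsymD[OF P, of "P k" k] by (simp add: inner_add_left dot_square_norm)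
    qed (rule h0)
    from surjD[OF bij_is_surj[OF this], of f] show ?thesis by metis
  qed
  then obtain k where k: "\<And>n. P (P (k n)) + h n *\<^sub>R k n = f" by metis
  define L where "L = \<bar>K\<bar> * norm g0"
  have L0: "0 \<le> L" by (simp add: L_def)
  \<comment> \<open>Pair the regularised equation with \<open>k n\<close>. Symmetry moves
    \<open>R\<close> onto \<open>k n\<close>, where the hypothesis compares it with
    \<open>P (k n)\<close>.\<close>
  have en: "(norm (P (k n)))\<^sup>2 + h n * (norm (k n))\<^sup>2 \<le> L * norm (P (k n))" for n
  proof -
    have "(norm (P (k n)))\<^sup>2 + h n * (norm (k n))\<^sup>2 = inner (P (P (k n)) + h n *\<^sub>R k n) (k n)"
      using bsymD[OF P, of "P (k n)" "k n"] by (simp add: inner_add_left dot_square_norm)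
    also have "\<dots> = inner g0 (R (k n))" by (simp add: k f_def bsymD[OF R])
    also have "\<dots> \<le> norm g0 * norm (R (k n))" by (rule norm_cauchy_schwarz)
    also have "\<dots> \<le> norm g0 * (\<bar>K\<bar> * norm (P (k n)))"
      using K[of "k n"] by (intro mult_left_mono order_trans[OF K] mult_right_mono) auto
    finally show ?thesis by (simp add: L_def mult_ac)
  qed
  have Pk: "norm (P (k n)) \<le> L" for n
  proof (cases "P (k n) = 0")
    case False
    have "norm (P (k n)) * norm (P (k n)) \<le> L * norm (P (k n))"
      using en[of n] mult_nonneg_nonneg[OF less_imp_le[OF h0] zero_le_power2[of "norm (k n)"], of n]
      by (simp add: power2_eq_square)
    then show ?thesis by (rule mult_right_le_imp_le) (use False in simp)
  qed (simp add: L0)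
  have "(\<lambda>n. h n *\<^sub>R k n) \<longlonglongrightarrow> 0"
  proof (rule tendsto_zero_of_norm_sq_le)
    fix n
    have "h n * (norm (k n))\<^sup>2 \<le> L * L"
      using en[of n] zero_le_power2[of "norm (P (k n))"] mult_left_mono[OF Pk[of n] L0] by linarith
    then have "h n * (h n * (norm (k n))\<^sup>2) \<le> h n * (L * L)"
      using h0[of n] by (intro mult_left_mono) auto
    then show "(norm (h n *\<^sub>R k n))\<^sup>2 \<le> h n * (L * L)"
      by (simp add: power2_eq_square mult_ac)
  next
    have "h \<longlonglongrightarrow> 0" unfolding h_def
      using LIMSEQ_inverse_real_of_nat by (simp only: inverse_eq_divide)
    then show "(\<lambda>n. h n * (L * L)) \<longlonglongrightarrow> 0" by (rule tendsto_mult_left_zero)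
  qed
  then have lim: "(\<lambda>n. f - h n *\<^sub>R k n) \<longlonglongrightarrow> f" using tendsto_diff[OF tendsto_const[of f]] by fastforce
  have Pf: "P (P (k n)) = f - h n *\<^sub>R k n" for n using k[of n] by (simp add: algebra_simps)
  obtain r l where r: "strict_mono (r::nat\<Rightarrow>nat)" "wnull (\<lambda>n. P (k (r n)) - l)"
    using weak_compactness[of "\<lambda>n. P (k n)" L] Pk by blast
  have "wnull (\<lambda>n. P (P (k (r n)) - l))" by (rule wnull_bsym[OF P r(2)])
  then have w: "(\<lambda>n. inner g (P (P (k (r n)) - l))) \<longlonglongrightarrow> 0" for g by (rule wnull_inner)
  \<comment> \<open>The vectors \<open>P (P (k (r n)))\<close> tend to \<open>f\<close> in norm,
    because the regularising term vanishes, and to \<open>P l\<close> weakly.\<close>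
  have "inner g f = inner g (P l)" for g
  proof -
    have "(\<lambda>n. inner g (f - h (r n) *\<^sub>R k (r n))) \<longlonglongrightarrow> inner g f"
      using LIMSEQ_subseq_LIMSEQ[OF lim r(1)] by (intro tendsto_inner tendsto_const) (simp add: o_def)
    moreover have "(\<lambda>n. inner g (P (P (k (r n)) - l)) + inner g (P l)) \<longlonglongrightarrow> 0 + inner g (P l)"
      by (intro tendsto_add w tendsto_const)
    then have "(\<lambda>n. inner g (f - h (r n) *\<^sub>R k (r n))) \<longlonglongrightarrow> inner g (P l)"
      by (simp add: P.diff Pf inner_diff_right)
    ultimately show ?thesis by (rule LIMSEQ_unique)
  qed
  then have "f = P l" by (metis inner_commute vector_eq_rdot)
  then show "R g0 \<in> range P" by (simp add: f_def)
qed

subsection \<open>Operators given by kernels with a Schur bound\<close>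

definition kop :: "('v \<Rightarrow> 'v \<Rightarrow> complex) \<Rightarrow> 'v l2 \<Rightarrow> 'v l2" where
  "kop k f = Abs_l2 (\<lambda>x. \<Sum>y\<in>{y. k x y \<noteq> 0}. k x y * coord f y)"

text \<open>The Schur test with test function \<open>w\<close>. The row bound is kept as a function
  \<open>M\<close> besides its supremum \<open>M0\<close>, because decay of \<open>M\<close> at
  infinity is what yields complete continuity.\<close>

locale schur_kernel =
  fixes k :: "'v \<Rightarrow> 'v \<Rightarrow> complex" and e :: "'v \<Rightarrow> 'v \<Rightarrow> real" and w M :: "'v \<Rightarrow> real" and M0 :: real
  assumes w: "\<And>x. 0 < w x" and e_sym: "\<And>x y. e x y = e y x" and e0: "\<And>x y. 0 \<le> e x y"
    and e_fin: "\<And>x. finite {y. e x y \<noteq> 0}"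
    and e_row: "\<And>x. (\<Sum>y\<in>{y. e x y \<noteq> 0}. e x y) \<le> M x * (w x)\<^sup>2"
    and k_le: "\<And>x y. cmod (k x y) \<le> e x y / (w x * w y)"
    and M_le: "\<And>x. M x \<le> M0"
begin

lemma k_fin: "finite {y. k x y \<noteq> 0}"
proof (rule finite_subset[OF _ e_fin[of x]], clarify)
  fix y assume "k x y \<noteq> 0" "e x y = 0"
  then show False using k_le[of x y] by simp
qed

lemma row_sum_le: "finite S \<Longrightarrow> (\<Sum>y\<in>S. e x y) \<le> M x * (w x)\<^sup>2"
proof -
  assume S: "finite S"
  have "(\<Sum>y\<in>S. e x y) = (\<Sum>y\<in>S \<inter> {y. e x y \<noteq> 0}. e x y)"
    by (rule sum.mono_neutral_right) (use S in auto)
  also have "\<dots> \<le> (\<Sum>y\<in>{y. e x y \<noteq> 0}. e x y)"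
    by (rule sum_mono2) (use e_fin e0 in auto)
  finally show ?thesis using e_row[of x] by linarith
qed

lemma M_nonneg: "0 \<le> M x"
  using row_sum_le[of "{}" x] w[of x] by (simp add: zero_le_mult_iff)

lemma M0_nonneg: "0 \<le> M0"
  by (rule order_trans[OF M_nonneg M_le])

text \<open>Cauchy-Schwarz after splitting \<open>e x y / (w x * w y)\<close> into
  \<open>sqrt (e x y) / w x\<close> and \<open>sqrt (e x y) / w y\<close>; the squares of the first
  factor sum to at most \<open>M x\<close>.\<close>

lemma row_sq_le:
  assumes U: "finite U" "{y. k x y \<noteq> 0} \<subseteq> U"
  shows "(cmod (\<Sum>y\<in>{y. k x y \<noteq> 0}. k x y * F y))\<^sup>2 \<le> M x * (\<Sum>y\<in>U. e x y * (cmod (F y))\<^sup>2 / (w y)\<^sup>2)"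
proof -
  have wn: "w x \<noteq> 0" for x using w[of x] by simp
  have "(\<Sum>y\<in>{y. k x y \<noteq> 0}. k x y * F y) = (\<Sum>y\<in>U. k x y * F y)"
    by (rule sum.mono_neutral_left) (use U in auto)
  then have "cmod (\<Sum>y\<in>{y. k x y \<noteq> 0}. k x y * F y) \<le> (\<Sum>y\<in>U. cmod (k x y) * cmod (F y))"
    using norm_sum[of "\<lambda>y. k x y * F y" U] by (simp add: norm_mult)
  also have "\<dots> \<le> (\<Sum>y\<in>U. (sqrt (e x y) / w x) * (sqrt (e x y) * cmod (F y) / w y))"
  proof (rule sum_mono)
    fix y
    have "cmod (k x y) * cmod (F y) \<le> e x y / (w x * w y) * cmod (F y)"
      by (intro mult_right_mono k_le) auto
    also have "\<dots> = (sqrt (e x y) * sqrt (e x y)) / (w x * w y) * cmod (F y)"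
      using e0[of x y] by simp
    also have "\<dots> = (sqrt (e x y) / w x) * (sqrt (e x y) * cmod (F y) / w y)"
      by (simp only: times_divide_eq_left times_divide_eq_right divide_divide_eq_left mult_ac)
    finally show "cmod (k x y) * cmod (F y) \<le> (sqrt (e x y) / w x) * (sqrt (e x y) * cmod (F y) / w y)" .
  qed
  finally have "(cmod (\<Sum>y\<in>{y. k x y \<noteq> 0}. k x y * F y))\<^sup>2
      \<le> (\<Sum>y\<in>U. (sqrt (e x y) / w x) * (sqrt (e x y) * cmod (F y) / w y))\<^sup>2"
    by (rule power_mono) simp
  also have "\<dots> \<le> (\<Sum>y\<in>U. (sqrt (e x y) / w x)\<^sup>2) * (\<Sum>y\<in>U. (sqrt (e x y) * cmod (F y) / w y)\<^sup>2)"
    by (rule Cauchy_Schwarz_ineq_sum)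
  also have "\<dots> = ((\<Sum>y\<in>U. e x y) / (w x)\<^sup>2) * (\<Sum>y\<in>U. e x y * (cmod (F y))\<^sup>2 / (w y)\<^sup>2)"
    using e0 by (simp add: power_divide power_mult_distrib sum_divide_distrib)
  also have "\<dots> \<le> M x * (\<Sum>y\<in>U. e x y * (cmod (F y))\<^sup>2 / (w y)\<^sup>2)"
    using row_sum_le[OF U(1), of x] w[of x] e0
    by (intro mult_right_mono sum_nonneg divide_nonneg_nonneg mult_nonneg_nonneg) (auto simp: field_simps)
  finally show ?thesis .
qed

text \<open>After exchanging the sums, symmetry of \<open>e\<close> turns column sums into row sums.
  One factor \<open>M\<close> is replaced by \<open>M0\<close>, the other survives as a weight on
  \<open>F\<close>, which \<open>ccont_kop\<close> exploits.\<close>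

lemma finite_rows_le:
  assumes S: "finite S"
  obtains U where "finite U"
    "(\<Sum>x\<in>S. (cmod (\<Sum>y\<in>{y. k x y \<noteq> 0}. k x y * F y))\<^sup>2) \<le> M0 * (\<Sum>y\<in>U. M y * (cmod (F y))\<^sup>2)"
proof -
  define U where "U = (\<Union>x\<in>S. {y. k x y \<noteq> 0})"
  have U: "finite U" using S k_fin by (auto simp: U_def)
  have "(\<Sum>x\<in>S. (cmod (\<Sum>y\<in>{y. k x y \<noteq> 0}. k x y * F y))\<^sup>2)
      \<le> (\<Sum>x\<in>S. M0 * (\<Sum>y\<in>U. e x y * (cmod (F y))\<^sup>2 / (w y)\<^sup>2))"
  proof (rule sum_mono)
    fix x assume "x \<in> S"
    then have "(cmod (\<Sum>y\<in>{y. k x y \<noteq> 0}. k x y * F y))\<^sup>2 \<le> M x * (\<Sum>y\<in>U. e x y * (cmod (F y))\<^sup>2 / (w y)\<^sup>2)"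
      by (intro row_sq_le U) (auto simp: U_def)
    also have "\<dots> \<le> M0 * (\<Sum>y\<in>U. e x y * (cmod (F y))\<^sup>2 / (w y)\<^sup>2)"
      using e0 by (intro mult_right_mono M_le sum_nonneg divide_nonneg_nonneg mult_nonneg_nonneg) auto
    finally show "(cmod (\<Sum>y\<in>{y. k x y \<noteq> 0}. k x y * F y))\<^sup>2 \<le> M0 * (\<Sum>y\<in>U. e x y * (cmod (F y))\<^sup>2 / (w y)\<^sup>2)" .
  qed
  also have "\<dots> = M0 * (\<Sum>y\<in>U. (\<Sum>x\<in>S. e y x) * ((cmod (F y))\<^sup>2 / (w y)\<^sup>2))"
  proof -
    have "(\<Sum>x\<in>S. \<Sum>y\<in>U. e x y * (cmod (F y))\<^sup>2 / (w y)\<^sup>2) = (\<Sum>y\<in>U. \<Sum>x\<in>S. e x y * (cmod (F y))\<^sup>2 / (w y)\<^sup>2)"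
      by (rule sum.swap)
    also have "\<dots> = (\<Sum>y\<in>U. (\<Sum>x\<in>S. e y x) * ((cmod (F y))\<^sup>2 / (w y)\<^sup>2))"
      by (intro sum.cong refl) (simp add: sum_distrib_right sum_divide_distrib e_sym)
    finally show ?thesis by (simp add: sum_distrib_left[symmetric])
  qed
  also have "\<dots> \<le> M0 * (\<Sum>y\<in>U. M y * (cmod (F y))\<^sup>2)"
  proof (intro mult_left_mono M0_nonneg sum_mono)
    fix y
    have "(\<Sum>x\<in>S. e y x) * ((cmod (F y))\<^sup>2 / (w y)\<^sup>2) \<le> M y * (w y)\<^sup>2 * ((cmod (F y))\<^sup>2 / (w y)\<^sup>2)"
      by (intro mult_right_mono row_sum_le S) auto
    then show "(\<Sum>x\<in>S. e y x) * ((cmod (F y))\<^sup>2 / (w y)\<^sup>2) \<le> M y * (cmod (F y))\<^sup>2"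
      using w[of y] by simp
  qed
  finally show ?thesis using U by (intro that[of U])
qed

lemma sum_M_le: "finite U \<Longrightarrow> (\<Sum>y\<in>U. M y * (cmod (coord f y))\<^sup>2) \<le> M0 * (norm f)\<^sup>2"
proof -
  assume U: "finite U"
  have "(\<Sum>y\<in>U. M y * (cmod (coord f y))\<^sup>2) \<le> (\<Sum>y\<in>U. M0 * (cmod (coord f y))\<^sup>2)"
    by (intro sum_mono mult_right_mono M_le) auto
  also have "\<dots> \<le> M0 * (norm f)\<^sup>2"
    unfolding sum_distrib_left[symmetric] by (intro mult_left_mono sum_coord_le U M0_nonneg)
  finally show ?thesis .
qed

lemma coord_kop: "coord (kop k f) x = (\<Sum>y\<in>{y. k x y \<noteq> 0}. k x y * coord f y)"
proof -
  have "\<forall>S. finite S \<longrightarrow> (\<Sum>x\<in>S. (cmod (\<Sum>y\<in>{y. k x y \<noteq> 0}. k x y * coord f y))\<^sup>2) \<le> M0 * (M0 * (norm f)\<^sup>2)"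
  proof (intro allI impI)
    fix S :: "'v set" assume "finite S"
    then obtain U where U: "finite U" "(\<Sum>x\<in>S. (cmod (\<Sum>y\<in>{y. k x y \<noteq> 0}. k x y * coord f y))\<^sup>2)
        \<le> M0 * (\<Sum>y\<in>U. M y * (cmod (coord f y))\<^sup>2)" by (rule finite_rows_le)
    then show "(\<Sum>x\<in>S. (cmod (\<Sum>y\<in>{y. k x y \<noteq> 0}. k x y * coord f y))\<^sup>2) \<le> M0 * (M0 * (norm f)\<^sup>2)"
      using mult_left_mono[OF sum_M_le[OF U(1)] M0_nonneg] order_trans by blast
  qed
  then have "(\<lambda>x. (cmod (\<Sum>y\<in>{y. k x y \<noteq> 0}. k x y * coord f y))\<^sup>2) summable_on UNIV"
    unfolding sq_summable_iff by blast
  then show ?thesis unfolding kop_def by (simp add: coord_Abs_l2)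
qed

lemma norm_kop_sq_leI:
  assumes "\<And>U. finite U \<Longrightarrow> (\<Sum>y\<in>U. M y * (cmod (coord f y))\<^sup>2) \<le> b"
  shows "(norm (kop k f))\<^sup>2 \<le> M0 * b"
proof (rule norm_l2_leI)
  fix S :: "'v set" assume "finite S"
  then obtain U where U: "finite U" "(\<Sum>x\<in>S. (cmod (\<Sum>y\<in>{y. k x y \<noteq> 0}. k x y * coord f y))\<^sup>2)
      \<le> M0 * (\<Sum>y\<in>U. M y * (cmod (coord f y))\<^sup>2)" by (rule finite_rows_le)
  then show "(\<Sum>x\<in>S. (cmod (coord (kop k f) x))\<^sup>2) \<le> M0 * b"
    unfolding coord_kop using mult_left_mono[OF assms[OF U(1)] M0_nonneg] order_trans by blast
qed

lemma norm_kop_le: "norm (kop k f) \<le> M0 * norm f"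
proof (rule power2_le_imp_le)
  show "(norm (kop k f))\<^sup>2 \<le> (M0 * norm f)\<^sup>2"
    using norm_kop_sq_leI[OF sum_M_le, of f] by (simp add: power2_eq_square mult_ac)
qed (simp add: M0_nonneg)

lemma kop_cscale: "kop k (cscale c f) = cscale c (kop k f)"
  by (rule l2_eqI) (simp add: coord_kop sum_distrib_left mult_ac)

lemma bounded_linear_kop: "bounded_linear (kop k)"
  by (rule bounded_linear_intro[where K = M0])
    (auto intro!: l2_eqI simp: coord_kop sum.distrib sum_distrib_left algebra_simps norm_kop_le mult.commute[of "norm _"])

lemma cip_kop:
  assumes S: "finite S" and f: "\<And>x. x \<notin> S \<Longrightarrow> coord f x = 0" and g: "\<And>x. x \<notin> S \<Longrightarrow> coord g x = 0"
  shows "cip f (kop k g) = (\<Sum>x\<in>S. \<Sum>y\<in>S. cnj (coord f x) * k x y * coord g y)"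
proof -
  have "(\<Sum>y\<in>{y. k x y \<noteq> 0}. k x y * coord g y) = (\<Sum>y\<in>S. k x y * coord g y)" for x
    by (rule sum.mono_neutral_cong) (use S k_fin g in auto)
  then show ?thesis
    using cip_finite_support[OF S f] by (simp add: coord_kop sum_distrib_left mult.assoc)
qed

text \<open>For finitely supported vectors this is an exchange in a finite double sum; boundedness
  and density carry it over to all vectors.\<close>

lemma cip_kop_hermitian:
  assumes herm: "\<And>x y. k y x = cnj (k x y)"
  shows "cip (kop k f) g = cip f (kop k g)"
proof -
  have fin: "cip (kop k u) v = cip u (kop k v)"
    if u: "finite {x. coord u x \<noteq> 0}" and v: "finite {x. coord v x \<noteq> 0}" for u v
  proof -
    let ?S = "{x. coord u x \<noteq> 0} \<union> {x. coord v x \<noteq> 0}"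
    have "cip (kop k u) v = cnj (cip v (kop k u))" by (rule cip_commute)
    also have "\<dots> = (\<Sum>x\<in>?S. \<Sum>y\<in>?S. cnj (coord u y) * k y x * coord v x)"
      by (subst cip_kop[of ?S]) (use u v in \<open>auto simp: herm[symmetric] mult_ac\<close>)
    also have "\<dots> = (\<Sum>x\<in>?S. \<Sum>y\<in>?S. cnj (coord u x) * k x y * coord v y)" by (rule sum.swap)
    also have "\<dots> = cip u (kop k v)" by (subst cip_kop[of ?S]) (use u v in auto)
    finally show ?thesis .
  qed
  obtain u where u: "\<And>n. finite {x. coord (u n) x \<noteq> 0}" "u \<longlonglongrightarrow> f" by (rule finite_support_dense[of f]) blast
  obtain v where v: "\<And>n. finite {x. coord (v n) x \<noteq> 0}" "v \<longlonglongrightarrow> g" by (rule finite_support_dense[of g]) blast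
  have "(\<lambda>n. cip (kop k (u n)) (v n)) \<longlonglongrightarrow> cip (kop k f) g"
    by (intro tendsto_cip bounded_linear.tendsto[OF bounded_linear_kop] u v)
  moreover have "(\<lambda>n. cip (kop k (u n)) (v n)) \<longlonglongrightarrow> cip f (kop k g)"
    unfolding fin[OF u(1) v(1)] by (intro tendsto_cip bounded_linear.tendsto[OF bounded_linear_kop] u v)
  ultimately show ?thesis by (rule LIMSEQ_unique)
qed

lemma bsym_kop: "(\<And>x y. k y x = cnj (k x y)) \<Longrightarrow> bsym (kop k)"
  unfolding bsym_def using cip_kop_hermitian bounded_linear_kop by (metis Re_cip)

text \<open>Outside a finite set the weight \<open>M\<close> is small; on the finite set the
  coordinates of a weakly null sequence tend to zero.\<close>

lemma ccont_kop:
  assumes M: "(M \<longlongrightarrow> 0) cofinite"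
  shows "ccont (kop k)"
  unfolding ccont_def
proof (intro allI impI)
  fix f :: "nat \<Rightarrow> 'v l2" assume f: "wnull f"
  obtain b where b: "\<And>n. norm (f n) \<le> b" and c: "\<And>x. (\<lambda>n. coord (f n) x) \<longlonglongrightarrow> 0"
    using f unfolding wnull_def by blast
  have b0: "0 \<le> b" using b[of 0] norm_ge_zero order_trans by blast
  show "(\<lambda>n. kop k (f n)) \<longlonglongrightarrow> 0"
  proof (rule LIMSEQ_I)
    fix r :: real assume r: "0 < r"
    \<comment> \<open>Makes \<open>d * b^2\<close> at most \<open>r^2 / (4 * (M0 + 1))\<close>, the
      same share as the finite set receives; multiplied by \<open>M0\<close>, the two shares add up
      to at most \<open>r^2 / 2\<close>.\<close>
    define d where "d = r\<^sup>2 / (4 * (M0 + 1) * (b\<^sup>2 + 1))"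
    have d0: "0 < d" using r M0_nonneg b0 by (auto simp: d_def intro!: divide_pos_pos mult_pos_pos add_nonneg_pos)
    have "\<forall>\<^sub>F x in cofinite. M x < d" using M d0 by (rule order_tendstoD)
    then have Sf: "finite {x. \<not> M x < d}" by (simp add: eventually_cofinite)
    let ?S = "{x. \<not> M x < d}"
    have "(\<lambda>n. \<Sum>x\<in>?S. M0 * (cmod (coord (f n) x))\<^sup>2) \<longlonglongrightarrow> (\<Sum>x\<in>?S. M0 * (cmod 0)\<^sup>2)"
      by (intro tendsto_intros c)
    then have "(\<lambda>n. \<Sum>x\<in>?S. M0 * (cmod (coord (f n) x))\<^sup>2) \<longlonglongrightarrow> 0" by simp
    moreover have q0: "0 < r\<^sup>2 / (4 * (M0 + 1))" using r M0_nonneg by simp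
    ultimately obtain N where N: "\<And>n. n \<ge> N \<Longrightarrow> (\<Sum>x\<in>?S. M0 * (cmod (coord (f n) x))\<^sup>2) < r\<^sup>2 / (4 * (M0 + 1))"
      using LIMSEQ_D[of "\<lambda>n. \<Sum>x\<in>?S. M0 * (cmod (coord (f n) x))\<^sup>2" 0] by fastforce
    have "norm (kop k (f n) - 0) < r" if n: "n \<ge> N" for n
    proof -
      have "(norm (kop k (f n)))\<^sup>2 \<le> M0 * (r\<^sup>2 / (4 * (M0 + 1)) + d * b\<^sup>2)"
      proof (rule norm_kop_sq_leI)
        fix U :: "'v set" assume U: "finite U"
        have "(\<Sum>y\<in>U. M y * (cmod (coord (f n) y))\<^sup>2)
            = (\<Sum>y\<in>U \<inter> ?S. M y * (cmod (coord (f n) y))\<^sup>2) + (\<Sum>y\<in>U - ?S. M y * (cmod (coord (f n) y))\<^sup>2)"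
          using U by (subst sum.Int_Diff[of U _ ?S]) auto
        also have "(\<Sum>y\<in>U \<inter> ?S. M y * (cmod (coord (f n) y))\<^sup>2) \<le> (\<Sum>y\<in>?S. M0 * (cmod (coord (f n) y))\<^sup>2)"
        proof (rule order_trans)
          show "(\<Sum>y\<in>U \<inter> ?S. M y * (cmod (coord (f n) y))\<^sup>2) \<le> (\<Sum>y\<in>U \<inter> ?S. M0 * (cmod (coord (f n) y))\<^sup>2)"
            by (intro sum_mono mult_right_mono M_le) auto
          show "(\<Sum>y\<in>U \<inter> ?S. M0 * (cmod (coord (f n) y))\<^sup>2) \<le> (\<Sum>y\<in>?S. M0 * (cmod (coord (f n) y))\<^sup>2)"
            by (rule sum_mono2) (use Sf M0_nonneg in auto)
        qed
        also have "(\<Sum>y\<in>U - ?S. M y * (cmod (coord (f n) y))\<^sup>2) \<le> d * b\<^sup>2"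
        proof -
          have "(\<Sum>y\<in>U - ?S. M y * (cmod (coord (f n) y))\<^sup>2) \<le> (\<Sum>y\<in>U - ?S. d * (cmod (coord (f n) y))\<^sup>2)"
            by (intro sum_mono mult_right_mono) auto
          also have "\<dots> \<le> d * (norm (f n))\<^sup>2"
            unfolding sum_distrib_left[symmetric] using U d0 by (intro mult_left_mono sum_coord_le) auto
          also have "\<dots> \<le> d * b\<^sup>2" using d0 by (intro mult_left_mono power_mono b) auto
          finally show ?thesis .
        qed
        finally show "(\<Sum>y\<in>U. M y * (cmod (coord (f n) y))\<^sup>2) \<le> r\<^sup>2 / (4 * (M0 + 1)) + d * b\<^sup>2"
          using N[OF n] by simp
      qed
      also have "\<dots> \<le> M0 * (r\<^sup>2 / (4 * (M0 + 1)) + r\<^sup>2 / (4 * (M0 + 1)))"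
      proof (intro mult_left_mono add_left_mono M0_nonneg)
        have "d * b\<^sup>2 = (r\<^sup>2 / (4 * (M0 + 1))) * (b\<^sup>2 / (b\<^sup>2 + 1))" by (simp add: d_def)
        also have "\<dots> \<le> (r\<^sup>2 / (4 * (M0 + 1))) * 1"
          using q0 by (intro mult_left_mono) (auto simp: divide_le_eq_1 add_nonneg_pos)
        finally show "d * b\<^sup>2 \<le> r\<^sup>2 / (4 * (M0 + 1))" by simp
      qed
      also have "\<dots> = (M0 / (M0 + 1)) * (r\<^sup>2 / 2)" using M0_nonneg by (simp add: divide_simps)
      also have "\<dots> \<le> 1 * (r\<^sup>2 / 2)" using M0_nonneg by (intro mult_right_mono) (auto simp: divide_le_eq_1)
      also have "\<dots> < r\<^sup>2" using r by simp
      finally have "norm (kop k (f n)) < r" by (rule power2_less_imp_less) (use r in simp)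
      then show ?thesis by simp
    qed
    then show "\<exists>N. \<forall>n\<ge>N. norm (kop k (f n) - 0) < r" by blast
  qed
qed

end

section \<open>Weyl sequences and essential spectrum\<close>

definition weyl :: "('v l2 \<Rightarrow> 'v l2) \<Rightarrow> real \<Rightarrow> bool" where
  "weyl T t \<longleftrightarrow> (\<exists>f. (\<forall>n. norm (f n) = 1) \<and> wnull f \<and> (\<lambda>n. T (f n) - t *\<^sub>R f n) \<longlonglongrightarrow> 0)"

text \<open>For a \<open>bsym\<close> operator this means that \<open>t\<close> lies in the
  resolvent set, as \<open>T - t\<close> is then bijective by
  \<open>bsym_bounded_below_bij\<close>.\<close>

definition bbelow :: "('v l2 \<Rightarrow> 'v l2) \<Rightarrow> real \<Rightarrow> bool" where
  "bbelow T t \<longleftrightarrow> (\<exists>c>0. \<forall>x. c * norm x \<le> norm (T x - t *\<^sub>R x))"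

definition orthonormal_upto :: "nat \<Rightarrow> (nat \<Rightarrow> 'v l2) \<Rightarrow> bool" where
  "orthonormal_upto N F \<longleftrightarrow> (\<forall>i<N. \<forall>j<N. cip (F i) (F j) = (if i = j then 1 else 0))"

definition clinear_op :: "('v l2 \<Rightarrow> 'v l2) \<Rightarrow> bool" where
  "clinear_op T \<longleftrightarrow> (\<forall>c f. T (cscale c f) = cscale c (T f))"

lemma not_bbelowD:
  fixes T :: "'v l2 \<Rightarrow> 'v l2"
  assumes T: "bsym T" and t: "\<not> bbelow T t" and c: "0 < c"
  shows "\<exists>f. norm f = 1 \<and> norm (T f - t *\<^sub>R f) \<le> c"
proof -
  interpret T: bounded_linear T using T by (rule bsym_bounded_linear)
  obtain x where x: "norm (T x - t *\<^sub>R x) < c * norm x"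
    using t c unfolding bbelow_def by (meson not_le)
  then have x0: "x \<noteq> 0" by (auto simp: T.zero)
  have "T (sgn x) - t *\<^sub>R sgn x = inverse (norm x) *\<^sub>R (T x - t *\<^sub>R x)"
    by (simp add: sgn_div_norm T.scaleR scaleR_right_diff_distrib mult.commute)
  then have "norm (T (sgn x) - t *\<^sub>R sgn x) = norm (T x - t *\<^sub>R x) / norm x"
    by (simp add: divide_inverse mult.commute)
  also have "\<dots> \<le> c" using x x0 by (simp add: divide_le_eq less_imp_le)
  finally show ?thesis using x0 by (intro exI[of _ "sgn x"]) (simp add: norm_sgn)
qed

lemma weyl_not_bbelow:
  assumes "weyl T t"
  shows "\<not> bbelow T t"
proof
  assume "bbelow T t"
  then obtain c where c: "c > 0" "\<And>x. c * norm x \<le> norm (T x - t *\<^sub>R x)" unfolding bbelow_def by blast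
  obtain f where f: "\<And>n. norm (f n) = 1" "(\<lambda>n. T (f n) - t *\<^sub>R f n) \<longlonglongrightarrow> 0"
    using assms unfolding weyl_def by blast
  have "c \<le> norm (T (f n) - t *\<^sub>R f n)" for n using c(2)[of "f n"] f(1)[of n] by simp
  then have "c \<le> norm (0 :: 'a l2)"
    by (intro LIMSEQ_le_const[OF tendsto_norm[OF f(2)]]) blast
  then show False using c(1) by simp
qed

text \<open>Take unit vectors \<open>f n\<close> with \<open>\<parallel>(T - s n) f n\<parallel>\<close> small compared to \<open>\<bar>s n - t\<bar>\<close>. A weak limit \<open>l\<close> lies in
  the kernel of \<open>T - t\<close>, and then \<open>\<langle>f n, l\<rangle> \<rightarrow> 0\<close>, so \<open>l = 0\<close>.\<close>

lemma weyl_if_limit_point: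
  fixes T :: "'v::countable l2 \<Rightarrow> 'v l2"
  assumes T: "bsym T" and s: "s \<longlonglongrightarrow> t" "\<And>n. s n \<noteq> t" "\<And>n. \<not> bbelow T (s n)"
  shows "weyl T t"
proof -
  interpret T: bounded_linear T using T by (rule bsym_bounded_linear)
  define d where "d n = \<bar>s n - t\<bar>" for n
  have d0: "0 < d n" for n using s(2)[of n] by (simp add: d_def)
  have "\<exists>f. norm f = 1 \<and> norm (T f - s n *\<^sub>R f) \<le> d n / real (Suc n)" for n
    by (rule not_bbelowD[OF T s(3)]) (simp add: d0)
  then obtain f where f: "\<And>n. norm (f n) = 1" "\<And>n. norm (T (f n) - s n *\<^sub>R f n) \<le> d n / real (Suc n)"
    by metis
  let ?S = "\<lambda>x. T x - t *\<^sub>R x"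
  have S: "bsym ?S" by (rule bsym_shift[OF T])
  have Sf: "(\<lambda>n. ?S (f n)) \<longlonglongrightarrow> 0"
  proof (rule Lim_null_comparison[OF always_eventually], intro allI)
    fix n
    have "?S (f n) = (T (f n) - s n *\<^sub>R f n) + (s n - t) *\<^sub>R f n" by (simp add: algebra_simps)
    then have "norm (?S (f n)) \<le> norm (T (f n) - s n *\<^sub>R f n) + norm ((s n - t) *\<^sub>R f n)"
      by (metis norm_triangle_ineq)
    also have "\<dots> \<le> d n / real (Suc n) + d n" using f(2)[of n] by (simp add: f(1) d_def)
    also have "\<dots> \<le> 2 * d n" using d0[of n] by (simp add: divide_le_eq)
    finally show "norm (?S (f n)) \<le> 2 * d n" .
    have "(\<lambda>n. 2 * \<bar>s n - t\<bar>) \<longlonglongrightarrow> 2 * \<bar>t - t\<bar>" by (intro tendsto_intros s(1))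
    then show "(\<lambda>n. 2 * d n) \<longlonglongrightarrow> 0" by (simp add: d_def)
  qed
  obtain r l where r: "strict_mono (r::nat\<Rightarrow>nat)" and w: "wnull (\<lambda>n. f (r n) - l)"
    using weak_compactness[of f 1] f(1) by auto
  have Sfr: "(\<lambda>n. ?S (f (r n))) \<longlonglongrightarrow> 0" using LIMSEQ_subseq_LIMSEQ[OF Sf r] by (simp add: o_def)
  have "inner g (?S l) = 0" for g
  proof -
    have "(\<lambda>n. inner g (?S (f (r n))) - inner g (?S (f (r n) - l))) \<longlonglongrightarrow> inner g 0 - 0"
      by (intro tendsto_diff tendsto_inner tendsto_const Sfr wnull_inner wnull_bsym[OF S w])
    moreover have "inner g (?S (f (r n))) - inner g (?S (f (r n) - l)) = inner g (?S l)" for n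
      by (simp add: inner_diff_right T.diff algebra_simps)
    ultimately have "(\<lambda>n. inner g (?S l)) \<longlonglongrightarrow> 0" by simp
    then show ?thesis by (simp add: LIMSEQ_const_iff)
  qed
  then have Sl: "?S l = 0" using inner_eq_zero_iff by blast
  have fl: "\<bar>inner (f n) l\<bar> \<le> norm l / real (Suc n)" for n
  proof -
    \<comment> \<open>As \<open>T - t\<close> kills \<open>l\<close>, only the residual of
      \<open>f n\<close> is left, and it is small compared with \<open>d n\<close>.\<close>
    have "(s n - t) * inner (f n) l = inner (?S (f n)) l - inner (T (f n) - s n *\<^sub>R f n) l"
      by (simp add: inner_diff_left algebra_simps)
    also have "inner (?S (f n)) l = 0" using bsymD[OF S, of "f n" l] Sl by simp
    finally have "d n * \<bar>inner (f n) l\<bar> = \<bar>inner (T (f n) - s n *\<^sub>R f n) l\<bar>"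
      unfolding d_def abs_mult[symmetric] by simp
    also have "\<dots> \<le> norm (T (f n) - s n *\<^sub>R f n) * norm l" by (rule Cauchy_Schwarz_ineq2)
    also have "\<dots> \<le> d n / real (Suc n) * norm l" by (intro mult_right_mono f(2)) auto
    finally have "d n * \<bar>inner (f n) l\<bar> \<le> d n * (norm l / real (Suc n))" by simp
    then show ?thesis by (rule mult_left_le_imp_le[OF _ d0])
  qed
  have "(\<lambda>n. inner (f n) l) \<longlonglongrightarrow> 0"
  proof (rule Lim_null_comparison[OF always_eventually])
    show "\<forall>n. norm (inner (f n) l) \<le> norm l / real (Suc n)" using fl by simp
    show "(\<lambda>n. norm l / real (Suc n)) \<longlonglongrightarrow> 0"
      using tendsto_mult_right_zero[OF LIMSEQ_inverse_real_of_nat, of "norm l"]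
      by (simp only: divide_inverse)
  qed
  from LIMSEQ_subseq_LIMSEQ[OF this r] have "(\<lambda>n. inner l (f (r n))) \<longlonglongrightarrow> 0"
    by (simp add: o_def inner_commute)
  from tendsto_diff[OF this wnull_inner[OF w, of l]] have "(\<lambda>n. inner l l) \<longlonglongrightarrow> 0"
    by (simp add: inner_diff_right)
  then have "l = 0" by (simp add: LIMSEQ_const_iff)
  then show ?thesis
    unfolding weyl_def using f(1) w Sfr by (intro exI[of _ "\<lambda>n. f (r n)"]) auto
qed

lemma bessel:
  fixes F :: "nat \<Rightarrow> 'a::real_inner"
  assumes F: "\<And>i j. i < N \<Longrightarrow> j < N \<Longrightarrow> inner (F i) (F j) = (if i = j then 1 else (0::real))"
  shows "(\<Sum>i<N. (inner g (F i))\<^sup>2) \<le> (norm g)\<^sup>2"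
proof -
  define p where "p = (\<Sum>i<N. inner g (F i) *\<^sub>R F i)"
  have gp: "inner g p = (\<Sum>i<N. (inner g (F i))\<^sup>2)"
    by (simp add: p_def inner_sum_right power2_eq_square)
  have "inner p p = (\<Sum>i<N. \<Sum>j<N. inner g (F i) * inner g (F j) * inner (F i) (F j))"
    by (simp add: p_def inner_sum_right inner_sum_left sum_distrib_left mult_ac inner_commute)
  also have "\<dots> = (\<Sum>i<N. \<Sum>j<N. if i = j then (inner g (F i))\<^sup>2 else 0)"
    by (intro sum.cong refl) (auto simp: F power2_eq_square)
  also have "\<dots> = (\<Sum>i<N. (inner g (F i))\<^sup>2)" by (simp add: sum.delta)
  finally have pp: "inner p p = (\<Sum>i<N. (inner g (F i))\<^sup>2)" .
  have "0 \<le> inner (g - p) (g - p)" by simp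
  also have "\<dots> = (norm g)\<^sup>2 - (\<Sum>i<N. (inner g (F i))\<^sup>2)"
    unfolding power2_norm_eq_inner using gp pp
    by (simp only: inner_diff_left inner_diff_right inner_commute[of p g])
  finally show ?thesis by simp
qed

text \<open>An orthonormal sequence is weakly null by Bessel's inequality, so exact eigenvectors
  already form a Weyl sequence.\<close>

lemma weyl_if_infinite_multiplicity:
  fixes T :: "'v l2 \<Rightarrow> 'v l2" and F :: "nat \<Rightarrow> 'v l2"
  assumes eig: "\<And>i. T (F i) = t *\<^sub>R F i" and orth: "\<And>i j. cip (F i) (F j) = (if i = j then 1 else 0)"
  shows "weyl T t"
proof -
  have inn: "inner (F i) (F j) = (if i = j then 1 else 0)" for i j
    using arg_cong[OF orth[of i j], of Re] by (simp add: Re_cip)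
  have nF: "norm (F i) = 1" for i using inn[of i i] by (simp add: norm_eq_sqrt_inner)
  have "wnull F"
  proof (rule wnullI[where b = 1])
    fix g
    have "summable (\<lambda>i. (inner g (F i))\<^sup>2)"
      by (rule summableI_nonneg_bounded[where x = "(norm g)\<^sup>2"]) (use bessel[of _ F g] inn in auto)
    then have "(\<lambda>i. (inner g (F i))\<^sup>2) \<longlonglongrightarrow> 0" by (rule summable_LIMSEQ_zero)
    then show "(\<lambda>i. inner g (F i)) \<longlonglongrightarrow> 0"
      by (rule tendsto_zero_of_norm_sq_le[rotated]) simp
  qed (simp add: nF)
  then show ?thesis unfolding weyl_def using nF eig by (intro exI[of _ F]) auto
qed

lemma orthonormal_residual:
  assumes F: "orthonormal_upto k F" and j: "j < k"
  shows "cip (F j) (e - (\<Sum>i<k. cscale (cip (F i) e) (F i))) = 0"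
proof -
  have "(\<Sum>i<k. cip (F i) e * cip (F j) (F i)) = (\<Sum>i<k. if i = j then cip (F j) e else 0)"
    using F j unfolding orthonormal_upto_def by (intro sum.cong refl) auto
  then show ?thesis using j by (simp add: cip_diff_right cip_sum_right)
qed

text \<open>Isolation gives the square of \<open>T - t\<close> a gap above 0, hence the distance to
  its kernel is controlled by \<open>T - t\<close>. The Weyl sequence can then be moved into the
  kernel, and being weakly null it stays far from the span of any finite orthonormal family, which
  allows a greedy construction.\<close>

lemma infinite_multiplicity_if_weyl_isolated:
  fixes T :: "'v l2 \<Rightarrow> 'v l2"
  assumes T: "bsym T" "clinear_op T" and weyl: "weyl T t" and d: "0 < d"
    and iso: "\<And>s. s \<noteq> t \<Longrightarrow> \<bar>s - t\<bar> < d \<Longrightarrow> bbelow T s"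
  shows "\<exists>F. (\<forall>i::nat. T (F i) = t *\<^sub>R F i) \<and> (\<forall>i j. cip (F i) (F j) = (if i = j then 1 else 0))"
proof -
  interpret T: bounded_linear T using T(1) by (rule bsym_bounded_linear)
  define S where "S x = T x - t *\<^sub>R x" for x
  have S: "bsym S" unfolding S_def by (rule bsym_shift[OF T(1)])
  interpret S: bounded_linear S using S by (rule bsym_bounded_linear)
  have Sc: "S (cscale c x) = cscale c (S x)" for c x
    using T(2) unfolding S_def clinear_op_def by (auto intro!: l2_eqI simp: algebra_simps)
  \<comment> \<open>The square of \<open>S\<close> minus \<open>q^2\<close> is the product of
    \<open>T - (t + q)\<close> and \<open>T - (t - q)\<close>, both bounded below by
    isolation.\<close>
  have gapS: "\<exists>c>0. \<forall>x. c * norm x \<le> norm (S (S x) - u *\<^sub>R x)" if u: "0 < u" "u < d\<^sup>2" for u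
  proof -
    define q where "q = sqrt u"
    have q: "0 < q" "q < d" "q * q = u"
      using u d by (auto simp: q_def real_less_lsqrt)
    obtain c1 where c1: "c1 > 0" "\<And>x. c1 * norm x \<le> norm (T x - (t + q) *\<^sub>R x)"
      using iso[of "t + q"] q unfolding bbelow_def by auto
    obtain c2 where c2: "c2 > 0" "\<And>x. c2 * norm x \<le> norm (T x - (t - q) *\<^sub>R x)"
      using iso[of "t - q"] q unfolding bbelow_def by auto
    have "c2 * c1 * norm x \<le> norm (S (S x) - u *\<^sub>R x)" for x
    proof -
      let ?y = "T x - (t + q) *\<^sub>R x"
      have "c2 * c1 * norm x \<le> c2 * norm ?y" using c1(2)[of x] c2(1) by (simp add: mult.assoc)
      also have "\<dots> \<le> norm (T ?y - (t - q) *\<^sub>R ?y)" by (rule c2(2))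
      also have "T ?y - (t - q) *\<^sub>R ?y = S (S x) - u *\<^sub>R x"
        unfolding q(3)[symmetric] by (simp add: S_def T.diff T.scaleR T.add scaleR_add_left algebra_simps)
      finally show ?thesis .
    qed
    then show ?thesis using c1(1) c2(1) by (intro exI[of _ "c2 * c1"]) auto
  qed
  have "d * norm (S x) \<le> norm (S (S x))" for x
  proof (rule power2_le_imp_le)
    have "d\<^sup>2 * inner (S (S x)) x \<le> (norm (S (S x)))\<^sup>2"
      by (rule bsym_spectral_gap[OF bsym_comp_self[OF S] _ gapS]) (use d in auto)
    then show "(d * norm (S x))\<^sup>2 \<le> (norm (S (S x)))\<^sup>2"
      using bsymD[OF S, of "S x" x] by (simp add: power_mult_distrib power2_norm_eq_inner)
  qed simp
  then obtain K where K: "\<And>x. \<exists>e. S e = 0 \<and> norm (x - e) \<le> K * norm (S x)"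
    using bsym_dist_kernel[OF S d] by blast
  obtain f where f: "\<And>n. norm (f n) = 1" "wnull f" "(\<lambda>n. S (f n)) \<longlonglongrightarrow> 0"
    using weyl unfolding weyl_def S_def by blast
  have "\<forall>n. \<exists>e. S e = 0 \<and> norm (f n - e) \<le> K * norm (S (f n))" using K by blast
  then obtain e where e: "\<And>n. S (e n) = 0" "\<And>n. norm (f n - e n) \<le> K * norm (S (f n))"
    using choice[of "\<lambda>n e. S e = 0 \<and> norm (f n - e) \<le> K * norm (S (f n))"] by blast
  have ef: "(\<lambda>n. e n - f n) \<longlonglongrightarrow> 0"
  proof (rule Lim_null_comparison[OF always_eventually])
    show "\<forall>n. norm (e n - f n) \<le> K * norm (S (f n))" using e(2) by (simp add: norm_minus_commute)
    show "(\<lambda>n. K * norm (S (f n))) \<longlonglongrightarrow> 0"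
      using f(3) by (intro tendsto_mult_right_zero tendsto_norm_zero)
  qed
  have we: "wnull e" by (rule wnull_perturb[OF f(2) ef])
  let ?P = "\<lambda>F k v. S v = 0 \<and> norm v = 1 \<and> (\<forall>i<k. cip (F i) v = 0)"
  have "\<exists>F. \<forall>k::nat. ?P F k (F k)"
  proof (rule dependent_wellorder_choice)
    fix r and F G :: "nat \<Rightarrow> 'v l2" and k :: nat
    assume "\<And>i. i < k \<Longrightarrow> F i = G i"
    then show "?P F k r = ?P G k r" by simp
  next
    fix k :: nat and F
    assume prev: "\<And>i. i < k \<Longrightarrow> ?P F i (F i)"
    have orth: "orthonormal_upto k F"
      unfolding orthonormal_upto_def
    proof (intro allI impI)
      fix i j assume ij: "i < k" "j < k"
      consider "i < j" | "j < i" | "i = j" by linarith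
      then show "cip (F i) (F j) = (if i = j then 1 else 0)"
      proof cases
        case 1 then show ?thesis using prev[OF ij(2)] by simp
      next
        case 2 then show ?thesis using prev[OF ij(1)] cip_commute[of "F i" "F j"] by simp
      next
        case 3 then show ?thesis using prev[OF ij(1)] by (simp add: cip_self)
      qed
    qed
    \<comment> \<open>Projecting off finitely many \<open>F i\<close> changes \<open>e n\<close>
      only by a null sequence, so some \<open>g n\<close> is nonzero and can be normalised.\<close>
    define g where "g n = e n - (\<Sum>i<k. cscale (cip (F i) (e n)) (F i))" for n
    have "(\<lambda>n. e n - f n - (\<Sum>i<k. cscale (cip (F i) (e n)) (F i))) \<longlonglongrightarrow> 0 - (\<Sum>i<k. 0)"
    proof (intro tendsto_diff ef tendsto_sum)
      fix i
      have "(\<lambda>n. cmod (cip (F i) (e n)) * norm (F i)) \<longlonglongrightarrow> 0"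
        by (intro tendsto_mult_left_zero tendsto_norm_zero wnull_cip we)
      then show "(\<lambda>n. cscale (cip (F i) (e n)) (F i)) \<longlonglongrightarrow> 0"
        unfolding norm_cscale[symmetric] by (rule tendsto_norm_zero_cancel)
    qed
    then have "(\<lambda>n. g n - f n) \<longlonglongrightarrow> 0" by (simp add: g_def algebra_simps)
    then obtain n where n: "norm (g n - f n) < 1" using LIMSEQ_D[of _ 0 1] by fastforce
    have g0: "g n \<noteq> 0" using n f(1)[of n] by auto
    have cs0: "cscale c 0 = (0 :: 'v l2)" for c by (rule l2_eqI) simp
    have Sg: "S (g n) = 0"
      using prev by (simp add: g_def S.diff S.sum e(1) Sc cs0)
    have "cip (F i) (g n) = 0" if "i < k" for i
      unfolding g_def by (rule orthonormal_residual[OF orth that])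
    then show "\<exists>v. ?P F k v"
      using g0 Sg cs0 by (intro exI[of _ "cscale (of_real (inverse (norm (g n)))) (g n)"])
        (simp add: Sc norm_inverse)
  qed
  then obtain F where F: "\<And>k::nat. ?P F k (F k)" by blast
  have "cip (F i) (F j) = (if i = j then 1 else 0)" for i j
  proof -
    consider "i < j" | "j < i" | "i = j" by linarith
    then show ?thesis
    proof cases
      case 1 then show ?thesis using F[of j] by simp
    next
      case 2 then show ?thesis using F[of i] cip_commute[of "F i" "F j"] by simp
    next
      case 3 then show ?thesis using F[of j] by (simp add: cip_self)
    qed
  qed
  moreover have "T (F i) = t *\<^sub>R F i" for i using F[of i] by (simp add: S_def)
  ultimately show ?thesis by blast
qed

text \<open>Weyl sequences are weakly null, so the completely continuous difference tends to zero
  along them and the same sequence serves both operators.\<close>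

lemma weyl_perturb:
  assumes "ccont (\<lambda>x. T x - T' x)" "weyl T t"
  shows "weyl T' t"
proof -
  obtain f where f: "\<And>n. norm (f n) = 1" "wnull f" "(\<lambda>n. T (f n) - t *\<^sub>R f n) \<longlonglongrightarrow> 0"
    using assms(2) unfolding weyl_def by blast
  have "(\<lambda>n. T (f n) - T' (f n)) \<longlonglongrightarrow> 0" using assms(1) f(2) unfolding ccont_def by blast
  from tendsto_diff[OF f(3) this] have "(\<lambda>n. T' (f n) - t *\<^sub>R f n) \<longlonglongrightarrow> 0" by simp
  then show ?thesis unfolding weyl_def using f by blast
qed

lemma not_weyl_if_ccont:
  assumes "ccont T" "t \<noteq> 0"
  shows "\<not> weyl T t"
proof
  assume "weyl T t"
  then obtain f where f: "\<And>n. norm (f n) = 1" "wnull f" "(\<lambda>n. T (f n) - t *\<^sub>R f n) \<longlonglongrightarrow> 0"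
    unfolding weyl_def by blast
  have "(\<lambda>n. T (f n)) \<longlonglongrightarrow> 0" using assms(1) f(2) unfolding ccont_def by blast
  from tendsto_diff[OF this f(3)] have "(\<lambda>n. t *\<^sub>R f n) \<longlonglongrightarrow> 0" by simp
  then have "(\<lambda>n. norm (t *\<^sub>R f n)) \<longlonglongrightarrow> 0" by (rule tendsto_norm_zero)
  then have "\<bar>t\<bar> = 0" by (simp add: f(1) LIMSEQ_const_iff)
  then show False using assms(2) by simp
qed

section \<open>Eigenvectors of completely continuous operators\<close>

text \<open>Approximate maximisers \<open>f n\<close> have a weakly convergent subsequence, on which
  \<open>T (f n)\<close> converges in norm. Since \<open>T (f n)\<close> is close to
  \<open>b f n\<close> with \<open>b > 0\<close>, the maximisers converge in norm as well.\<close>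

lemma ccont_max_eigenvector:
  fixes T :: "'v::countable l2 \<Rightarrow> 'v l2"
  assumes T: "bsym T" and cc: "ccont T" and pos: "0 < inner (T x0) x0"
  obtains b v where "0 < b" "norm v = 1" "T v = b *\<^sub>R v" "\<And>x. inner (T x) x \<le> b * (norm x)\<^sup>2"
proof -
  interpret T: bounded_linear T using T by (rule bsym_bounded_linear)
  have nT: "bsym (\<lambda>x. - T x)" using T unfolding bsym_def by (auto intro: bounded_linear_minus)
  have "x0 \<noteq> 0" using pos by (auto simp: T.zero)
  then obtain k f where k: "\<And>x. k * (norm x)\<^sup>2 \<le> inner (- T x) x" and f: "\<And>n::nat. norm (f n) = 1"
    and lim: "(\<lambda>n. - T (f n) - k *\<^sub>R f n) \<longlonglongrightarrow> 0"
    using bsym_inf_approx[OF nT] by blast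
  have k0: "k < 0"
  proof (rule ccontr)
    assume "\<not> k < 0"
    then have "0 \<le> k * (norm x0)\<^sup>2" by simp
    then show False using k[of x0] pos by simp
  qed
  obtain r l where r: "strict_mono (r::nat\<Rightarrow>nat)" and w: "wnull (\<lambda>n. f (r n) - l)"
    using weak_compactness[of f 1] f by auto
  have "(\<lambda>n. T (f (r n) - l)) \<longlonglongrightarrow> 0" using cc w unfolding ccont_def by blast
  then have Tf: "(\<lambda>n. T (f (r n))) \<longlonglongrightarrow> T l" by (simp add: T.diff LIM_zero_iff)
  have limr: "(\<lambda>n. - T (f (r n)) - k *\<^sub>R f (r n)) \<longlonglongrightarrow> 0"
    using LIMSEQ_subseq_LIMSEQ[OF lim r] by (simp add: o_def)
  from tendsto_scaleR[OF tendsto_const[of "- 1 / k"] tendsto_add[OF limr Tf]]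
  have fv: "(\<lambda>n. f (r n)) \<longlonglongrightarrow> (- 1 / k) *\<^sub>R T l" using k0 by simp
  define v where "v = (- 1 / k) *\<^sub>R T l"
  have fv: "(\<lambda>n. f (r n)) \<longlonglongrightarrow> v" using fv by (simp add: v_def)
  have "(\<lambda>n. norm (f (r n))) \<longlonglongrightarrow> norm v" by (rule tendsto_norm[OF fv])
  then have nv: "norm v = 1" by (simp add: f LIMSEQ_const_iff)
  have "(\<lambda>n. - T (f (r n)) - k *\<^sub>R f (r n)) \<longlonglongrightarrow> - T v - k *\<^sub>R v"
    by (intro tendsto_intros T.tendsto fv)
  then have "- T v - k *\<^sub>R v = 0" using limr LIMSEQ_unique by blast
  then have Tv: "T v = (- k) *\<^sub>R v" by (metis add.inverse_inverse eq_iff_diff_eq_0 scaleR_minus_left)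
  show ?thesis by (rule that[of "- k" v]) (use k0 nv Tv k in \<open>auto simp: le_minus_iff\<close>)
qed

text \<open>Gaussian elimination: equation \<open>i0\<close> eliminates the unknown
  \<open>j0\<close>. This is the dimension count behind the min-max comparison and the eigenvalue
  count.\<close>

lemma homogeneous_system_nontrivial:
  fixes a :: "'i \<Rightarrow> 'j \<Rightarrow> 'f::field"
  assumes "finite I" "finite J" "card I < card J"
  shows "\<exists>c. (\<exists>j\<in>J. c j \<noteq> 0) \<and> (\<forall>i\<in>I. (\<Sum>j\<in>J. a i j * c j) = 0)"
  using assms
proof (induction I arbitrary: J a rule: finite_induct)
  case empty
  then obtain j where "j \<in> J" by fastforce
  then show ?case by (intro exI[of _ "\<lambda>_. 1"]) auto
next
  case (insert i0 I)
  show ?case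
  proof (cases "\<forall>j\<in>J. a i0 j = 0")
    case True
    have "card I < card J" using insert by simp
    then obtain c where "\<exists>j\<in>J. c j \<noteq> 0" "\<forall>i\<in>I. (\<Sum>j\<in>J. a i j * c j) = 0"
      using insert.IH[of J a] insert.prems by blast
    then show ?thesis using True by (intro exI[of _ c]) auto
  next
    case False
    then obtain j0 where j0: "j0 \<in> J" "a i0 j0 \<noteq> 0" by blast
    let ?J = "J - {j0}" and ?a = "\<lambda>i j. a i j - a i j0 * a i0 j / a i0 j0"
    have "card I < card ?J" using insert j0 by simp
    then obtain c where c: "\<exists>j\<in>?J. c j \<noteq> 0" "\<forall>i\<in>I. (\<Sum>j\<in>?J. ?a i j * c j) = 0"
      using insert.IH[of ?J ?a] insert.prems by blast
    define s where "s = (\<Sum>j\<in>?J. a i0 j * c j)"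
    define c' where "c' = c(j0 := - s / a i0 j0)"
    have split: "(\<Sum>j\<in>J. a i j * c' j) = a i j0 * (- s / a i0 j0) + (\<Sum>j\<in>?J. a i j * c j)" for i
      using sum.remove[OF insert.prems(1) j0(1), of "\<lambda>j. a i j * c' j"]
      by (simp add: c'_def)
    have "(\<Sum>j\<in>J. a i j * c' j) = 0" if "i \<in> I" for i
    proof -
      have "(\<Sum>j\<in>?J. ?a i j * c j) = (\<Sum>j\<in>?J. a i j * c j - (a i j0 / a i0 j0) * (a i0 j * c j))"
        by (intro sum.cong refl) (simp add: algebra_simps)
      also have "\<dots> = (\<Sum>j\<in>?J. a i j * c j) - (a i j0 / a i0 j0) * s"
        by (simp only: sum_subtractf sum_distrib_left s_def)
      finally show ?thesis using c(2) that unfolding split by simp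
    qed
    moreover have "(\<Sum>j\<in>J. a i0 j * c' j) = 0"
      unfolding split s_def[symmetric] using j0(2) by simp
    moreover have "\<exists>j\<in>J. c' j \<noteq> 0" using c(1) by (auto simp: c'_def)
    ultimately show ?thesis by (intro exI[of _ c']) auto
  qed
qed

text \<open>If \<open>T\<close> is the resolvent with shift \<open>C\<close> and
  \<open>s > 0\<close>, an eigenvalue \<open>t >= s\<close> belongs to the operator eigenvalue
  \<open>1/t - C <= 1/s - C\<close>, so such families count eigenvalues from below.\<close>

definition eigenfamily :: "('v l2 \<Rightarrow> 'v l2) \<Rightarrow> real \<Rightarrow> nat \<Rightarrow> (nat \<Rightarrow> 'v l2) \<Rightarrow> bool" where
  "eigenfamily T s N F \<longleftrightarrow> orthonormal_upto N F \<and> (\<forall>i<N. \<exists>t\<ge>s. T (F i) = t *\<^sub>R F i)"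

lemma eigenfamily_mono: "eigenfamily T s N F \<Longrightarrow> k \<le> N \<Longrightarrow> eigenfamily T s k F"
  unfolding eigenfamily_def orthonormal_upto_def by (meson less_le_trans)

text \<open>Subtracting from \<open>T\<close> its part on a maximal eigenfamily leaves an operator whose largest
  eigenvalue lies below \<open>s\<close>, since its eigenvector would extend the family.\<close>

lemma eigenfamily_maximal:
  fixes T :: "'v::countable l2 \<Rightarrow> 'v l2"
  assumes T: "bsym T" "clinear_op T" and cc: "ccont T" and s: "0 < s"
    and none: "\<not> (\<exists>F. eigenfamily T s N F)"
  obtains k F b where "k < N" "eigenfamily T s k F" "0 \<le> b" "b < s"
    "\<And>f. (\<And>i. i < k \<Longrightarrow> cip (F i) f = 0) \<Longrightarrow> inner (T f) f \<le> b * (norm f)\<^sup>2"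
proof -
  interpret T: bounded_linear T using T(1) by (rule bsym_bounded_linear)
  \<comment> \<open>The empty family exists, so if every family could be replaced by a longer one, a
    family of size \<open>N\<close> would exist.\<close>
  have "\<exists>k F. eigenfamily T s k F \<and> \<not> (\<exists>G. eigenfamily T s (Suc k) G)"
  proof (rule ccontr)
    assume "\<not> ?thesis"
    then have "\<exists>F. eigenfamily T s k F" for k
    proof (induction k)
      case 0 then show ?case by (simp add: eigenfamily_def orthonormal_upto_def)
    qed blast
    then show False using none by blast
  qed
  then obtain k F where F: "eigenfamily T s k F" and max: "\<not> (\<exists>G. eigenfamily T s (Suc k) G)" by blast
  have kN: "k < N"
  proof (rule ccontr)
    assume "\<not> k < N"
    then show False using none eigenfamily_mono[OF F, of N] by auto
  qed
  have orth: "orthonormal_upto k F" using F by (simp add: eigenfamily_def)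
  obtain t where t: "\<And>i. i < k \<Longrightarrow> t i \<ge> s \<and> T (F i) = t i *\<^sub>R F i"
    using F unfolding eigenfamily_def by metis
  define D where "D f = (\<Sum>i<k. t i *\<^sub>R cscale (cip (F i) f) (F i))" for f
  define T' where "T' f = T f - D f" for f
  have cipF: "cip g (D f) = (\<Sum>i<k. of_real (t i) * (cip (F i) f * cip g (F i)))" for f g
    by (simp add: D_def cip_sum_right flip: cscale_of_real)
  have D_sym: "inner (D f) g = inner f (D g)" for f g
  proof -
    have "cip f (D g) = cnj (cip g (D f))"
      unfolding cipF cnj_sum complex_cnj_mult complex_cnj_complex_of_real
        cip_commute[of g "F _", symmetric] cip_commute[of f "F _"] cip_commute[of "F _" g] complex_cnj_cnj
      by (simp add: mult_ac)
    then show ?thesis by (metis Re_cip cip_commute)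
  qed
  have D_bl: "bounded_linear D"
    unfolding D_def
  proof (rule bounded_linear_sum)
    fix i
    show "bounded_linear (\<lambda>f. t i *\<^sub>R cscale (cip (F i) f) (F i))"
    proof (rule bounded_linear_compose[OF bounded_linear_scaleR_right], rule bounded_linear_intro[where K = "norm (F i) * norm (F i)"])
      fix f show "norm (cscale (cip (F i) f) (F i)) \<le> norm f * (norm (F i) * norm (F i))"
        using mult_right_mono[OF norm_cip_le[of "F i" f] norm_ge_zero[of "F i"]] by (simp add: mult_ac)
    qed (auto intro!: l2_eqI simp: cip_add_right algebra_simps simp flip: cscale_of_real)
  qed
  have T': "bsym T'" unfolding bsym_def T'_def
    using T(1) D_sym D_bl by (auto simp: bsym_def inner_diff_left inner_diff_right intro: bounded_linear_sub)
  have cc': "ccont T'"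
    unfolding ccont_def
  proof (intro allI impI)
    fix f :: "nat \<Rightarrow> 'v l2" assume f: "wnull f"
    have "(\<lambda>n. D (f n)) \<longlonglongrightarrow> (\<Sum>i<k. t i *\<^sub>R 0)"
      unfolding D_def
    proof (intro tendsto_sum tendsto_scaleR tendsto_const)
      fix i
      have "(\<lambda>n. cmod (cip (F i) (f n)) * norm (F i)) \<longlonglongrightarrow> 0"
        by (intro tendsto_mult_left_zero tendsto_norm_zero wnull_cip f)
      then show "(\<lambda>n. cscale (cip (F i) (f n)) (F i)) \<longlonglongrightarrow> 0"
        unfolding norm_cscale[symmetric] by (rule tendsto_norm_zero_cancel)
    qed
    then have D0: "(\<lambda>n. D (f n)) \<longlonglongrightarrow> 0" by simp
    have "(\<lambda>n. T (f n)) \<longlonglongrightarrow> 0" using cc f unfolding ccont_def by blast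
    from tendsto_diff[OF this D0] show "(\<lambda>n. T' (f n)) \<longlonglongrightarrow> 0" by (simp add: T'_def)
  qed
  have T'F: "T' (F j) = 0" if j: "j < k" for j
  proof -
    have "D (F j) = (\<Sum>i<k. if i = j then t j *\<^sub>R F j else 0)"
      unfolding D_def using orth j
      by (intro sum.cong refl) (auto simp: orthonormal_upto_def intro!: l2_eqI)
    then show ?thesis using t[OF j] j by (simp add: T'_def)
  qed
  have T'f: "T' f = T f" if "\<And>i. i < k \<Longrightarrow> cip (F i) f = 0" for f
  proof -
    have "D f = (\<Sum>i<k. 0)"
      unfolding D_def by (intro sum.cong refl) (auto intro!: l2_eqI simp: that)
    then show ?thesis by (simp add: T'_def)
  qed
  show ?thesis
  proof (cases "\<exists>x. 0 < inner (T' x) x")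
    case True
    then obtain b v where b: "0 < b" "norm v = 1" "T' v = b *\<^sub>R v" "\<And>x. inner (T' x) x \<le> b * (norm x)\<^sup>2"
      using ccont_max_eigenvector[OF T' cc'] by blast
    have T'c: "T' (cscale c f) = cscale c (T' f)" for c f
      using T(2) unfolding T'_def D_def clinear_op_def
      by (auto intro!: l2_eqI simp: algebra_simps sum_distrib_left)
    \<comment> \<open>The vector \<open>v\<close> lies in the range of \<open>T'\<close>, which is
      orthogonal to the kernel. Both \<open>F i\<close> and its multiple by \<i> lie in the kernel,
      so real orthogonality to both gives complex orthogonality.\<close>
    have perp: "cip (F i) v = 0" if i: "i < k" for i
    proof -
      have z: "inner (F i) (T' u) = 0" for u using bsymD[OF T', of "F i" u] T'F[OF i] by simp
      have z': "inner (cscale \<i> (F i)) (T' u) = 0" for u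
        using bsymD[OF T', of "cscale \<i> (F i)" u] T'F[OF i] by (simp add: T'c cip_eq flip: Re_cip)
      have "cip (F i) (T' v) = 0" using z[of v] z'[of v] by (simp add: complex_eq_iff Re_cip Im_cip)
      then show ?thesis using b(1,3) by (simp flip: cscale_of_real)
    qed
    have Tv: "T v = b *\<^sub>R v" using T'f[OF perp] b(3) by simp
    have "b < s"
    proof (rule ccontr)
      assume bs: "\<not> b < s"
      have "eigenfamily T s (Suc k) (F(k := v))"
        unfolding eigenfamily_def orthonormal_upto_def
      proof (intro conjI allI impI)
        fix i j assume "i < Suc k" "j < Suc k"
        then show "cip ((F(k := v)) i) ((F(k := v)) j) = (if i = j then 1 else 0)"
          using orth perp b(2) cip_commute[of v "F j"] unfolding orthonormal_upto_def
          by (auto simp: less_Suc_eq cip_self[of v])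
      next
        fix i assume "i < Suc k"
        then show "\<exists>t\<ge>s. T ((F(k := v)) i) = t *\<^sub>R (F(k := v)) i"
          using t Tv bs by (auto simp: less_Suc_eq not_less)
      qed
      then show False using max by blast
    qed
    then show ?thesis using kN F b T'f by (intro that[of k F b]) (auto intro: less_imp_le simp flip: T'f)
  next
    \<comment> \<open>If the form of \<open>T'\<close> is nowhere positive, \<open>b = 0\<close>
      serves as bound.\<close>
    case False
    show ?thesis
    proof (rule that[OF kN F, of 0])
      fix f assume "\<And>i. i < k \<Longrightarrow> cip (F i) f = 0"
      then have "T' f = T f" by (rule T'f)
      then show "inner (T f) f \<le> 0 * (norm f)\<^sup>2" using False by (metis mult_zero_left not_le)
    qed (use s in auto)
  qed
qed

section \<open>Resolvents of pencils and comparison of eigenvalues\<close>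

lemma bsym_bij_coercive:
  fixes B :: "'a::{real_inner, banach} \<Rightarrow> 'a"
  assumes B: "bsym B" and c: "0 < c" and coer: "\<And>x. c * (norm x)\<^sup>2 \<le> inner (B x) x"
  shows "bij B" "bsym (inv B)"
proof -
  show b: "bij B" by (rule lax_milgram[OF bsym_bounded_linear[OF B] c coer])
  have "c * norm x \<le> norm (B x)" for x
  proof (cases "x = 0")
    case False
    have "c * norm x * norm x \<le> norm (B x) * norm x"
      using coer[of x] norm_cauchy_schwarz[of "B x" x] by (simp add: power2_eq_square mult.assoc)
    then show ?thesis by (rule mult_right_le_imp_le) (use False in simp)
  qed simp
  then show "bsym (inv B)" by (rule bsym_inv[OF B b c])
qed

text \<open>In the application \<open>P\<close> is multiplication by \<open>(1 + d)\<^sup>-\<^sup>1\<^sup>/\<^sup>2\<close> and \<open>B\<close> represents the shifted form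
  on its form domain, so that \<open>pres P B\<close> is the resolvent of the associated operator.\<close>

definition pres :: "('v l2 \<Rightarrow> 'v l2) \<Rightarrow> ('v l2 \<Rightarrow> 'v l2) \<Rightarrow> 'v l2 \<Rightarrow> 'v l2" where
  "pres P B x = P (inv B (P x))"

text \<open>For \<open>t\<close> different from 0, an eigenvector of \<open>pres P B\<close> with
  eigenvalue \<open>t\<close> corresponds through \<open>G = inv B (P f)\<close> to the generalised
  problem \<open>B G = (1/t) P (P G)\<close>.\<close>

locale pencil =
  fixes P B :: "'v::countable l2 \<Rightarrow> 'v l2" and c :: real
  assumes P: "bsym P" "clinear_op P" and B: "bsym B" "clinear_op B" and c: "0 < c"
    and coer: "\<And>x. c * (norm x)\<^sup>2 \<le> inner (B x) x"
begin

sublocale P: bounded_linear P using P(1) by (rule bsym_bounded_linear)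
sublocale B: bounded_linear B using B(1) by (rule bsym_bounded_linear)

lemma bsym_invB: "bsym (inv B)"
  by (rule bsym_bij_coercive(2)[OF B(1) c coer])

sublocale Bi: bounded_linear "inv B" using bsym_invB by (rule bsym_bounded_linear)

lemma B_inv [simp]: "B (inv B x) = x" and inv_B [simp]: "inv B (B x) = x"
  using bsym_bij_coercive(1)[OF B(1) c coer] by (simp_all add: bij_is_surj surj_f_inv_f bij_is_inj)

lemma B_nonneg: "0 \<le> inner (B x) x"
  by (rule order_trans[OF _ coer]) (use c in simp)

lemma inv_B_cscale: "inv B (cscale a x) = cscale a (inv B x)"
  using B(2) inv_B[of "cscale a (inv B x)"] unfolding clinear_op_def by simp

lemma bsym_pres: "bsym (pres P B)"
  unfolding bsym_def pres_def
  using bounded_linear_compose[OF P.bounded_linear_axioms bounded_linear_compose[OF Bi.bounded_linear_axioms P.bounded_linear_axioms]]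
  by (simp add: bsymD[OF P(1)] bsymD[OF bsym_invB])

lemma clinear_pres: "clinear_op (pres P B)"
  using P(2) unfolding clinear_op_def pres_def by (simp add: inv_B_cscale)

lemma inner_pres: "inner (pres P B x) x = inner (inv B (P x)) (P x)"
  unfolding pres_def by (simp add: bsymD[OF P(1)])

lemma inner_pres_nonneg: "0 \<le> inner (pres P B x) x"
  unfolding inner_pres using B_nonneg[of "inv B (P x)"] by (simp add: inner_commute)

text \<open>Cauchy-Schwarz for the form of \<open>B\<close> between \<open>inv B (P (P G))\<close>
  and \<open>G\<close>. An upper bound for the form at \<open>G\<close> thereby becomes a lower
  bound for the resolvent at \<open>P G\<close>.\<close>

lemma norm_P_pow4_le:
  "((norm (P G))\<^sup>2)\<^sup>2 \<le> inner (pres P B (P G)) (P G) * inner (B G) G"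
proof -
  let ?h = "inv B (P (P G))"
  have "(norm (P G))\<^sup>2 = inner (B ?h) G"
    by (simp add: bsymD[OF P(1)] power2_norm_eq_inner)
  then have "((norm (P G))\<^sup>2)\<^sup>2 \<le> inner (B ?h) ?h * inner (B G) G"
    using bsym_Cauchy_Schwarz[OF B(1) B_nonneg, of ?h G] by simp
  moreover have "inner (B ?h) ?h = inner (pres P B (P G)) (P G)"
    unfolding inner_pres B_inv by (rule inner_commute)
  ultimately show ?thesis by simp
qed

lemma ccont_pres: "ccont P \<Longrightarrow> ccont (pres P B)"
  unfolding ccont_def pres_def
proof (intro allI impI)
  fix f :: "nat \<Rightarrow> 'v l2" assume "\<forall>f. wnull f \<longrightarrow> (\<lambda>n. P (f n)) \<longlonglongrightarrow> 0" "wnull f"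
  then have "(\<lambda>n. P (f n)) \<longlonglongrightarrow> 0" by blast
  from P.tendsto[OF Bi.tendsto[OF this]] show "(\<lambda>n. P (inv B (P (f n)))) \<longlonglongrightarrow> 0"
    by (simp add: Bi.zero P.zero)
qed

end

text \<open>Resolvent identity: the difference is
  \<open>P (inv B ((B' - B) (inv B' (P x))))\<close>. The inner factors preserve weakly null
  sequences and the outer ones are continuous.\<close>

lemma ccont_pres_diff:
  assumes "pencil P B c" "pencil P B' c'" and cc: "ccont (\<lambda>x. B' x - B x)"
  shows "ccont (\<lambda>x. pres P B x - pres P B' x)"
proof -
  interpret p: pencil P B c by fact
  interpret p': pencil P B' c' by fact
  show ?thesis
    unfolding ccont_def
  proof (intro allI impI)
    fix f :: "nat \<Rightarrow> 'a l2" assume f: "wnull f"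
    have "wnull (\<lambda>n. inv B' (P (f n)))"
      by (rule wnull_bsym[OF p'.bsym_invB wnull_bsym[OF p.P(1) f]])
    then have "(\<lambda>n. B' (inv B' (P (f n))) - B (inv B' (P (f n)))) \<longlonglongrightarrow> 0" using cc unfolding ccont_def by blast
    from p.P.tendsto[OF p.Bi.tendsto[OF this]]
    show "(\<lambda>n. pres P B (f n) - pres P B' (f n)) \<longlonglongrightarrow> 0"
      by (simp add: pres_def p.Bi.diff p.P.diff p.Bi.zero p.P.zero)
  qed
qed

text \<open>Min-max as a contradiction. If the second resolvent had too few large eigenvalues, some
  nonzero combination of the \<open>N\<close> vectors \<open>U\<close> would be orthogonal to all
  its eigenvectors \<open>F\<close>. The form inequality bounds the second form on this combination
  from above, the orthogonality bounds the resolvent from above, and \<open>norm_P_pow4_le\<close>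
  forbids both at once.\<close>

lemma eigenfamily_compare:
  assumes p1: "pencil P B1 c1" and p2: "pencil P B2 c2" and cc: "ccont (pres P B2)"
    and a: "0 \<le> a" and le: "\<And>G. inner (B2 G) G \<le> a * inner (B1 G) G + g * (norm (P G))\<^sup>2"
    and nu: "0 < nu" "0 < a * nu + g" and U: "eigenfamily (pres P B1) (1 / nu) N U"
  shows "\<exists>F. eigenfamily (pres P B2) (1 / (a * nu + g)) N F"
proof (rule ccontr)
  interpret p1: pencil P B1 c1 by fact
  interpret p2: pencil P B2 c2 by fact
  define nu2 where "nu2 = a * nu + g"
  have nu2: "0 < nu2" using nu by (simp add: nu2_def)
  assume "\<not> ?thesis"
  then have none: "\<not> (\<exists>F. eigenfamily (pres P B2) (1 / nu2) N F)" by (simp add: nu2_def)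
  obtain k F b where k: "k < N" and F: "eigenfamily (pres P B2) (1 / nu2) k F" and b: "0 \<le> b" "b < 1 / nu2"
    and bd: "\<And>f. (\<And>i. i < k \<Longrightarrow> cip (F i) f = 0) \<Longrightarrow> inner (pres P B2 f) f \<le> b * (norm f)\<^sup>2"
    by (rule eigenfamily_maximal[OF p2.bsym_pres p2.clinear_pres cc _ none]) (simp add: nu2, rule that, assumption+, blast)
  obtain c where c: "\<exists>j\<in>{..<N}. c j \<noteq> 0" "\<And>i. i < k \<Longrightarrow> (\<Sum>j<N. cip (F i) (U j) * c j) = 0"
    using homogeneous_system_nontrivial[of "{..<k}" "{..<N}" "\<lambda>i j. cip (F i) (U j)"] k by auto
  obtain t where t: "\<And>j. j < N \<Longrightarrow> t j \<ge> 1 / nu \<and> pres P B1 (U j) = t j *\<^sub>R U j"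
    using U unfolding eigenfamily_def by metis
  have t0: "0 < t j" if "j < N" for j using t[OF that] nu(1) by (meson divide_pos_pos less_le_trans zero_less_one)
  define f where "f = (\<Sum>j<N. cscale (c j) (U j))"
  \<comment> \<open>The coefficients are divided by the eigenvalues so that the first resolvent maps
    \<open>h\<close> to \<open>f\<close>; thus \<open>f = P G\<close> with \<open>G\<close> at hand
    for the form inequality.\<close>
  define h where "h = (\<Sum>j<N. cscale (c j * of_real (1 / t j)) (U j))"
  define G where "G = inv B1 (P h)"
  have cU: "cip (U i) (U j) = (if i = j then 1 else 0)" if "i < N" "j < N" for i j
    using U that unfolding eigenfamily_def orthonormal_upto_def by blast
  have cf: "cip (U j) f = c j" if j: "j < N" for j
  proof -
    have "cip (U j) f = (\<Sum>i<N. if i = j then c j else 0)"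
      unfolding f_def cip_sum_right by (intro sum.cong refl) (auto simp: cU j)
    then show ?thesis using j by simp
  qed
  have f0: "f \<noteq> 0"
  proof
    assume f0: "f = 0"
    obtain j where j: "j < N" "c j \<noteq> 0" using c(1) by auto
    then show False using cf[OF j(1)] f0 by (simp add: cip_eq)
  qed
  have PG: "P G = f"
  proof -
    have "P G = pres P B1 h" by (simp add: G_def pres_def)
    also have "\<dots> = (\<Sum>j<N. pres P B1 (cscale (c j * of_real (1 / t j)) (U j)))"
      unfolding h_def by (rule linear_sum[OF bounded_linear.linear[OF bsym_bounded_linear[OF p1.bsym_pres]]])
    also have "\<dots> = f"
      unfolding f_def
    proof (intro sum.cong refl)
      fix j assume "j \<in> {..<N}"
      then have j: "j < N" by simp
      have "pres P B1 (cscale (c j * of_real (1 / t j)) (U j)) = cscale (c j * of_real (1 / t j)) (t j *\<^sub>R U j)"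
        using p1.clinear_pres t[OF j] unfolding clinear_op_def by simp
      also have "\<dots> = cscale (c j) (U j)" using t0[OF j] by (intro l2_eqI) simp
      finally show "pres P B1 (cscale (c j * of_real (1 / t j)) (U j)) = cscale (c j) (U j)" .
    qed
    finally show ?thesis .
  qed
  have perp: "cip (F i) f = 0" if "i < k" for i
    using c(2)[OF that] by (simp add: f_def cip_sum_right mult.commute)
  have nf: "(norm f)\<^sup>2 = (\<Sum>j<N. (cmod (c j))\<^sup>2)"
  proof -
    have "cip f f = (\<Sum>j<N. c j * cip f (U j))" 
      using arg_cong[OF f_def, of "cip f"] by (simp only: cip_sum_right cip_cscale_right)
    also have "\<dots> = (\<Sum>j<N. c j * cnj (c j))"
      by (intro sum.cong refl) (use cf cip_commute[of f] in auto)
    also have "\<dots> = of_real (\<Sum>j<N. (cmod (c j))\<^sup>2)" by (simp only: of_real_sum complex_norm_square)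
    finally show ?thesis unfolding cip_self of_real_eq_iff .
  qed
  have "inner (B1 G) G = inner h f"
    using bsymD[OF p1.P(1), of h G] by (simp add: G_def) (simp add: G_def[symmetric] PG)
  also have "\<dots> = (\<Sum>j<N. (1 / t j) * (cmod (c j))\<^sup>2)"
  proof -
    have "cip f h = (\<Sum>j<N. (c j * of_real (1 / t j)) * cip f (U j))" by (simp add: h_def cip_sum_right)
    also have "\<dots> = (\<Sum>j<N. of_real (1 / t j) * (c j * cnj (c j)))"
      by (intro sum.cong refl) (use cf cip_commute[of f] in auto)
    also have "\<dots> = of_real (\<Sum>j<N. (1 / t j) * (cmod (c j))\<^sup>2)"
      by (simp only: of_real_sum of_real_mult complex_norm_square)
    finally show ?thesis by (metis Re_cip Re_complex_of_real inner_commute)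
  qed
  also have "\<dots> \<le> (\<Sum>j<N. nu * (cmod (c j))\<^sup>2)"
  proof (intro sum_mono mult_right_mono)
    fix j assume "j \<in> {..<N}"
    then have j: "j < N" by simp
    show "1 / t j \<le> nu" using t[OF j] t0[OF j] nu(1) by (simp add: field_simps)
  qed simp
  also have "\<dots> = nu * (norm f)\<^sup>2" by (simp add: nf sum_distrib_left)
  finally have "inner (B2 G) G \<le> a * (nu * (norm f)\<^sup>2) + g * (norm f)\<^sup>2"
    using le[of G] mult_left_mono[OF _ a] unfolding PG by fastforce
  then have B2: "inner (B2 G) G \<le> nu2 * (norm f)\<^sup>2" by (simp add: nu2_def algebra_simps)
  have "((norm f)\<^sup>2)\<^sup>2 \<le> inner (pres P B2 f) f * inner (B2 G) G"
    using p2.norm_P_pow4_le[of G] by (simp add: PG)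
  also have "\<dots> \<le> (b * (norm f)\<^sup>2) * (nu2 * (norm f)\<^sup>2)"
    using b by (intro mult_mono bd[OF perp] B2 p2.B_nonneg) auto
  also have "\<dots> = (b * nu2) * ((norm f)\<^sup>2)\<^sup>2" by (simp add: power2_eq_square)
  also have "\<dots> < 1 * ((norm f)\<^sup>2)\<^sup>2"
    using b nu2 f0 by (intro mult_strict_right_mono) (auto simp: field_simps)
  finally show False by simp
qed

section \<open>A Weyl sequence at the top of the form at infinity\<close>

lemma trunc_tendsto_zero:
  assumes S: "finite S" and f: "wnull f"
  shows "(\<lambda>n. trunc S (f n)) \<longlonglongrightarrow> 0"
proof -
  have eq: "trunc S g = (\<Sum>x\<in>S. cscale (coord g x) (basis x))" for g :: "'a l2"
    by (rule l2_eqI) (simp add: S if_distrib[of "(*) _"] cong: if_cong)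
  have "(\<lambda>n. \<Sum>x\<in>S. cscale (coord (f n) x) (basis x)) \<longlonglongrightarrow> (\<Sum>x\<in>S. 0)"
  proof (rule tendsto_sum)
    fix x
    have "(\<lambda>n. norm (coord (f n) x)) \<longlonglongrightarrow> 0" using f unfolding wnull_def by (intro tendsto_norm_zero) blast
    then have "(\<lambda>n. norm (cscale (coord (f n) x) (basis x))) \<longlonglongrightarrow> 0" by simp
    then show "(\<lambda>n. cscale (coord (f n) x) (basis x)) \<longlonglongrightarrow> 0" by (rule tendsto_norm_zero_cancel)
  qed
  then show ?thesis by (simp add: eq)
qed

text \<open>Take the suprema \<open>s n\<close> of the form over unit vectors vanishing on growing
  finite sets; their limit \<open>b\<close> is at least \<open>c\<close>. Near-maximisers escape to
  infinity and are weakly null. Along weakly null sequences \<open>b - T\<close> is asymptotically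
  nonnegative, and its form is asymptotically at most 0 on the near-maximisers, which forces
  \<open>(b - T) f\<close> to vanish in the limit.\<close>

lemma weyl_exists:
  fixes T :: "'v::countable l2 \<Rightarrow> 'v l2"
  assumes T: "bsym T" and c: "0 < c" and X: "infinite X" "\<And>x. x \<in> X \<Longrightarrow> c \<le> inner (T (basis x)) (basis x)"
  shows "\<exists>b>0. weyl T b"
proof -
  interpret T: bounded_linear T using T by (rule bsym_bounded_linear)
  obtain M where M: "0 < M" "\<And>x. norm (T x) \<le> M * norm x" using bsym_bound[OF T] by blast
  have TM: "\<bar>inner (T f) f\<bar> \<le> M * (norm f)\<^sup>2" for f
    using Cauchy_Schwarz_ineq2[of "T f" f] mult_right_mono[OF M(2)[of f] norm_ge_zero[of f]]
    by (simp add: power2_eq_square mult.assoc)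
  define S where "S n = {x::'v. to_nat x < n}" for n :: nat
  have Sfin: "finite (S n)" for n
    unfolding S_def by (rule finite_imageD[of to_nat]) (auto intro: finite_subset[of _ "{..<n}"] inj_on_subset)
  define V where "V n = {inner (T f) f | f. norm f = 1 \<and> (\<forall>x\<in>S n. coord f x = 0)}" for n
  have Vc: "\<exists>v\<in>V n. c \<le> v" for n
  proof -
    obtain x where x: "x \<in> X" "x \<notin> S n" using X(1) Sfin[of n] by (meson finite_subset subsetI)
    then have "inner (T (basis x)) (basis x) \<in> V n"
      unfolding V_def by (intro CollectI exI[of _ "basis x"]) auto
    then show ?thesis using X(2)[OF x(1)] by blast
  qed
  have Vbd: "bdd_above (V n)" for n
  proof (rule bdd_aboveI[of _ M])
    fix v assume "v \<in> V n"
    then obtain f where "v = inner (T f) f" "norm f = 1" by (auto simp: V_def)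
    then show "v \<le> M" using TM[of f] by simp
  qed
  define s where "s n = Sup (V n)" for n
  have sup: "inner (T f) f \<le> s n * (norm f)\<^sup>2" if f: "\<And>x. x \<in> S n \<Longrightarrow> coord f x = 0" for f n
  proof (cases "f = 0")
    case False
    have "inner (T (sgn f)) (sgn f) \<in> V n"
      unfolding V_def using False f by (intro CollectI exI[of _ "sgn f"]) (auto simp: norm_sgn sgn_div_norm)
    then have "inner (T (sgn f)) (sgn f) \<le> s n" unfolding s_def by (rule cSup_upper[OF _ Vbd])
    moreover have "inner (T (sgn f)) (sgn f) = inner (T f) f / (norm f)\<^sup>2"
      by (simp add: sgn_div_norm T.scaleR power2_eq_square field_simps)
    ultimately show ?thesis using False by (simp add: divide_le_eq)
  qed (simp add: T.zero)
  have sc: "c \<le> s n" for n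
    using Vc[of n] cSup_upper[OF _ Vbd[of n]] unfolding s_def by (meson order_trans)
  have "V (Suc n) \<subseteq> V n" for n by (auto simp: V_def S_def)
  then have dec: "decseq s"
    unfolding s_def using Vbd Vc by (intro decseq_SucI cSup_subset_mono) blast+
  obtain b where b: "s \<longlonglongrightarrow> b" "\<And>n. b \<le> s n" 
    using decseq_convergent[OF dec, of c] sc by blast
  have bc: "c \<le> b" using LIMSEQ_le_const[OF b(1)] sc by blast
  have "\<exists>f. norm f = 1 \<and> (\<forall>x\<in>S n. coord f x = 0) \<and> s n - 1 / real (Suc n) < inner (T f) f" for n
  proof -
    have "s n - 1 / real (Suc n) < Sup (V n)" by (simp add: s_def)
    then obtain v where "v \<in> V n" "s n - 1 / real (Suc n) < v"
      using less_cSup_iff[OF _ Vbd[of n]] Vc[of n] by blast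
    then show ?thesis by (auto simp: V_def)
  qed
  then obtain f where f: "\<And>n. norm (f n) = 1" "\<And>n x. x \<in> S n \<Longrightarrow> coord (f n) x = 0"
    "\<And>n. s n - 1 / real (Suc n) < inner (T (f n)) (f n)" by metis
  have wf: "wnull f"
    unfolding wnull_def
  proof (intro conjI allI)
    show "\<exists>b. \<forall>n. norm (f n) \<le> b" using f(1) by (intro exI[of _ 1]) simp
    fix x
    have "\<forall>\<^sub>F n in sequentially. coord (f n) x = 0"
      using eventually_gt_at_top[of "to_nat x"] by eventually_elim (simp add: f(2) S_def)
    then show "(\<lambda>n. coord (f n) x) \<longlonglongrightarrow> 0" by (rule tendsto_eventually)
  qed
  define Pb where "Pb x = b *\<^sub>R x - T x" for x
  have "bsym (\<lambda>x. T x - b *\<^sub>R x)" by (rule bsym_shift[OF T])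
  then have Pb: "bsym Pb"
    unfolding bsym_def Pb_def using bounded_linear_minus[of "\<lambda>x. T x - b *\<^sub>R x"]
    by (simp add: inner_diff_left inner_diff_right)
  interpret Pb: bounded_linear Pb using Pb by (rule bsym_bounded_linear)
  obtain L where L: "0 < L" "\<And>x. norm (Pb x) \<le> L * norm x" using bsym_bound[OF Pb] by blast
  \<comment> \<open>Fix \<open>k\<close> with \<open>s k\<close> close to \<open>b\<close>. Deleting
    the coordinates in \<open>S k\<close> changes the form by a null sequence and leaves a vector to
    which the bound by \<open>s k\<close> applies.\<close>
  have asym: "\<forall>\<^sub>F n in sequentially. - e < inner (Pb (h n)) (h n)" if h: "wnull h" and e: "0 < e" for h e
  proof -
    obtain u where u: "\<And>n. norm (h n) \<le> u" using h unfolding wnull_def by blast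
    have "\<forall>\<^sub>F k in sequentially. s k < b + e / (2 * (u\<^sup>2 + 1))"
      using e by (intro order_tendstoD(2)[OF b(1)]) (simp add: add_nonneg_pos)
    then obtain k where k: "s k < b + e / (2 * (u\<^sup>2 + 1))" 
      using eventually_happens'[OF sequentially_bot] by blast
    define q where "q n = h n - trunc (S k) (h n)" for n
    have qh: "(\<lambda>n. trunc (S k) (h n)) \<longlonglongrightarrow> 0" by (rule trunc_tendsto_zero[OF Sfin h])
    have low: "- (e / 2) \<le> inner (Pb (q n)) (q n)" for n
    proof -
      have nq: "(norm (q n))\<^sup>2 \<le> u\<^sup>2"
      proof (rule norm_l2_leI)
        fix U :: "'v set" assume U: "finite U"
        have "(\<Sum>x\<in>U. (cmod (coord (q n) x))\<^sup>2) \<le> (\<Sum>x\<in>U. (cmod (coord (h n) x))\<^sup>2)"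
          by (intro sum_mono) (simp add: q_def)
        also have "\<dots> \<le> (norm (h n))\<^sup>2" by (rule sum_coord_le[OF U])
        also have "\<dots> \<le> u\<^sup>2" by (intro power_mono u) simp
        finally show "(\<Sum>x\<in>U. (cmod (coord (q n) x))\<^sup>2) \<le> u\<^sup>2" .
      qed
      have "inner (T (q n)) (q n) \<le> s k * (norm (q n))\<^sup>2" by (rule sup) (simp add: q_def)
      then have "inner (Pb (q n)) (q n) \<ge> - ((s k - b) * (norm (q n))\<^sup>2)"
        by (simp add: Pb_def inner_diff_left dot_square_norm algebra_simps)
      moreover have "(s k - b) * (norm (q n))\<^sup>2 \<le> e / (2 * (u\<^sup>2 + 1)) * u\<^sup>2"
        using k b(2)[of k] nq by (intro mult_mono) auto
      moreover have "e / (2 * (u\<^sup>2 + 1)) * u\<^sup>2 \<le> e / 2"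
        using e by (simp add: divide_simps add_nonneg_pos)
      ultimately show ?thesis by linarith
    qed
    have "(\<lambda>n. inner (Pb (h n)) (h n) - inner (Pb (q n)) (q n)) \<longlonglongrightarrow> 0"
    proof (rule Lim_null_comparison[OF always_eventually], intro allI)
      fix n
      let ?t = "trunc (S k) (h n)"
      have "inner (Pb (h n)) (h n) - inner (Pb (q n)) (q n) = 2 * inner (Pb (h n)) ?t - inner (Pb ?t) ?t"
        using bsymD[OF Pb, of ?t "h n"] 
        by (simp add: q_def Pb.diff inner_diff_left inner_diff_right inner_commute)
      then have "norm (inner (Pb (h n)) (h n) - inner (Pb (q n)) (q n))
          \<le> 2 * \<bar>inner (Pb (h n)) ?t\<bar> + \<bar>inner (Pb ?t) ?t\<bar>" by simp
      also have "\<dots> \<le> 2 * (L * u * norm ?t) + L * norm ?t * norm ?t"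
      proof -
        have "\<bar>inner (Pb (h n)) ?t\<bar> \<le> norm (Pb (h n)) * norm ?t" by (rule Cauchy_Schwarz_ineq2)
        also have "\<dots> \<le> L * u * norm ?t"
          using L(1) by (intro mult_right_mono order_trans[OF L(2)] mult_left_mono u) auto
        finally have 1: "\<bar>inner (Pb (h n)) ?t\<bar> \<le> L * u * norm ?t" .
        have "\<bar>inner (Pb ?t) ?t\<bar> \<le> norm (Pb ?t) * norm ?t" by (rule Cauchy_Schwarz_ineq2)
        also have "\<dots> \<le> L * norm ?t * norm ?t" by (intro mult_right_mono L(2)) auto
        finally show ?thesis using 1 by linarith
      qed
      finally show "norm (inner (Pb (h n)) (h n) - inner (Pb (q n)) (q n))
          \<le> 2 * (L * u * norm ?t) + L * norm ?t * norm ?t" .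
      have "(\<lambda>n. 2 * (L * u * norm (trunc (S k) (h n))) + L * norm (trunc (S k) (h n)) * norm (trunc (S k) (h n)))
         \<longlonglongrightarrow> 2 * (L * u * norm (0 :: 'v l2)) + L * norm (0 :: 'v l2) * norm (0 :: 'v l2)"
        by (intro tendsto_intros qh)
      then show "(\<lambda>n. 2 * (L * u * norm (trunc (S k) (h n))) + L * norm (trunc (S k) (h n)) * norm (trunc (S k) (h n)))
         \<longlonglongrightarrow> 0" by simp
    qed
    then have "\<forall>\<^sub>F n in sequentially. - (e / 2) < inner (Pb (h n)) (h n) - inner (Pb (q n)) (q n)"
      by (rule order_tendstoD(1)) (use e in simp)
    then show ?thesis
    proof eventually_elim
      case (elim n)
      then show ?case using low[of n] by linarith
    qed
  qed
  have Pf: "\<forall>\<^sub>F n in sequentially. inner (Pb (f n)) (f n) < e" if "0 < e" for e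
  proof -
    have inv0: "(\<lambda>n. 1 / real (Suc n)) \<longlonglongrightarrow> 0"
      using LIMSEQ_inverse_real_of_nat by (simp only: inverse_eq_divide)
    have "\<forall>\<^sub>F n in sequentially. 1 / real (Suc n) < e" by (rule order_tendstoD(2)[OF inv0 that])
    then show ?thesis
    proof eventually_elim
      case (elim n)
      have "inner (Pb (f n)) (f n) = b - inner (T (f n)) (f n)"
        by (simp add: Pb_def inner_diff_left dot_square_norm f(1))
      then show ?case using f(3)[of n] b(2)[of n] elim by linarith
    qed
  qed
  have "(\<lambda>n. Pb (f n)) \<longlonglongrightarrow> 0"
  proof (rule tendsto_norm_zero_cancel, rule LIMSEQ_I)
    fix e :: real assume e: "0 < e"
    define r where "r = e\<^sup>2"
    have r: "0 < r" using e by (simp add: r_def)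
    define g where "g n = Pb (f n)" for n
    \<comment> \<open>Testing \<open>asym\<close> on \<open>f n - t g n\<close> with
      \<open>g n = Pb (f n)\<close> gives \<open>2 t norm(g n)^2 < t^2 K\<close>: the form at
      \<open>g n\<close> contributes at most \<open>L * L^2\<close> and the two error bounds
      \<open>t^2\<close> contribute the 2. The choice \<open>t = r / K\<close> turns the right side
      into \<open>t r\<close>.\<close>
    define K where "K = L * L\<^sup>2 + 2"
    have K2: "2 \<le> K" using L(1) by (simp add: K_def)
    define t where "t = r / K"
    have t: "0 < t" using r K2 by (simp add: t_def)
    have ng: "norm (g n) \<le> L" for n using L(2)[of "f n"] by (simp add: g_def f(1))
    have wg: "wnull g" unfolding g_def by (rule wnull_bsym[OF Pb wf])
    have wh: "wnull (\<lambda>n. f n - t *\<^sub>R g n)"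
      unfolding wnull_def
    proof (intro conjI allI exI)
      fix n
      have "norm (f n - t *\<^sub>R g n) \<le> 1 + t * norm (g n)"
        using norm_triangle_ineq4[of "f n" "t *\<^sub>R g n"] t f(1)[of n] by simp
      also have "\<dots> \<le> 1 + t * L" using t ng[of n] by simp
      finally show "norm (f n - t *\<^sub>R g n) \<le> 1 + t * L" .
    next
      fix x
      have "(\<lambda>n. coord (f n) x - of_real t * coord (g n) x) \<longlonglongrightarrow> 0 - of_real t * 0"
        using wf wg unfolding wnull_def by (intro tendsto_intros) auto
      then show "(\<lambda>n. coord (f n - t *\<^sub>R g n) x) \<longlonglongrightarrow> 0" by simp
    qed
    have "\<forall>\<^sub>F n in sequentially. - (t\<^sup>2) < inner (Pb (f n - t *\<^sub>R g n)) (f n - t *\<^sub>R g n)"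
      by (rule asym[OF wh]) (use t in simp)
    moreover have "\<forall>\<^sub>F n in sequentially. inner (Pb (f n)) (f n) < t\<^sup>2" by (rule Pf) (use t in simp)
    ultimately have "\<forall>\<^sub>F n in sequentially. norm (Pb (f n)) < e"
    proof eventually_elim
      case (elim n)
      have "inner (Pb (f n - t *\<^sub>R g n)) (f n - t *\<^sub>R g n)
          = inner (Pb (f n)) (f n) - 2 * t * (norm (g n))\<^sup>2 + t\<^sup>2 * inner (Pb (g n)) (g n)"
        using bsymD[OF Pb, of "g n" "f n"] unfolding power2_norm_eq_inner
        by (simp add: Pb.diff Pb.scaleR inner_diff_left inner_diff_right
            g_def[symmetric] inner_commute power2_eq_square algebra_simps)
      moreover have "inner (Pb (g n)) (g n) \<le> L * L\<^sup>2"
      proof -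
        have "inner (Pb (g n)) (g n) \<le> norm (Pb (g n)) * norm (g n)" by (rule norm_cauchy_schwarz)
        also have "\<dots> \<le> (L * norm (g n)) * norm (g n)" by (intro mult_right_mono L(2)) auto
        also have "\<dots> \<le> (L * L) * L" using L(1) by (intro mult_mono ng mult_left_mono) auto
        finally show ?thesis by (simp add: power2_eq_square)
      qed
      then have "t\<^sup>2 * inner (Pb (g n)) (g n) \<le> t\<^sup>2 * (L * L\<^sup>2)" by (rule mult_left_mono) simp
      ultimately have "2 * t * (norm (g n))\<^sup>2 < t\<^sup>2 + t\<^sup>2 * (L * L\<^sup>2) + t\<^sup>2" using elim by linarith
      also have "\<dots> = t * (t * K)" by (simp add: K_def power2_eq_square algebra_simps)
      also have "\<dots> = t * r" using K2 by (simp add: t_def)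
      finally have "t * (2 * (norm (g n))\<^sup>2) < t * r" by (simp add: mult_ac)
      then have "2 * (norm (g n))\<^sup>2 < r" using t by simp
      then have "(norm (g n))\<^sup>2 < e\<^sup>2"
        using zero_le_power2[of "norm (g n)"] unfolding r_def by linarith
      then have "norm (g n) < e" by (rule power2_less_imp_less) (use e in simp)
      then show ?case by (simp add: g_def)
    qed
    then show "\<exists>N. \<forall>n\<ge>N. norm (norm (Pb (f n)) - 0) < e" by (simp add: eventually_sequentially)
  qed
  then have "(\<lambda>n. - Pb (f n)) \<longlonglongrightarrow> 0" using tendsto_minus by fastforce
  then have "weyl T b" unfolding weyl_def using f(1) wf by (intro exI[of _ f]) (simp add: Pb_def)
  then show ?thesis using bc c by (intro exI[of _ b]) auto
qed

section \<open>Trees\<close>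

definition edge_removed :: "('v \<Rightarrow> 'v \<Rightarrow> real) \<Rightarrow> 'v \<Rightarrow> 'v \<Rightarrow> 'v \<Rightarrow> 'v \<Rightarrow> bool" where
  "edge_removed E a b = (\<lambda>u w. adj E u w \<and> {u, w} \<noteq> {a, b})\<^sup>*\<^sup>*"

text \<open>\<open>par x p\<close>: the neighbour \<open>p\<close> of \<open>x\<close> lies on the side of the root \<open>r\<close>.\<close>

definition par :: "('v \<Rightarrow> 'v \<Rightarrow> real) \<Rightarrow> 'v \<Rightarrow> 'v \<Rightarrow> 'v \<Rightarrow> bool" where
  "par E r x p \<longleftrightarrow> adj E x p \<and> edge_removed E x p p r"

context
  fixes E :: "'v \<Rightarrow> 'v \<Rightarrow> real" and m :: "'v \<Rightarrow> real" and th :: "'v \<Rightarrow> 'v \<Rightarrow> real"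
  assumes tree: "weighted_tree E m th"
begin

lemma adj_sym: "adj E x y \<Longrightarrow> adj E y x"
  using tree unfolding weighted_tree_def weighted_graph_def adj_def by auto

lemma tree_connected: "(adj E)\<^sup>*\<^sup>* x y"
  using tree unfolding weighted_tree_def weighted_graph_def by blast

lemma edge_removed_sym: "edge_removed E a b x y \<Longrightarrow> edge_removed E a b y x"
  unfolding edge_removed_def
proof (induction rule: rtranclp_induct)
  case (step y z)
  have "adj E z y \<and> {z, y} \<noteq> {a, b}" using step(2) adj_sym by (auto simp: insert_commute)
  then show ?case using step.IH by (rule converse_rtranclp_into_rtranclp)
qed simp

lemma edge_removed_trans: "edge_removed E a b x y \<Longrightarrow> edge_removed E a b y z \<Longrightarrow> edge_removed E a b x z"
  unfolding edge_removed_def by (rule rtranclp_trans)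

lemma edge_removed_commute: "edge_removed E a b = edge_removed E b a"
  unfolding edge_removed_def by (simp add: insert_commute)

lemma edge_removed_step: "adj E u w \<Longrightarrow> {u, w} \<noteq> {a, b} \<Longrightarrow> edge_removed E a b u w"
  unfolding edge_removed_def by (rule r_into_rtranclp) simp

text \<open>A tree only promises that some pair of vertices is separated. If the ends of the edge
  stayed connected, every walk could bypass the edge and no pair would be separated.\<close>

lemma edge_removed_disconnects:
  assumes "adj E a b"
  shows "\<not> edge_removed E a b a b"
proof
  assume ab: "edge_removed E a b a b"
  have "edge_removed E a b x y" for x y
    using tree_connected[of x y]
  proof (induction rule: rtranclp_induct)
    case base
    show ?case by (simp add: edge_removed_def)
  next
    case (step u w)
    have "edge_removed E a b u w"
    proof (cases "{u, w} = {a, b}")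
      case True
      then show ?thesis using ab edge_removed_sym[OF ab] by (auto simp: doubleton_eq_iff)
    qed (rule edge_removed_step[OF step(2)])
    then show ?case using step.IH edge_removed_trans by blast
  qed
  then show False using tree assms unfolding weighted_tree_def edge_removed_def by blast
qed

text \<open>Along any walk from \<open>x\<close> each vertex stays connected, without the edge, to
  one of its two ends; this is applied to the root.\<close>

lemma par_total:
  assumes xy: "adj E x y"
  shows "par E r x y \<or> par E r y x"
proof -
  have "edge_removed E x y v x \<or> edge_removed E x y v y" for v
    using tree_connected[of x v]
  proof (induction rule: rtranclp_induct)
    case base
    show ?case by (simp add: edge_removed_def)
  next
    case (step u w)
    show ?case
    proof (cases "{u, w} = {x, y}")
      case True
      then show ?thesis by (auto simp: doubleton_eq_iff edge_removed_def)
    next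
      case False
      have "edge_removed E x y w u" by (rule edge_removed_sym[OF edge_removed_step[OF step(2) False]])
      then show ?thesis using step.IH edge_removed_trans by blast
    qed
  qed
  then have "edge_removed E x y x r \<or> edge_removed E x y y r" using edge_removed_sym by blast
  then show ?thesis
    unfolding par_def using xy adj_sym[OF xy] edge_removed_commute[of x y] by auto
qed

lemma par_asym: "par E r x y \<Longrightarrow> \<not> par E r y x"
proof
  assume "par E r x y" "par E r y x"
  then have "adj E x y" "edge_removed E x y y r" "edge_removed E x y x r"
    unfolding par_def using edge_removed_commute[of x y] by auto
  then show False using edge_removed_disconnects edge_removed_sym edge_removed_trans by blast
qed

text \<open>Without the edge to \<open>p\<close>, the component of \<open>p\<close> avoids
  \<open>x\<close>, so the connection from \<open>p\<close> to the root never uses the edge from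
  \<open>x\<close> to \<open>q\<close>. Through \<open>p\<close> and the root, \<open>x\<close> and
  \<open>q\<close> would stay connected without their edge.\<close>

lemma par_unique:
  assumes p: "par E r x p" and q: "par E r x q"
  shows "p = q"
proof (rule ccontr)
  assume pq: "p \<noteq> q"
  have xp: "adj E x p" "edge_removed E x p p r" and xq: "adj E x q" "edge_removed E x q q r"
    using p q by (auto simp: par_def)
  have notx: "v \<noteq> x" if "edge_removed E x p p v" for v
    using that edge_removed_disconnects[OF xp(1)] edge_removed_sym by blast
  have "edge_removed E x q p v" if "edge_removed E x p p v" for v
    using that unfolding edge_removed_def[of E x p]
  proof (induction rule: rtranclp_induct)
    case base
    show ?case by (simp add: edge_removed_def)
  next
    case (step u w)
    have u: "edge_removed E x p p u" using step(1) by (simp add: edge_removed_def)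
    then have "edge_removed E x p p w" using edge_removed_trans edge_removed_step step(2) by blast
    then have "w \<noteq> x" "u \<noteq> x" using notx u by auto
    then have "{u, w} \<noteq> {x, q}" by (auto simp: doubleton_eq_iff)
    then have "edge_removed E x q u w" using step(2) edge_removed_step by blast
    then show ?case using step.IH edge_removed_trans by blast
  qed
  then have "edge_removed E x q p r" using xp(2) by blast
  moreover have "edge_removed E x q x p"
    using pq by (intro edge_removed_step xp(1)) (auto simp: doubleton_eq_iff)
  ultimately have "edge_removed E x q x q"
    using xq(2) edge_removed_trans edge_removed_sym by blast
  then show False using edge_removed_disconnects[OF xq(1)] by blast
qed

lemma par_root: "\<not> par E r r y"
  unfolding par_def using edge_removed_disconnects edge_removed_sym by blast

end

section \<open>Gauging away a potential on a tree\<close>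

text \<open>The phase accumulated on the path from a vertex to the root. It is a relation first;
  uniqueness of parents makes it a function and connectedness makes it total.\<close>

inductive tree_phase :: "('v \<Rightarrow> 'v \<Rightarrow> bool) \<Rightarrow> ('v \<Rightarrow> 'v \<Rightarrow> real) \<Rightarrow> 'v \<Rightarrow> 'v \<Rightarrow> complex \<Rightarrow> bool"
  for P :: "'v \<Rightarrow> 'v \<Rightarrow> bool" and dl :: "'v \<Rightarrow> 'v \<Rightarrow> real" and r :: 'v where
  root: "tree_phase P dl r r 1"
| step: "P x p \<Longrightarrow> tree_phase P dl r p z \<Longrightarrow> tree_phase P dl r x (cis (dl x p) * z)"

text \<open>Every edge joins a child to its parent, so prescribing the phase along the edges to the
  root leaves no cycle on which a flux could obstruct it. In use, \<open>dl\<close> is the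
  difference of two potentials.\<close>

lemma tree_gauge:
  assumes tree: "weighted_tree E m th" and dl: "\<And>x y. dl x y = - dl y x"
  obtains u :: "'v \<Rightarrow> complex" where "\<And>x. cmod (u x) = 1"
    "\<And>x y. adj E x y \<Longrightarrow> u x = cis (dl x y) * u y"
proof -
  fix r :: 'v
  let ?P = "par E r"
  have uniq: "z = z'" if "tree_phase ?P dl r x z" "tree_phase ?P dl r x z'" for x z z'
    using that
  proof (induction arbitrary: z' rule: tree_phase.induct)
    case root
    then show ?case by cases (use par_root[OF tree] in auto)
  next
    case (step x p z)
    from step.prems show ?case
    proof cases
      case root
      then show ?thesis using step.hyps par_root[OF tree] by blast
    next
      case (step p' z'')
      then have "p' = p" using par_unique[OF tree] \<open>?P x p\<close> by blast
      then show ?thesis using step step.IH[of z''] \<open>\<And>z'. tree_phase ?P dl r p z' \<Longrightarrow> z = z'\<close> by simp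
    qed
  qed
  have ex: "\<exists>z. tree_phase ?P dl r x z" for x
    using tree_connected[OF tree, of r x]
  proof (induction rule: rtranclp_induct)
    case base
    show ?case by (rule exI, rule tree_phase.root)
  next
    case (step y x)
    then obtain z where z: "tree_phase ?P dl r y z" by blast
    show ?case
    proof (cases "?P x y")
      case True
      show ?thesis by (rule exI, rule tree_phase.step[OF True z])
    next
      case False
      then have yx: "?P y x" using par_total[OF tree step(2)] by blast
      \<comment> \<open>Here the walk moves towards the root: the derivation for \<open>y\<close>
        ends with its unique parent \<open>x\<close> and so contains a derivation for
        \<open>x\<close>.\<close>
      from z show ?thesis
      proof cases
        case root
        then show ?thesis using yx par_root[OF tree] by blast
      next
        case (step p z')
        then have "p = x" using par_unique[OF tree yx] by simp
        then show ?thesis using step by blast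
      qed
    qed
  qed
  obtain u where u: "\<And>x. tree_phase ?P dl r x (u x)"
    using choice[of "\<lambda>x z. tree_phase ?P dl r x z"] ex by auto
  have mod: "cmod z = 1" if "tree_phase ?P dl r x z" for x z
    using that by induction (auto simp: norm_mult)
  have par_eq: "u x = cis (dl x p) * u p" if "?P x p" for x p
    by (rule uniq[OF u tree_phase.step[OF that u]])
  have "u x = cis (dl x y) * u y" if xy: "adj E x y" for x y
  proof (cases "?P x y")
    case False
    then have "?P y x" using par_total[OF tree xy] by blast
    then have "u y = cis (dl y x) * u x" by (rule par_eq)
    then have "cis (dl x y) * u y = cis (dl x y) * cis (dl y x) * u x" by simp
    also have "\<dots> = u x" by (simp add: cis_mult dl[of x y])
    finally show ?thesis by simp
  qed (rule par_eq)
  then show ?thesis using mod[OF u] that by blast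
qed

section \<open>The degree dominates the off-diagonal terms\<close>

lemma powr_sublinear:
  fixes K e :: real
  assumes e: "0 < e" "e < 1" and d: "0 < d"
  obtains c where "0 \<le> c" "\<And>t. 0 \<le> t \<Longrightarrow> K * t powr (1 - e) \<le> d * t + c"
proof -
  define K' where "K' = max K 1"
  \<comment> \<open>Solves \<open>K' = d * R powr e\<close>; beyond \<open>R\<close> the linear term
    wins, below it the value at \<open>R\<close> is the constant.\<close>
  define R where "R = (K' / d) powr (1 / e)"
  have K': "0 < K'" "K \<le> K'" by (auto simp: K'_def)
  have R0: "0 < R" using K' d by (simp add: R_def)
  show ?thesis
  proof (rule that[of "K' * R powr (1 - e)"])
    show "0 \<le> K' * R powr (1 - e)" using K' by simp
    fix t :: real assume t: "0 \<le> t"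
    have "K * t powr (1 - e) \<le> K' * t powr (1 - e)" using K' by (intro mult_right_mono) auto
    also have "\<dots> \<le> d * t + K' * R powr (1 - e)"
    proof (cases "t \<le> R")
      case True
      have "K' * t powr (1 - e) \<le> K' * R powr (1 - e)"
        using K' True t e by (intro mult_left_mono powr_mono2) auto
      then show ?thesis using d t by (simp add: add_increasing)
    next
      case False
      then have t0: "0 < t" using R0 by simp
      have "K' / d = R powr e" using K' d e by (simp add: R_def powr_powr)
      also have "\<dots> \<le> t powr e" using False R0 e by (intro powr_mono2) auto
      finally have "K' \<le> d * t powr e" using d by (simp add: field_simps)
      then have "K' * t powr (1 - e) \<le> d * t powr e * t powr (1 - e)" by (intro mult_right_mono) auto
      also have "\<dots> = d * t" using t0 by (simp add: mult.assoc flip: powr_add)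
      finally show ?thesis using K' by (simp add: add_increasing2)
    qed
    finally show "K * t powr (1 - e) \<le> d * t + K' * R powr (1 - e)" .
  qed
qed

lemma wdeg_times: "0 < m x \<Longrightarrow> (\<Sum>y\<in>{y. adj E x y}. E x y) = wdeg E m x * (m x)\<^sup>2"
  by (simp add: wdeg_def)

text \<open>In a rooted tree every vertex has one parent, so the off-diagonal terms split into pairs
  \<open>(x, parent x)\<close>. By AM-GM the parent takes an \<open>\<epsilon>\<close>-fraction of its degree, and the large
  factor falls on \<open>E x (parent x)\<close>, which the assumption makes sublinear in the degree of \<open>x\<close>.\<close>

lemma tree_off_diagonal_bound:
  fixes E :: "'v \<Rightarrow> 'v \<Rightarrow> real"
  assumes tree: "weighted_tree E m th" and e0: "0 < e0" "e0 < 1"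
    and C0: "\<And>x y. wdeg E m x powr (e0 - 1) * E x y / (m x)\<^sup>2 \<le> C0" and eps: "0 < eps"
  obtains c where "0 \<le> c"
    "\<And>S (f :: 'v \<Rightarrow> real). finite S \<Longrightarrow> (\<Sum>x\<in>S. \<Sum>y\<in>S. E x y * (\<bar>f x\<bar> * \<bar>f y\<bar>))
        \<le> eps * (\<Sum>x\<in>S. wdeg E m x * (m x)\<^sup>2 * (f x)\<^sup>2) + c * (\<Sum>x\<in>S. (m x)\<^sup>2 * (f x)\<^sup>2)"
proof -
  fix r :: 'v
  let ?P = "par E r"
  have graph: "weighted_graph E m th" using tree by (simp add: weighted_tree_def)
  have m0: "0 < m x" and E_sym: "E x y = E y x" and E0: "0 \<le> E x y" and fin: "finite {y. adj E x y}" for x y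
    using graph unfolding weighted_graph_def by auto
  let ?d = "wdeg E m"
  have d0: "0 \<le> ?d x" for x unfolding wdeg_def by (intro divide_nonneg_nonneg sum_nonneg E0) simp
  have row: "(\<Sum>y\<in>S. E x y) \<le> ?d x * (m x)\<^sup>2" if "finite S" for x S
  proof -
    have "(\<Sum>y\<in>S. E x y) = (\<Sum>y\<in>S \<inter> {y. adj E x y}. E x y)"
      by (rule sum.mono_neutral_right) (use that in \<open>auto simp: adj_def\<close>)
    also have "\<dots> \<le> (\<Sum>y\<in>{y. adj E x y}. E x y)" by (rule sum_mono2) (use fin E0 in auto)
    finally show ?thesis using wdeg_times[of m x E, OF m0] by simp
  qed
  \<comment> \<open>Parent and child each receive \<open>h\<close> times their degree. The child's
    share is multiplied by \<open>1 / h\<close> in AM-GM, so its edge weight must first be bounded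
    with the factor \<open>h^2\<close>.\<close>
  define h where "h = eps / 2"
  have h: "0 < h" and eps2: "eps = 2 * h" using eps by (simp_all add: h_def)
  obtain c1 where c1: "0 \<le> c1" "\<And>t. 0 \<le> t \<Longrightarrow> C0 * t powr (1 - e0) \<le> h\<^sup>2 * t + c1"
    using powr_sublinear[OF e0, of "h\<^sup>2" C0] h by auto
  have Ele: "E x y \<le> (h\<^sup>2 * ?d x + c1) * (m x)\<^sup>2" for x y
  proof (cases "E x y = 0")
    case True
    then show ?thesis using c1 d0 by (simp add: mult_nonneg_nonneg)
  next
    case False
    have "0 < E x y" using False E0[of x y] by simp
    also have "E x y \<le> ?d x * (m x)\<^sup>2" using row[of "{y}" x] by simp
    finally have dp: "0 < ?d x" using m0[of x] by (simp add: zero_less_mult_iff)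
    have "?d x powr (1 - e0) * ?d x powr (e0 - 1) = 1" using dp by (simp flip: powr_add)
    then have "E x y = ?d x powr (1 - e0) * (?d x powr (e0 - 1) * E x y / (m x)\<^sup>2) * (m x)\<^sup>2"
      using m0[of x] by (simp add: mult.assoc[symmetric])
    also have "\<dots> \<le> ?d x powr (1 - e0) * C0 * (m x)\<^sup>2"
      by (intro mult_right_mono mult_left_mono C0) auto
    also have "\<dots> \<le> (h\<^sup>2 * ?d x + c1) * (m x)\<^sup>2"
      using c1(2)[OF d0, of x] by (intro mult_right_mono) (auto simp: mult.commute)
    finally show ?thesis .
  qed
  \<comment> \<open>Each edge weight is kept only in the direction from the child \<open>x\<close>
    to the parent \<open>y\<close>, so a row of \<open>e1\<close> has at most one nonzero
    entry.\<close>
  define e1 where "e1 x y = (if ?P x y then E x y else 0)" for x y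
  have e1: "0 \<le> e1 x y" "e1 x y \<le> E x y" for x y using E0 by (auto simp: e1_def)
  have E_split: "E x y = e1 x y + e1 y x" for x y
  proof (cases "E x y = 0")
    case True then show ?thesis using E_sym[of x y] by (simp add: e1_def)
  next
    case False
    then have "adj E x y" by (simp add: adj_def)
    then show ?thesis
      using par_total[OF tree, of x y r] par_asym[OF tree, of r x y] E_sym[of x y] by (auto simp: e1_def)
  qed
  have up: "(\<Sum>y\<in>S. e1 x y) \<le> (h\<^sup>2 * ?d x + c1) * (m x)\<^sup>2" if S: "finite S" for S x
  proof (cases "\<exists>p. ?P x p")
    case True
    then obtain p where p: "?P x p" by blast
    have "e1 x y = (if y = p then E x p else 0)" for y
      unfolding e1_def using par_unique[OF tree p] p by metis
    then have "(\<Sum>y\<in>S. e1 x y) \<le> E x p" using S E0 by (simp add: sum.delta)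
    then show ?thesis using Ele[of x p] by linarith
  next
    case False
    then have "(\<Sum>y\<in>S. e1 x y) = 0" by (simp add: e1_def)
    then show ?thesis using c1 d0 by (simp add: mult_nonneg_nonneg)
  qed
  show ?thesis
  proof (rule that[of "c1 / h"])
    show "0 \<le> c1 / h" using c1 h by simp
    fix S :: "'v set" and f :: "'v \<Rightarrow> real" assume S: "finite S"
    let ?A = "\<Sum>x\<in>S. \<Sum>y\<in>S. e1 x y * (\<bar>f x\<bar> * \<bar>f y\<bar>)"
    have "(\<Sum>x\<in>S. \<Sum>y\<in>S. E x y * (\<bar>f x\<bar> * \<bar>f y\<bar>))
        = (\<Sum>x\<in>S. \<Sum>y\<in>S. e1 x y * (\<bar>f x\<bar> * \<bar>f y\<bar>) + e1 y x * (\<bar>f y\<bar> * \<bar>f x\<bar>))"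
      by (intro sum.cong refl) (subst E_split, simp add: algebra_simps)
    also have "\<dots> = ?A + (\<Sum>x\<in>S. \<Sum>y\<in>S. e1 y x * (\<bar>f y\<bar> * \<bar>f x\<bar>))" by (simp add: sum.distrib)
    also have "(\<Sum>x\<in>S. \<Sum>y\<in>S. e1 y x * (\<bar>f y\<bar> * \<bar>f x\<bar>)) = ?A" by (rule sum.swap)
    finally have "(\<Sum>x\<in>S. \<Sum>y\<in>S. E x y * (\<bar>f x\<bar> * \<bar>f y\<bar>)) = (\<Sum>x\<in>S. \<Sum>y\<in>S. e1 x y * (2 * \<bar>f x\<bar> * \<bar>f y\<bar>))"
      by (simp add: sum_distrib_left mult_ac)
    also have "\<dots> \<le> (\<Sum>x\<in>S. \<Sum>y\<in>S. e1 x y * ((1 / h) * (f x)\<^sup>2 + h * (f y)\<^sup>2))"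
    proof (intro sum_mono mult_left_mono e1)
      fix x y
      have "0 \<le> (\<bar>f x\<bar> - h * \<bar>f y\<bar>)\<^sup>2 / h" using h by simp
      also have "\<dots> = (1 / h) * (f x)\<^sup>2 + h * (f y)\<^sup>2 - 2 * \<bar>f x\<bar> * \<bar>f y\<bar>"
        using h by (simp add: power2_diff field_simps power2_eq_square)
      finally show "2 * \<bar>f x\<bar> * \<bar>f y\<bar> \<le> (1 / h) * (f x)\<^sup>2 + h * (f y)\<^sup>2" by simp
    qed
    also have "\<dots> = (\<Sum>x\<in>S. (\<Sum>y\<in>S. e1 x y) * ((1 / h) * (f x)\<^sup>2)) + (\<Sum>x\<in>S. \<Sum>y\<in>S. e1 x y * (h * (f y)\<^sup>2))"
      by (simp only: sum.distrib distrib_left sum_distrib_right)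
    also have "(\<Sum>x\<in>S. \<Sum>y\<in>S. e1 x y * (h * (f y)\<^sup>2)) = (\<Sum>y\<in>S. \<Sum>x\<in>S. e1 x y * (h * (f y)\<^sup>2))"
      by (rule sum.swap)
    also have "\<dots> = (\<Sum>y\<in>S. (\<Sum>x\<in>S. e1 x y) * (h * (f y)\<^sup>2))" by (simp add: sum_distrib_right)
    also have "(\<Sum>x\<in>S. (\<Sum>y\<in>S. e1 x y) * ((1 / h) * (f x)\<^sup>2))
        \<le> (\<Sum>x\<in>S. ((h\<^sup>2 * ?d x + c1) * (m x)\<^sup>2) * ((1 / h) * (f x)\<^sup>2))"
      using h by (intro sum_mono mult_right_mono up S) auto
    also have "(\<Sum>y\<in>S. (\<Sum>x\<in>S. e1 x y) * (h * (f y)\<^sup>2)) \<le> (\<Sum>y\<in>S. (?d y * (m y)\<^sup>2) * (h * (f y)\<^sup>2))"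
    proof (intro sum_mono mult_right_mono)
      fix y
      have "(\<Sum>x\<in>S. e1 x y) \<le> (\<Sum>x\<in>S. E y x)" using e1 E_sym by (intro sum_mono) metis
      then show "(\<Sum>x\<in>S. e1 x y) \<le> ?d y * (m y)\<^sup>2" using row[OF S, of y] by linarith
    qed (use h in simp)
    finally have "(\<Sum>x\<in>S. \<Sum>y\<in>S. E x y * (\<bar>f x\<bar> * \<bar>f y\<bar>))
      \<le> (\<Sum>x\<in>S. ((h\<^sup>2 * ?d x + c1) * (m x)\<^sup>2) * ((1 / h) * (f x)\<^sup>2) + (?d x * (m x)\<^sup>2) * (h * (f x)\<^sup>2))"
      by (simp add: sum.distrib)
    also have "\<dots> = (\<Sum>x\<in>S. eps * (?d x * (m x)\<^sup>2 * (f x)\<^sup>2) + (c1 / h) * ((m x)\<^sup>2 * (f x)\<^sup>2))"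
    proof (intro sum.cong refl)
      fix x
      have "((h\<^sup>2 * ?d x + c1) * (m x)\<^sup>2) * ((1 / h) * (f x)\<^sup>2) = h * (?d x * (m x)\<^sup>2 * (f x)\<^sup>2) + (c1 / h) * ((m x)\<^sup>2 * (f x)\<^sup>2)"
        using h by (simp add: field_simps power2_eq_square)
      then show "((h\<^sup>2 * ?d x + c1) * (m x)\<^sup>2) * ((1 / h) * (f x)\<^sup>2) + (?d x * (m x)\<^sup>2) * (h * (f x)\<^sup>2)
        = eps * (?d x * (m x)\<^sup>2 * (f x)\<^sup>2) + (c1 / h) * ((m x)\<^sup>2 * (f x)\<^sup>2)"
        by (simp only: eps2) (simp add: algebra_simps)
    qed
    also have "\<dots> = eps * (\<Sum>x\<in>S. ?d x * (m x)\<^sup>2 * (f x)\<^sup>2) + (c1 / h) * (\<Sum>x\<in>S. (m x)\<^sup>2 * (f x)\<^sup>2)"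
      by (simp add: sum.distrib sum_distrib_left)
    finally show "(\<Sum>x\<in>S. \<Sum>y\<in>S. E x y * (\<bar>f x\<bar> * \<bar>f y\<bar>))
        \<le> eps * (\<Sum>x\<in>S. wdeg E m x * (m x)\<^sup>2 * (f x)\<^sup>2) + (c1 / h) * (\<Sum>x\<in>S. (m x)\<^sup>2 * (f x)\<^sup>2)" .
  qed
qed

section \<open>Weighted spaces and Friedrichs extensions\<close>

text \<open>The unitary map from the weighted to the unweighted space, meaningful on
  \<open>ell2 m\<close> only; \<open>unio m\<close> is its inverse.\<close>

definition iota :: "('v \<Rightarrow> real) \<Rightarrow> ('v \<Rightarrow> complex) \<Rightarrow> 'v l2" where
  "iota m f = Abs_l2 (\<lambda>x. of_real (m x) * f x)"

definition unio :: "('v \<Rightarrow> real) \<Rightarrow> 'v l2 \<Rightarrow> 'v \<Rightarrow> complex" where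
  "unio m F = (\<lambda>x. coord F x / of_real (m x))"

lemma ell2_iff: "f \<in> ell2 m \<longleftrightarrow> (\<lambda>x. (cmod (of_real (m x) * f x))\<^sup>2) summable_on UNIV"
  by (simp add: ell2_def norm_mult power_mult_distrib)

lemma coord_iota: "f \<in> ell2 m \<Longrightarrow> coord (iota m f) x = of_real (m x) * f x"
  unfolding iota_def ell2_iff by (simp add: coord_Abs_l2)

lemma unio_in [simp]: "(\<And>x. 0 < m x) \<Longrightarrow> unio m F \<in> ell2 m"
  unfolding ell2_iff unio_def using coord_summable[of F] by (simp add: less_imp_neq[THEN not_sym])

lemma iota_unio [simp]:
  assumes "\<And>x. 0 < m x"
  shows "iota m (unio m F) = F"
proof (rule l2_eqI)
  fix x
  have "m x \<noteq> 0" using assms[of x] by simp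
  then show "coord (iota m (unio m F)) x = coord F x"
    using coord_iota[OF unio_in[of m F, OF assms], of x] by (simp add: unio_def)
qed

lemma unio_iota: "(\<And>x. 0 < m x) \<Longrightarrow> f \<in> ell2 m \<Longrightarrow> unio m (iota m f) = f"
  unfolding unio_def by (rule ext) (simp add: coord_iota less_imp_neq[THEN not_sym])

lemma iota_inject: "(\<And>x. 0 < m x) \<Longrightarrow> f \<in> ell2 m \<Longrightarrow> g \<in> ell2 m \<Longrightarrow> iota m f = iota m g \<Longrightarrow> f = g"
  by (metis unio_iota)

lemma ell2_diff: "f \<in> ell2 m \<Longrightarrow> g \<in> ell2 m \<Longrightarrow> f - g \<in> ell2 m"
  unfolding ell2_iff using sq_summable_add[of "\<lambda>x. of_real (m x) * f x" "\<lambda>x. of_real (m x) * (- g x)"]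
  by (simp add: algebra_simps)

lemma ell2_smul: "f \<in> ell2 m \<Longrightarrow> smul c f \<in> ell2 m"
  unfolding ell2_iff smul_def using sq_summable_cmult[of "\<lambda>x. of_real (m x) * f x" c]
  by (simp add: mult_ac)

lemma iota_diff: "f \<in> ell2 m \<Longrightarrow> g \<in> ell2 m \<Longrightarrow> iota m (f - g) = iota m f - iota m g"
  by (rule l2_eqI) (simp add: coord_iota ell2_diff algebra_simps)

lemma iota_smul: "f \<in> ell2 m \<Longrightarrow> iota m (smul c f) = cscale c (iota m f)"
  by (rule l2_eqI) (simp add: coord_iota ell2_smul, simp add: smul_def)

lemma Cc_ell2: "f \<in> Cc \<Longrightarrow> f \<in> ell2 m"
  unfolding Cc_def ell2_def by (auto intro!: finite_nonzero_values_imp_summable_on elim: finite_subset[rotated])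

lemma Cc_diff: "f \<in> Cc \<Longrightarrow> g \<in> Cc \<Longrightarrow> f - g \<in> Cc"
  unfolding Cc_def by (auto intro: finite_subset[of _ "{x. f x \<noteq> 0} \<union> {x. g x \<noteq> 0}"])

lemma ell2_ip_eq:
  assumes "f \<in> ell2 m" "g \<in> ell2 m"
  shows "ell2_ip m f g = cip (iota m f) (iota m g)"
  unfolding ell2_ip_def cip_eq
  by (rule infsum_cong) (simp add: coord_iota assms power2_eq_square)

lemma ell2_norm_eq:
  assumes "f \<in> ell2 m"
  shows "ell2_norm m f = norm (iota m f)"
proof -
  have "(norm (iota m f))\<^sup>2 = (\<Sum>\<^sub>\<infinity>x. (m x)\<^sup>2 * (cmod (f x))\<^sup>2)"
    unfolding norm_l2_sq by (rule infsum_cong) (simp add: coord_iota assms norm_mult power_mult_distrib)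
  then show ?thesis unfolding ell2_norm_def by (metis norm_ge_zero real_sqrt_abs abs_of_nonneg)
qed

subsection \<open>Multiplication operators\<close>

definition dmul :: "('v \<Rightarrow> real) \<Rightarrow> 'v l2 \<Rightarrow> 'v l2" where
  "dmul a = kop (\<lambda>x y. if x = y then of_real (a x) else 0)"

context
  fixes a :: "'v \<Rightarrow> real"
  assumes a: "\<And>x. 0 \<le> a x" "\<And>x. a x \<le> 1"
begin

interpretation schur_kernel "\<lambda>x y. if x = y then of_real (a x) else 0" "\<lambda>x y. if x = y then a x else 0"
  "\<lambda>_. 1" a 1
proof
  fix x
  have fin: "{y. (if x = y then a x else 0) \<noteq> 0} \<subseteq> {x}" by auto
  show "finite {y. (if x = y then a x else 0) \<noteq> 0}" by (rule finite_subset[OF fin]) simp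
  have "(\<Sum>y\<in>{y. (if x = y then a x else 0) \<noteq> 0}. if x = y then a x else 0) = (\<Sum>y\<in>{x}. if x = y then a x else 0)"
    by (rule sum.mono_neutral_left) (use fin in auto)
  then show "(\<Sum>y\<in>{y. (if x = y then a x else 0) \<noteq> 0}. if x = y then a x else 0) \<le> a x * 1\<^sup>2" by simp
qed (use a in auto)

lemma coord_dmul: "coord (dmul a f) x = of_real (a x) * coord f x"
proof -
  have "coord (dmul a f) x = (\<Sum>y\<in>{x}. (if x = y then of_real (a x) else 0) * coord f y)"
    unfolding dmul_def coord_kop by (rule sum.mono_neutral_left) (auto split: if_splits)
  then show ?thesis by simp
qed

lemma bsym_dmul: "bsym (dmul a)"
  unfolding dmul_def by (rule bsym_kop) auto

lemma clinear_dmul: "clinear_op (dmul a)"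
  unfolding dmul_def clinear_op_def by (simp add: kop_cscale)

lemma cip_dmul: "cip (dmul a f) g = cip f (dmul a g)"
  unfolding dmul_def by (rule cip_kop_hermitian) auto

lemma ccont_dmul: "(a \<longlongrightarrow> 0) cofinite \<Longrightarrow> ccont (dmul a)"
  unfolding dmul_def by (rule ccont_kop)

end

subsection \<open>Operators given by a resolvent\<close>

text \<open>Encodes \<open>T = (A + C)^-1\<close> without inverting \<open>T\<close>:
  \<open>A f = g\<close> becomes \<open>f = T (g + C f)\<close>.\<close>

definition opT :: "('v \<Rightarrow> real) \<Rightarrow> ('v l2 \<Rightarrow> 'v l2) \<Rightarrow> real \<Rightarrow> ('v \<Rightarrow> complex) \<Rightarrow> ('v \<Rightarrow> complex) \<Rightarrow> bool" where
  "opT m T C f g \<longleftrightarrow> f \<in> ell2 m \<and> g \<in> ell2 m \<and> iota m f = T (iota m g + C *\<^sub>R iota m f)"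

subsection \<open>The form of a magnetic Schroedinger operator\<close>

text \<open>The form domain is the weighted space with weight \<open>w\<close>; transported to unweighted \<open>l2\<close> by
  \<open>iota w\<close>, the form becomes the bounded operator \<open>A\<close>, and the norm of \<open>ell2 m\<close> becomes that of \<open>P\<close>.\<close>

locale graph_form =
  fixes E :: "'v::countable \<Rightarrow> 'v \<Rightarrow> real" and m :: "'v \<Rightarrow> real" and th :: "'v \<Rightarrow> 'v \<Rightarrow> real"
    and V d :: "'v \<Rightarrow> real" and K :: real
  assumes graph: "weighted_graph E m th" and d0: "\<And>x. 0 \<le> d x"
    and K: "\<And>x. 2 * wdeg E m x + \<bar>V x\<bar> \<le> K * (1 + d x)"
begin

definition w :: "'v \<Rightarrow> real" where "w x = m x * sqrt (1 + d x)"

definition ke :: "'v \<Rightarrow> 'v \<Rightarrow> complex" where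
  "ke x y = ((if x = y then of_real ((wdeg E m x + V x) * (m x)\<^sup>2) else 0) - of_real (E x y) * cis (th x y))
     / of_real (w x * w y)"

definition A :: "'v l2 \<Rightarrow> 'v l2" where "A = kop ke"

definition P :: "'v l2 \<Rightarrow> 'v l2" where "P = dmul (\<lambda>x. 1 / sqrt (1 + d x))"

lemma m0: "0 < m x" and E_sym: "E x y = E y x" and E0: "0 \<le> E x y" and E_diag: "E x x = 0"
  and fin: "finite {y. adj E x y}" and th_anti: "th x y = - th y x"
  using graph unfolding weighted_graph_def by blast+

lemma d1: "0 < 1 + d x" using d0[of x] by simp
lemma w0: "0 < w x" unfolding w_def using m0 d1 by simp
lemma wsq: "(w x)\<^sup>2 = (m x)\<^sup>2 * (1 + d x)" unfolding w_def using d1[of x] by (simp add: power_mult_distrib)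
lemma m_le_w: "m x \<le> w x" unfolding w_def using m0[of x] d0[of x] by (simp add: mult_le_cancel_left1)
lemma wdeg0: "0 \<le> wdeg E m x" unfolding wdeg_def by (intro divide_nonneg_nonneg sum_nonneg E0) simp

text \<open>Each row contains the degree twice, on the diagonal and as the row sum of
  \<open>E\<close>; this is the origin of the factor 2 in the hypothesis on
  \<open>K\<close>.\<close>

sublocale A: schur_kernel ke "\<lambda>x y. (if x = y then \<bar>wdeg E m x + V x\<bar> * (m x)\<^sup>2 else 0) + E x y" w "\<lambda>_. K" K
proof
  fix x y
  show "0 < w x" by (rule w0)
  show "(if x = y then \<bar>wdeg E m x + V x\<bar> * (m x)\<^sup>2 else 0) + E x y = (if y = x then \<bar>wdeg E m y + V y\<bar> * (m y)\<^sup>2 else 0) + E y x"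
    using E_sym[of x y] by auto
  show "0 \<le> (if x = y then \<bar>wdeg E m x + V x\<bar> * (m x)\<^sup>2 else 0) + E x y" using E0[of x y] by simp
  let ?e = "\<lambda>y. (if x = y then \<bar>wdeg E m x + V x\<bar> * (m x)\<^sup>2 else 0) + E x y"
  have sub: "{y. ?e y \<noteq> 0} \<subseteq> insert x {y. adj E x y}" by (auto simp: adj_def)
  show "finite {y. ?e y \<noteq> 0}" by (rule finite_subset[OF sub]) (simp add: fin)
  have "(\<Sum>y\<in>{y. ?e y \<noteq> 0}. ?e y) = (\<Sum>y\<in>insert x {y. adj E x y}. ?e y)"
    by (rule sum.mono_neutral_left) (use sub fin in auto)
  also have "\<dots> = \<bar>wdeg E m x + V x\<bar> * (m x)\<^sup>2 + (\<Sum>y\<in>{y. adj E x y}. E x y)"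
  proof -
    have x: "x \<notin> {y. adj E x y}" using E_diag by (simp add: adj_def)
    have "(\<Sum>y\<in>{y. adj E x y}. ?e y) = (\<Sum>y\<in>{y. adj E x y}. E x y)"
      using E_diag by (intro sum.cong refl) (auto simp: adj_def)
    then show ?thesis using sum.insert[OF fin[of x] x, of ?e] E_diag by simp
  qed
  also have "\<dots> = (\<bar>wdeg E m x + V x\<bar> + wdeg E m x) * (m x)\<^sup>2"
    using wdeg_times[of m x E, OF m0] by (simp add: algebra_simps)
  also have "\<dots> \<le> (K * (1 + d x)) * (m x)\<^sup>2"
    using K[of x] wdeg0[of x] by (intro mult_right_mono) auto
  finally show "(\<Sum>y\<in>{y. ?e y \<noteq> 0}. ?e y) \<le> K * (w x)\<^sup>2" by (simp add: wsq mult_ac)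
  have "cmod ((if x = y then of_real ((wdeg E m x + V x) * (m x)\<^sup>2) else 0) - of_real (E x y) * cis (th x y))
      \<le> cmod (if x = y then of_real ((wdeg E m x + V x) * (m x)\<^sup>2) else 0) + cmod (of_real (E x y) * cis (th x y))"
    by (rule norm_triangle_ineq4)
  also have "\<dots> = ?e y" using E0[of x y] by (simp add: norm_mult abs_mult del: of_real_mult of_real_add)
  finally show "cmod (ke x y) \<le> ?e y / (w x * w y)"
    unfolding ke_def norm_divide using w0[of x] w0[of y] by (simp add: divide_right_mono del: of_real_mult)
qed simp

lemma ke_herm: "ke y x = cnj (ke x y)"
  unfolding ke_def using E_sym[of x y] th_anti[of x y] by (auto simp: cis_cnj mult.commute)

lemma bsym_A: "bsym A" unfolding A_def by (rule A.bsym_kop[OF ke_herm])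

lemma clinear_A: "clinear_op A" unfolding A_def clinear_op_def by (simp add: A.kop_cscale)

sublocale A': bounded_linear A using bsym_A by (rule bsym_bounded_linear)

lemma P_weight: "0 \<le> 1 / sqrt (1 + d x)" "1 / sqrt (1 + d x) \<le> 1"
  using d0[of x] by auto

lemma coord_P: "coord (P F) x = coord F x / of_real (sqrt (1 + d x))"
  unfolding P_def by (simp add: coord_dmul[OF P_weight])

lemma bsym_P: "bsym P" unfolding P_def by (rule bsym_dmul[OF P_weight])
lemma clinear_P: "clinear_op P" unfolding P_def by (rule clinear_dmul[OF P_weight])
lemma cip_P: "cip (P f) g = cip f (P g)" unfolding P_def by (rule cip_dmul[OF P_weight])
sublocale P': bounded_linear P using bsym_P by (rule bsym_bounded_linear)

lemma ell2_w_subset: "f \<in> ell2 w \<Longrightarrow> f \<in> ell2 m"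
  unfolding ell2_def mem_Collect_eq
  by (erule summable_on_comparison_test)
    (auto intro!: mult_right_mono power_mono m_le_w less_imp_le[OF m0])

lemma P_iota: "f \<in> ell2 w \<Longrightarrow> P (iota w f) = iota m f"
  using d1 by (intro l2_eqI) (simp add: coord_P coord_iota ell2_w_subset w_def less_imp_neq[THEN not_sym])

lemma A_iota:
  assumes f: "f \<in> ell2 w"
  shows "of_real (w x) * coord (A (iota w f)) x = of_real ((m x)\<^sup>2) * (mlap E m th f x + of_real (V x) * f x)"
proof -
  have wn: "w y \<noteq> 0" and mn: "m y \<noteq> 0" for y using w0[of y] m0[of y] by auto
  have sub: "{y. ke x y \<noteq> 0} \<subseteq> insert x {y. adj E x y}" by (auto simp: ke_def adj_def)
  have x: "x \<notin> {y. adj E x y}" using E_diag by (simp add: adj_def)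
  have "coord (A (iota w f)) x = (\<Sum>y\<in>insert x {y. adj E x y}. ke x y * (of_real (w y) * f y))"
    unfolding A_def A.coord_kop coord_iota[OF f]
    by (rule sum.mono_neutral_left) (use sub fin in auto)
  also have "\<dots> = ke x x * (of_real (w x) * f x) + (\<Sum>y\<in>{y. adj E x y}. ke x y * (of_real (w y) * f y))"
    using x fin by simp
  finally have "of_real (w x) * coord (A (iota w f)) x
    = of_real (w x) * (ke x x * (of_real (w x) * f x)) + (\<Sum>y\<in>{y. adj E x y}. of_real (w x) * (ke x y * (of_real (w y) * f y)))"
    by (simp add: distrib_left sum_distrib_left)
  also have "of_real (w x) * (ke x x * (of_real (w x) * f x)) = of_real ((wdeg E m x + V x) * (m x)\<^sup>2) * f x"
    using wn[of x] by (simp add: ke_def E_diag field_simps del: of_real_add)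
  also have "(\<Sum>y\<in>{y. adj E x y}. of_real (w x) * (ke x y * (of_real (w y) * f y)))
      = (\<Sum>y\<in>{y. adj E x y}. - (of_real (E x y) * cis (th x y) * f y))"
    using x wn by (intro sum.cong refl) (auto simp: ke_def)
  also have "of_real ((wdeg E m x + V x) * (m x)\<^sup>2) * f x + (\<Sum>y\<in>{y. adj E x y}. - (of_real (E x y) * cis (th x y) * f y))
     = (\<Sum>y\<in>{y. adj E x y}. of_real (E x y) * (f x - cis (th x y) * f y)) + of_real ((m x)\<^sup>2) * of_real (V x) * f x"
  proof -
    have "(\<Sum>y\<in>{y. adj E x y}. of_real (E x y) * (f x - cis (th x y) * f y))
      = of_real (wdeg E m x * (m x)\<^sup>2) * f x + (\<Sum>y\<in>{y. adj E x y}. - (of_real (E x y) * cis (th x y) * f y))"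
      unfolding wdeg_times[of m x E, OF m0, symmetric]
      by (simp add: right_diff_distrib sum_subtractf sum_distrib_right sum_negf mult.assoc)
    then show ?thesis by (simp add: algebra_simps)
  qed
  also have "\<dots> = of_real ((m x)\<^sup>2) * (mlap E m th f x + of_real (V x) * f x)"
    unfolding mlap_def using mn[of x] by (simp add: distrib_left mult.assoc)
  finally show ?thesis .
qed

abbreviation s :: "('v \<Rightarrow> complex) \<Rightarrow> ('v \<Rightarrow> complex) \<Rightarrow> complex" where "s \<equiv> schr_form E m th V"

lemma s_eq:
  assumes f: "f \<in> Cc" and g: "g \<in> Cc"
  shows "s f g = cip (iota w f) (A (iota w g))"
proof -
  have fw: "f \<in> ell2 w" "g \<in> ell2 w" using f g by (auto intro: Cc_ell2)
  show ?thesis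
    unfolding schr_form_def ell2_ip_def cip_eq
  proof (rule infsum_cong)
    fix x
    show "of_real ((m x)\<^sup>2) * (cnj (f x) * (mlap E m th g x + of_real (V x) * g x))
       = cnj (coord (iota w f) x) * coord (A (iota w g)) x"
      using A_iota[OF fw(2), of x] by (simp add: coord_iota[OF fw(1)] mult_ac)
  qed
qed

lemma iota_w_dense:
  obtains u where "\<And>n. u n \<in> Cc" "(\<lambda>n. iota w (u n)) \<longlonglongrightarrow> F"
proof -
  obtain v where v: "\<And>n. finite {x. coord (v n) x \<noteq> 0}" "v \<longlonglongrightarrow> F" by (rule finite_support_dense[of F]) blast
  show ?thesis
  proof (rule that[of "\<lambda>n. unio w (v n)"])
    fix n show "unio w (v n) \<in> Cc"
      unfolding Cc_def unio_def using v(1)[of n] by (auto elim: finite_subset[rotated])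
  next
    show "(\<lambda>n. iota w (unio w (v n))) \<longlonglongrightarrow> F" using v(2) by (simp add: w0)
  qed
qed

lemma cip_ext: "(\<And>H. cip H X = cip H Y) \<Longrightarrow> X = Y"
  by (rule l2_eqI) (metis cip_basis)

end

locale coercive_form = graph_form +
  fixes C c :: real
  assumes c: "0 < c" and coer: "\<And>F. c * (norm F)\<^sup>2 \<le> inner (A F) F + C * (norm (P F))\<^sup>2"
begin

definition B :: "'a l2 \<Rightarrow> 'a l2" where "B F = A F + C *\<^sub>R P (P F)"

lemma inner_B: "inner (B F) F = inner (A F) F + C * (norm (P F))\<^sup>2"
  unfolding B_def using bsymD[OF bsym_P, of "P F" F] by (simp add: inner_add_left power2_norm_eq_inner)

sublocale p: pencil P B c
proof
  show "bsym B"
    unfolding bsym_def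
  proof (intro conjI allI)
    show "bounded_linear B"
      unfolding B_def
      by (intro bounded_linear_add A'.bounded_linear_axioms bounded_linear_compose[OF bounded_linear_scaleR_right]
          bounded_linear_compose[OF P'.bounded_linear_axioms] P'.bounded_linear_axioms)
    fix x y
    show "inner (B x) y = inner x (B y)"
      unfolding B_def by (simp add: inner_add_left inner_add_right bsymD[OF bsym_A] bsymD[OF bsym_P])
  qed
  show "clinear_op B"
    using clinear_A clinear_P unfolding clinear_op_def B_def
    by (auto intro!: l2_eqI simp: algebra_simps)
  show "c * (norm x)\<^sup>2 \<le> inner (B x) x" for x unfolding inner_B by (rule coer)
qed (rule bsym_P clinear_P c)+

text \<open>By coercivity the form together with the norm of \<open>ell2 m\<close> controls the norm
  of \<open>ell2 w\<close>, and boundedness of \<open>A\<close> gives the converse. The limits agree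
  because \<open>P\<close> turns one embedding into the other.\<close>

lemma form_approx_iff:
  "form_approx m s u f \<longleftrightarrow> (\<forall>n. u n \<in> Cc) \<and> f \<in> ell2 w \<and> (\<lambda>n. iota w (u n)) \<longlonglongrightarrow> iota w f"
proof
  assume L: "form_approx m s u f"
  then have u: "\<And>n. u n \<in> Cc" and f: "f \<in> ell2 m" and lim: "(\<lambda>n. ell2_norm m (u n - f)) \<longlonglongrightarrow> 0"
    and cau: "\<And>e. e > 0 \<Longrightarrow> \<exists>N. \<forall>n\<ge>N. \<forall>k\<ge>N. cmod (s (u n - u k) (u n - u k)) < e"
    unfolding form_approx_def by blast+
  have uw: "u n \<in> ell2 w" and um: "u n \<in> ell2 m" for n using u by (auto intro: Cc_ell2)
  have "(\<lambda>n. norm (iota m (u n) - iota m f)) \<longlonglongrightarrow> 0"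
    using lim um f by (simp add: ell2_norm_eq ell2_diff iota_diff)
  then have limm: "(\<lambda>n. iota m (u n)) \<longlonglongrightarrow> iota m f"
    by (rule LIM_zero_cancel[OF tendsto_norm_zero_cancel])
  then have cauP: "Cauchy (\<lambda>n. iota m (u n))" by (rule LIMSEQ_imp_Cauchy)
  have "Cauchy (\<lambda>n. iota w (u n))"
  proof (rule metric_CauchyI)
    fix e :: real assume e: "0 < e"
    \<comment> \<open>The form and the shift term each receive half of \<open>c * e^2\<close>, the
      bound that coercivity turns into \<open>norm < e\<close>.\<close>
    define e1 where "e1 = c * e\<^sup>2 / 2"
    have e1: "0 < e1" using c e by (simp add: e1_def)
    obtain N1 where N1: "\<forall>n\<ge>N1. \<forall>k\<ge>N1. cmod (s (u n - u k) (u n - u k)) < e1" using cau[OF e1] by blast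
    define e2 where "e2 = sqrt (e1 / (\<bar>C\<bar> + 1))"
    have e2: "0 < e2" "\<bar>C\<bar> * e2\<^sup>2 \<le> e1"
      using e1 by (auto simp: e2_def field_simps add_nonneg_pos)
    obtain N2 where N2: "\<forall>n\<ge>N2. \<forall>k\<ge>N2. dist (iota m (u n)) (iota m (u k)) < e2"
      using metric_CauchyD[OF cauP e2(1)] by blast
    have "dist (iota w (u n)) (iota w (u k)) < e" if n: "n \<ge> max N1 N2" and k: "k \<ge> max N1 N2" for n k
    proof -
      let ?F = "iota w (u n) - iota w (u k)"
      have F: "?F = iota w (u n - u k)" using uw by (simp add: iota_diff)
      have "s (u n - u k) (u n - u k) = cip ?F (A ?F)" unfolding F by (intro s_eq Cc_diff u)
      then have "inner (A ?F) ?F \<le> cmod (s (u n - u k) (u n - u k))"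
        using complex_Re_le_cmod[of "cip ?F (A ?F)"] by (simp add: Re_cip inner_commute)
      also have "\<dots> < e1" using N1 n k by auto
      finally have 1: "inner (A ?F) ?F < e1" .
      have "P ?F = iota m (u n) - iota m (u k)" using uw by (simp add: P'.diff P_iota)
      then have "norm (P ?F) < e2" using N2 n k by (simp add: dist_norm)
      then have "(norm (P ?F))\<^sup>2 \<le> e2\<^sup>2" by (intro power_mono) auto
      then have "C * (norm (P ?F))\<^sup>2 \<le> \<bar>C\<bar> * e2\<^sup>2" by (intro mult_mono) auto
      then have "c * (norm ?F)\<^sup>2 < e1 + e1" using coer[of ?F] 1 e2(2) by linarith
      also have "\<dots> = c * e\<^sup>2" by (simp add: e1_def)
      finally have "(norm ?F)\<^sup>2 < e\<^sup>2" using c by simp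
      then have "norm ?F < e" by (rule power2_less_imp_less) (use e in simp)
      then show ?thesis by (simp add: dist_norm)
    qed
    then show "\<exists>N. \<forall>n\<ge>N. \<forall>k\<ge>N. dist (iota w (u n)) (iota w (u k)) < e" by blast
  qed
  then obtain G where G: "(\<lambda>n. iota w (u n)) \<longlonglongrightarrow> G" by (metis Cauchy_convergent_iff convergent_def)
  have "(\<lambda>n. P (iota w (u n))) \<longlonglongrightarrow> P G" by (rule P'.tendsto[OF G])
  then have "(\<lambda>n. iota m (u n)) \<longlonglongrightarrow> P G" using uw by (simp add: P_iota)
  then have "iota m f = P G" using limm LIMSEQ_unique by blast
  then have "iota m f = iota m (unio w G)" by (metis P_iota iota_unio unio_in w0)
  then have "f = unio w G" by (intro iota_inject[OF m0 f ell2_w_subset]) (auto simp: w0)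
  then show "(\<forall>n. u n \<in> Cc) \<and> f \<in> ell2 w \<and> (\<lambda>n. iota w (u n)) \<longlonglongrightarrow> iota w f"
    using u G by (simp add: w0)
next
  assume R: "(\<forall>n. u n \<in> Cc) \<and> f \<in> ell2 w \<and> (\<lambda>n. iota w (u n)) \<longlonglongrightarrow> iota w f"
  then have u: "\<And>n. u n \<in> Cc" and f: "f \<in> ell2 w" and lim: "(\<lambda>n. iota w (u n)) \<longlonglongrightarrow> iota w f" by auto
  have uw: "u n \<in> ell2 w" and um: "u n \<in> ell2 m" for n using u by (auto intro: Cc_ell2)
  have fm: "f \<in> ell2 m" by (rule ell2_w_subset[OF f])
  have "(\<lambda>n. norm (P (iota w (u n)) - P (iota w f))) \<longlonglongrightarrow> 0"
    by (rule tendsto_norm_zero[OF LIM_zero[OF P'.tendsto[OF lim]]])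
  then have 1: "(\<lambda>n. ell2_norm m (u n - f)) \<longlonglongrightarrow> 0"
    using um fm uw f by (simp add: P_iota ell2_norm_eq ell2_diff iota_diff)
  obtain M where M: "0 < M" "\<And>x. norm (A x) \<le> M * norm x" using bsym_bound[OF bsym_A] by blast
  have 2: "\<exists>N. \<forall>n\<ge>N. \<forall>k\<ge>N. cmod (s (u n - u k) (u n - u k)) < e" if e: "e > 0" for e
  proof -
    define e1 where "e1 = sqrt (e / M)"
    have e1: "0 < e1" "M * e1\<^sup>2 = e" using e M(1) by (auto simp: e1_def)
    obtain N where N: "\<forall>n\<ge>N. \<forall>k\<ge>N. dist (iota w (u n)) (iota w (u k)) < e1"
      using metric_CauchyD[OF LIMSEQ_imp_Cauchy[OF lim] e1(1)] by blast
    have "cmod (s (u n - u k) (u n - u k)) < e" if nk: "n \<ge> N" "k \<ge> N" for n k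
    proof -
      let ?F = "iota w (u n) - iota w (u k)"
      have F: "?F = iota w (u n - u k)" using uw by (simp add: iota_diff)
      have "s (u n - u k) (u n - u k) = cip ?F (A ?F)" unfolding F by (intro s_eq Cc_diff u)
      then have "cmod (s (u n - u k) (u n - u k)) \<le> norm ?F * norm (A ?F)" using norm_cip_le by simp
      also have "\<dots> \<le> norm ?F * (M * norm ?F)" by (intro mult_left_mono M(2)) auto
      also have "\<dots> = M * (norm ?F)\<^sup>2" by (simp add: power2_eq_square)
      also have "\<dots> < M * e1\<^sup>2"
        using N nk M(1) by (intro mult_strict_left_mono power_strict_mono) (auto simp: dist_norm)
      finally show ?thesis by (simp add: e1(2))
    qed
    then show ?thesis by blast
  qed
  show "form_approx m s u f" unfolding form_approx_def using u fm 1 2 by blast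
qed

lemma form_dom_eq: "form_dom m s = ell2 w"
proof -
  have "f \<in> form_dom m s" if f: "f \<in> ell2 w" for f
  proof -
    obtain u where "\<And>n. u n \<in> Cc" "(\<lambda>n. iota w (u n)) \<longlonglongrightarrow> iota w f"
      by (rule iota_w_dense[of "iota w f"]) blast
    then show ?thesis unfolding form_dom_def form_approx_iff using f by blast
  qed
  then show ?thesis unfolding form_dom_def form_approx_iff by blast
qed

lemma form_closure_val_iff:
  "form_closure_val m s h f z \<longleftrightarrow> h \<in> ell2 w \<and> f \<in> ell2 w \<and> z = cip (iota w h) (A (iota w f))"
proof
  assume "form_closure_val m s h f z"
  then obtain u v where uv: "form_approx m s u h" "form_approx m s v f" "(\<lambda>n. s (u n) (v n)) \<longlonglongrightarrow> z"
    unfolding form_closure_val_def by blast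
  then have u: "\<And>n. u n \<in> Cc" "h \<in> ell2 w" "(\<lambda>n. iota w (u n)) \<longlonglongrightarrow> iota w h"
    and v: "\<And>n. v n \<in> Cc" "f \<in> ell2 w" "(\<lambda>n. iota w (v n)) \<longlonglongrightarrow> iota w f"
    unfolding form_approx_iff by auto
  have "(\<lambda>n. cip (iota w (u n)) (A (iota w (v n)))) \<longlonglongrightarrow> cip (iota w h) (A (iota w f))"
    by (intro tendsto_cip u A'.tendsto v)
  then have "(\<lambda>n. s (u n) (v n)) \<longlonglongrightarrow> cip (iota w h) (A (iota w f))" using u v by (simp add: s_eq)
  then show "h \<in> ell2 w \<and> f \<in> ell2 w \<and> z = cip (iota w h) (A (iota w f))"
    using u v uv(3) LIMSEQ_unique by blast
next
  assume R: "h \<in> ell2 w \<and> f \<in> ell2 w \<and> z = cip (iota w h) (A (iota w f))"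
  obtain u where u: "\<And>n. u n \<in> Cc" "(\<lambda>n. iota w (u n)) \<longlonglongrightarrow> iota w h" 
    by (rule iota_w_dense[of "iota w h"]) blast
  obtain v where v: "\<And>n. v n \<in> Cc" "(\<lambda>n. iota w (v n)) \<longlonglongrightarrow> iota w f"
    by (rule iota_w_dense[of "iota w f"]) blast
  have "(\<lambda>n. cip (iota w (u n)) (A (iota w (v n)))) \<longlonglongrightarrow> cip (iota w h) (A (iota w f))"
    by (intro tendsto_cip u A'.tendsto v)
  then have "(\<lambda>n. s (u n) (v n)) \<longlonglongrightarrow> z" using u v R by (simp add: s_eq)
  then show "form_closure_val m s h f z"
    unfolding form_closure_val_def form_approx_iff using u v R by blast
qed

text \<open>Both sides of the weak equation are products with \<open>iota w h\<close>, where
  \<open>h\<close> runs through the whole form domain, so the equation holds between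
  vectors.\<close>

lemma friedrichs_iff:
  "friedrichs m s f g \<longleftrightarrow> f \<in> ell2 w \<and> g \<in> ell2 m \<and> A (iota w f) = P (iota m g)"
proof -
  have "(\<forall>h z. h \<in> ell2 w \<longrightarrow> h \<in> ell2 w \<and> f \<in> ell2 w \<and> z = cip (iota w h) (A (iota w f)) \<longrightarrow> z = ell2_ip m h g)
      \<longleftrightarrow> A (iota w f) = P (iota m g)" if f: "f \<in> ell2 w" and g: "g \<in> ell2 m"
  proof -
    have ip: "ell2_ip m h g = cip (iota w h) (P (iota m g))" if "h \<in> ell2 w" for h
      using that g by (simp add: ell2_ip_eq ell2_w_subset cip_P[symmetric] P_iota)
    have "A (iota w f) = P (iota m g)"
      if H: "\<forall>h. h \<in> ell2 w \<longrightarrow> cip (iota w h) (A (iota w f)) = cip (iota w h) (P (iota m g))"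
    proof (rule cip_ext)
      fix G show "cip G (A (iota w f)) = cip G (P (iota m g))"
        using H[rule_format, of "unio w G"] by (simp add: w0)
    qed
    then show ?thesis using f ip by auto
  qed
  then show ?thesis unfolding friedrichs_def form_dom_eq form_closure_val_iff by blast
qed

text \<open>Adding \<open>C P (P F)\<close> to \<open>A F = P g\<close> with \<open>f = P F\<close>
  gives \<open>B F = P (g + C f)\<close>, which can be solved for \<open>F\<close>.\<close>

lemma friedrichs_eq_opT: "friedrichs m s = opT m (pres P B) C"
proof (intro ext iffI)
  fix f g assume "friedrichs m s f g"
  then have f: "f \<in> ell2 w" and g: "g \<in> ell2 m" and eq: "A (iota w f) = P (iota m g)"
    unfolding friedrichs_iff by auto
  have "B (iota w f) = P (iota m g + C *\<^sub>R iota m f)"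
    unfolding B_def eq P_iota[OF f] by (simp add: P'.add P'.scaleR)
  then have "iota w f = inv B (P (iota m g + C *\<^sub>R iota m f))" by (metis p.inv_B)
  then have "iota m f = pres P B (iota m g + C *\<^sub>R iota m f)"
    unfolding pres_def using P_iota[OF f] by simp
  then show "opT m (pres P B) C f g" unfolding opT_def using f g ell2_w_subset by blast
next
  fix f g assume "opT m (pres P B) C f g"
  then have f: "f \<in> ell2 m" and g: "g \<in> ell2 m" and eq: "iota m f = pres P B (iota m g + C *\<^sub>R iota m f)"
    unfolding opT_def by auto
  define G where "G = inv B (P (iota m g + C *\<^sub>R iota m f))"
  have PG: "iota m f = P G" using eq unfolding pres_def G_def .
  then have "iota m f = iota m (unio w G)" by (metis P_iota iota_unio unio_in w0)
  then have fG: "f = unio w G" by (intro iota_inject[OF m0 f ell2_w_subset]) (auto simp: w0)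
  have "B G = P (iota m g) + C *\<^sub>R P (P G)" unfolding G_def using PG[unfolded G_def] by (simp add: P'.add P'.scaleR)
  then have "A G = P (iota m g)" unfolding B_def by simp
  then show "friedrichs m s f g" unfolding friedrichs_iff using g by (simp add: fG w0)
qed

text \<open>Local finiteness keeps the Laplacian of a finitely supported function finitely
  supported, so such functions lie in the operator domain and not merely in the form domain.\<close>

lemma friedrichs_Cc:
  assumes f: "f \<in> Cc"
  shows "\<exists>g. friedrichs m s f g \<and> ell2_ip m f g = s f f"
proof -
  define g where "g = (\<lambda>x. mlap E m th f x + of_real (V x) * f x)"
  have "{x. g x \<noteq> 0} \<subseteq> {x. f x \<noteq> 0} \<union> (\<Union>y\<in>{x. f x \<noteq> 0}. {x. adj E y x})"
  proof clarify
    fix x assume gx: "g x \<noteq> 0" and fx: "f x = 0" and n: "x \<notin> (\<Union>y\<in>{x. f x \<noteq> 0}. {x. adj E y x})"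
    have "f y = 0" if "adj E x y" for y
      using n that E_sym[of x y] by (auto simp: adj_def)
    then have "mlap E m th f x = 0" by (simp add: mlap_def fx)
    then show False using gx fx by (simp add: g_def)
  qed
  then have "finite {x. g x \<noteq> 0}"
    using f fin unfolding Cc_def by (auto elim: finite_subset)
  then have gm: "g \<in> ell2 m" by (intro Cc_ell2) (simp add: Cc_def)
  have fw: "f \<in> ell2 w" by (rule Cc_ell2[OF f])
  have "A (iota w f) = P (iota m g)"
  proof (rule l2_eqI)
    fix x
    have "of_real (w x) * coord (A (iota w f)) x = of_real (w x) * coord (P (iota m g)) x"
    proof -
      have "complex_of_real (sqrt (1 + d x)) \<noteq> 0" using d1[of x] by simp
      then have "of_real (w x) * coord (P (iota m g)) x = of_real ((m x)\<^sup>2) * g x"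
        by (simp add: coord_P coord_iota[OF gm] w_def power2_eq_square)
      then show ?thesis unfolding A_iota[OF fw] g_def by simp
    qed
    then show "coord (A (iota w f)) x = coord (P (iota m g)) x" using w0[of x] by simp
  qed
  then have "friedrichs m s f g" unfolding friedrichs_iff using fw gm by blast
  then show ?thesis unfolding schr_form_def g_def by blast
qed

end

section \<open>Spectrum of an operator in terms of its resolvent\<close>

locale resolvent_op =
  fixes m :: "'v::countable \<Rightarrow> real" and T :: "'v l2 \<Rightarrow> 'v l2" and C :: real
  assumes m0: "\<And>x. 0 < m x" and T: "bsym T" "clinear_op T"
begin

sublocale T': bounded_linear T using T(1) by (rule bsym_bounded_linear)

lemma T_cscale: "T (cscale z x) = cscale z (T x)"
  using T(2) by (simp add: clinear_op_def)

text \<open>With \<open>z = l + C\<close>, the equation \<open>(A - l) f = g\<close> for the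
  operator \<open>A\<close> with resolvent \<open>T\<close> reads
  \<open>Q z f = T g\<close>.\<close>

definition Q :: "complex \<Rightarrow> 'v l2 \<Rightarrow> 'v l2" where "Q z x = x - cscale z (T x)"

lemma cscale_add_left: "cscale (a + b) x = cscale a x + cscale b x"
  by (rule l2_eqI) (simp add: algebra_simps)

lemma cscale_minus_left: "cscale (- a) x = - cscale a x"
  by (rule l2_eqI) simp

lemma opT_resolvent:
  assumes f: "f \<in> ell2 m" and g: "g \<in> ell2 m"
  shows "opT m T C f (g - smul (- l) f) \<longleftrightarrow> Q (l + of_real C) (iota m f) = T (iota m g)"
proof -
  have "T (iota m (g - smul (- l) f) + C *\<^sub>R iota m f) = T (iota m g) + cscale (l + of_real C) (T (iota m f))"
    using f g by (simp add: iota_diff ell2_smul iota_smul T'.add T'.diff T_cscale cscale_add_left cscale_minus_left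
        flip: cscale_of_real)
  moreover have "g - smul (- l) f \<in> ell2 m" using f g by (intro ell2_diff ell2_smul)
  ultimately show ?thesis unfolding opT_def Q_def using f by (auto simp: algebra_simps)
qed

lemma opT_ell2: "opT m T C f a \<Longrightarrow> f \<in> ell2 m \<and> a \<in> ell2 m"
  by (simp add: opT_def)

lemma diff_smul_eq: "a - smul l f = g \<longleftrightarrow> a = g - smul (- l) f" for a :: "'v \<Rightarrow> complex"
  by (auto simp: fun_eq_iff smul_def algebra_simps)

lemma resolventI:
  assumes b: "bij (Q (l + of_real C))" and c: "0 < c" and low: "\<And>x. c * norm x \<le> norm (Q (l + of_real C) x)"
  shows "l \<in> op_resolvent_set m (opT m T C)"
  unfolding op_resolvent_set_def
proof (intro CollectI conjI ballI)
  let ?Q = "Q (l + of_real C)"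
  fix g assume g: "g \<in> ell2 m"
  have iff: "(\<exists>a. opT m T C f a \<and> a - smul l f = g) \<longleftrightarrow> f \<in> ell2 m \<and> ?Q (iota m f) = T (iota m g)" for f
  proof -
    have "(\<exists>a. opT m T C f a \<and> a - smul l f = g) \<longleftrightarrow> opT m T C f (g - smul (- l) f)"
      by (auto simp: diff_smul_eq)
    then show ?thesis using opT_resolvent[OF _ g] opT_ell2 by blast
  qed
  show "\<exists>!f. \<exists>a. opT m T C f a \<and> a - smul l f = g"
    unfolding iff
  proof (rule ex1I[of _ "unio m (inv ?Q (T (iota m g)))"])
    show "unio m (inv ?Q (T (iota m g))) \<in> ell2 m \<and> ?Q (iota m (unio m (inv ?Q (T (iota m g))))) = T (iota m g)"
      using b by (simp add: m0 bij_is_surj surj_f_inv_f)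
    fix f assume f: "f \<in> ell2 m \<and> ?Q (iota m f) = T (iota m g)"
    then have "iota m f = inv ?Q (T (iota m g))" using b by (metis bij_is_inj inv_f_f)
    then show "f = unio m (inv ?Q (T (iota m g)))" 
      using unio_iota[of m f, OF m0] f by simp
  qed
next
  let ?Q = "Q (l + of_real C)"
  obtain M where M: "0 < M" "\<And>x. norm (T x) \<le> M * norm x" by (rule bsym_bound[OF T(1)]) (rule that)
  show "\<exists>K. \<forall>f a. opT m T C f a \<longrightarrow> ell2_norm m f \<le> K * ell2_norm m (a - smul l f)"
  proof (intro exI allI impI)
    fix f a assume fa: "opT m T C f a"
    define g where "g = a - smul l f"
    have f: "f \<in> ell2 m" and g: "g \<in> ell2 m" using opT_ell2[OF fa] by (auto simp: g_def intro: ell2_diff ell2_smul)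
    have "a = g - smul (- l) f" by (simp add: g_def fun_eq_iff smul_def)
    then have "?Q (iota m f) = T (iota m g)" using fa opT_resolvent[OF f g] by simp
    then have "c * norm (iota m f) \<le> M * norm (iota m g)" using low[of "iota m f"] M(2)[of "iota m g"] by simp
    then show "ell2_norm m f \<le> (M / c) * ell2_norm m (a - smul l f)"
      using c unfolding g_def[symmetric] ell2_norm_eq[OF f] ell2_norm_eq[OF g] by (simp add: field_simps)
  qed
qed

lemma cip_T_self: "Im (cip (T x) x) = 0"
proof -
  have "Im (cip (T x) x) = inner (cscale \<i> (T x)) x" by (rule Im_cip)
  also have "\<dots> = inner (cscale \<i> x) (T x)" unfolding T_cscale[symmetric] by (rule bsymD[OF T(1)])
  also have "\<dots> = Im (cip x (T x))" by (rule Im_cip[symmetric])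
  also have "\<dots> = - Im (cip (T x) x)" by (subst cip_commute) simp
  finally show ?thesis by simp
qed

text \<open>With \<open>a = 1 / (l + C)\<close>, the form of \<open>T\<close> is real, so
  multiplying \<open>a - T\<close> by a suitable imaginary unit gives an operator whose real form is
  \<open>\<bar>Im a\<bar>\<close> times the squared norm.\<close>

lemma nonreal_resolvent:
  assumes "l \<notin> \<real>"
  shows "l \<in> op_resolvent_set m (opT m T C)"
proof -
  define z where "z = l + of_real C"
  have Iz: "Im z \<noteq> 0" using assms by (simp add: z_def complex_is_Real_iff)
  then have z0: "z \<noteq> 0" by auto
  define a where "a = inverse z"
  have Ia: "Im a \<noteq> 0"
  proof
    assume "Im a = 0"
    then have "inverse a \<in> \<real>" by (intro Reals_inverse) (simp add: complex_is_Real_iff)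
    then show False using Iz by (simp add: a_def complex_is_Real_iff)
  qed
  \<comment> \<open>The sign that makes the rotated form positive.\<close>
  define sg where "sg = - sgn (Im a)"
  have sg: "sg * Im a = - \<bar>Im a\<bar>" "sg \<noteq> 0" "\<bar>sg\<bar> = 1" using Ia by (auto simp: sg_def sgn_if)
  define Y where "Y x = cscale (\<i> * of_real sg) (cscale a x - T x)" for x
  have Y_coer: "inner (Y x) x = \<bar>Im a\<bar> * (norm x)\<^sup>2" for x
  proof -
    have "cip (Y x) x = cnj (\<i> * of_real sg) * (cnj a * of_real ((norm x)\<^sup>2) - cip (T x) x)"
    proof -
      have "cip (cscale a x - T x) x = cip (cscale a x) x - cip (T x) x"
        using cip_add_left[of "cscale a x - T x" "T x" x] by simp
      then show ?thesis by (simp add: Y_def cip_self)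
    qed
    then have "Re (cip (Y x) x) = - sg * Im a * (norm x)\<^sup>2" using cip_T_self[of x] by simp
    then show ?thesis unfolding Re_cip using sg(1) by simp
  qed
  have Y_bl: "bounded_linear Y"
    unfolding Y_def by (intro bounded_linear_compose[OF bounded_linear_cscale] bounded_linear_sub
        bounded_linear_cscale T'.bounded_linear_axioms)
  have Y_bij: "bij Y" by (rule lax_milgram[OF Y_bl, of "\<bar>Im a\<bar>"]) (use Ia Y_coer in auto)
  have QY: "Q z x = cscale (z / (\<i> * of_real sg)) (Y x)" for x
    using sg(2) z0 by (intro l2_eqI) (simp add: Q_def Y_def a_def field_simps)
  have Y_low: "\<bar>Im a\<bar> * norm x \<le> norm (Y x)" for x
  proof (cases "x = 0")
    case False
    have "\<bar>Im a\<bar> * norm x * norm x \<le> norm (Y x) * norm x"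
      using norm_cauchy_schwarz[of "Y x" x] by (simp add: Y_coer power2_eq_square mult.assoc)
    then show ?thesis by (rule mult_right_le_imp_le) (use False in simp)
  qed simp
  have k0: "z / (\<i> * of_real sg) \<noteq> 0" using z0 sg by simp
  have "bij (cscale (z / (\<i> * of_real sg)) :: 'v l2 \<Rightarrow> 'v l2)"
  proof (rule o_bij)
    show "cscale (inverse (z / (\<i> * of_real sg))) \<circ> cscale (z / (\<i> * of_real sg)) = (id :: 'v l2 \<Rightarrow> _)"
      "cscale (z / (\<i> * of_real sg)) \<circ> cscale (inverse (z / (\<i> * of_real sg))) = (id :: 'v l2 \<Rightarrow> _)"
      using k0 by (auto intro!: l2_eqI simp: fun_eq_iff)
  qed
  then have "bij (\<lambda>x. cscale (z / (\<i> * of_real sg)) (Y x))" using bij_comp[OF Y_bij] by (simp add: o_def)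
  then have "bij (Q z)" by (simp add: QY[abs_def])
  moreover have "cmod z * \<bar>Im a\<bar> * norm x \<le> norm (Q z x)" for x
    unfolding QY using Y_low[of x] sg(3) by (simp add: norm_divide norm_mult mult.assoc mult_left_mono)
  ultimately show ?thesis
    unfolding z_def using z0 Ia by (intro resolventI[of l "cmod z * \<bar>Im a\<bar>"]) (auto simp: z_def)
qed

text \<open>A resolvent bound controls only solutions of \<open>Q z f = T g\<close>, whereas the
  lower bound concerns every \<open>x\<close>. The part of \<open>x\<close> in the range of
  \<open>T\<close> is such a solution, and the rest is \<open>Q z x\<close> itself.\<close>

lemma real_resolvent_iff:
  "of_real l \<in> op_resolvent_set m (opT m T C) \<longleftrightarrow> (\<exists>c>0. \<forall>x. c * norm x \<le> norm (x - (l + C) *\<^sub>R T x))"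
proof
  let ?z = "of_real l + of_real C :: complex"
  have Qe: "Q ?z x = x - (l + C) *\<^sub>R T x" for x
    unfolding Q_def by (simp flip: cscale_of_real)
  {
    assume "of_real l \<in> op_resolvent_set m (opT m T C)"
    then obtain K where K: "\<And>f a. opT m T C f a \<Longrightarrow> ell2_norm m f \<le> K * ell2_norm m (a - smul (of_real l) f)"
      unfolding op_resolvent_set_def by blast
    define M where "M = 1 + \<bar>K\<bar> * \<bar>l + C\<bar>"
    have M: "0 < M" by (simp add: M_def add_pos_nonneg)
    have "(1 / M) * norm x \<le> norm (x - (l + C) *\<^sub>R T x)" for x
    proof -
      define y where "y = x - (l + C) *\<^sub>R T x"
      \<comment> \<open>Since \<open>v = (l + C) T x\<close>, it solves
        \<open>Q z v = T ((l + C) y)\<close>, to which the resolvent bound applies.\<close>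
      define v where "v = x - y"
      define f where "f = unio m v"
      define g where "g = unio m ((l + C) *\<^sub>R y)"
      have v: "v = (l + C) *\<^sub>R T x" by (simp add: v_def y_def)
      have "Q ?z v = T ((l + C) *\<^sub>R y)"
        unfolding Qe v y_def by (simp add: T'.diff T'.scaleR scaleR_right_diff_distrib)
      then have "opT m T C f (g - smul (- of_real l) f)"
        by (subst opT_resolvent) (simp_all add: f_def g_def m0)
      moreover have "g - smul (- of_real l) f - smul (of_real l) f = g" by (simp add: fun_eq_iff smul_def)
      ultimately have "ell2_norm m f \<le> K * ell2_norm m g" using K by fastforce
      then have "norm v \<le> K * norm ((l + C) *\<^sub>R y)"
        by (simp add: ell2_norm_eq f_def g_def m0)
      also have "\<dots> \<le> \<bar>K\<bar> * \<bar>l + C\<bar> * norm y" by (simp add: mult.assoc mult_right_mono)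
      finally have "norm x \<le> M * norm y"
        using norm_triangle_ineq[of v y] by (simp add: v_def M_def algebra_simps)
      then show ?thesis using M unfolding y_def[symmetric] by (simp add: field_simps)
    qed
    then show "\<exists>c>0. \<forall>x. c * norm x \<le> norm (x - (l + C) *\<^sub>R T x)" using M by (intro exI[of _ "1 / M"]) auto
  next
    assume "\<exists>c>0. \<forall>x. c * norm x \<le> norm (x - (l + C) *\<^sub>R T x)"
    then obtain c where c: "c > 0" "\<And>x. c * norm x \<le> norm (Q ?z x)" unfolding Qe by blast
    have "bsym (Q ?z)"
      unfolding bsym_def Qe[abs_def]
      using T(1) by (auto simp: bsym_def inner_diff_left inner_diff_right
          intro!: bounded_linear_sub bounded_linear_ident bounded_linear_compose[OF bounded_linear_scaleR_right])
    then have "bij (Q ?z)" by (rule bsym_bounded_below_bij[OF _ c])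
    then show "of_real l \<in> op_resolvent_set m (opT m T C)" using c by (intro resolventI)
  }
qed

text \<open>For \<open>l = - C\<close> the operator \<open>Q 0\<close> is the identity, so this
  point is regular; elsewhere \<open>x - (l + C) T x\<close> is a nonzero multiple of
  \<open>T x - x / (l + C)\<close>.\<close>

lemma mem_spectrum_iff:
  "l \<in> op_spectrum m (opT m T C) \<longleftrightarrow> l \<in> \<real> \<and> Re l + C \<noteq> 0 \<and> \<not> bbelow T (1 / (Re l + C))"
proof (cases "l \<in> \<real>")
  case False
  then show ?thesis using nonreal_resolvent by (simp add: op_spectrum_def)
next
  case True
  then obtain r where r: "l = of_real r" by (auto elim: Reals_cases)
  show ?thesis
  proof (cases "r + C = 0")
    case True
    have "of_real r \<in> op_resolvent_set m (opT m T C)"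
      unfolding real_resolvent_iff True by (intro exI[of _ 1]) auto
    then show ?thesis using True by (simp add: r op_spectrum_def)
  next
    case False
    have aux: "x - k *\<^sub>R y = (- k) *\<^sub>R (y - (1 / k) *\<^sub>R x)" if "k \<noteq> 0" for k and x y :: "'v l2"
      using that by (simp add: scaleR_right_diff_distrib)
    have eq: "norm (x - (r + C) *\<^sub>R T x) = \<bar>r + C\<bar> * norm (T x - (1 / (r + C)) *\<^sub>R x)" for x
    proof -
      have "x - (r + C) *\<^sub>R T x = (- (r + C)) *\<^sub>R (T x - (1 / (r + C)) *\<^sub>R x)"
        by (rule aux[OF False])
      then show ?thesis by (metis abs_minus_cancel norm_scaleR)
    qed
    have "(\<exists>c>0. \<forall>x. c * norm x \<le> norm (x - (r + C) *\<^sub>R T x)) \<longleftrightarrow> bbelow T (1 / (r + C))"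
    proof
      assume "\<exists>c>0. \<forall>x. c * norm x \<le> norm (x - (r + C) *\<^sub>R T x)"
      then obtain c where "c > 0" "\<And>x. c * norm x \<le> \<bar>r + C\<bar> * norm (T x - (1 / (r + C)) *\<^sub>R x)" unfolding eq by blast
      then show "bbelow T (1 / (r + C))"
        unfolding bbelow_def using False by (intro exI[of _ "c / \<bar>r + C\<bar>"]) (auto simp: divide_le_eq mult.commute)
    next
      assume "bbelow T (1 / (r + C))"
      then obtain c where c: "c > 0" "\<And>x. c * norm x \<le> norm (T x - (1 / (r + C)) *\<^sub>R x)" unfolding bbelow_def by blast
      then have "(\<bar>r + C\<bar> * c) * norm x \<le> \<bar>r + C\<bar> * norm (T x - (1 / (r + C)) *\<^sub>R x)" for x
        by (simp add: mult.assoc mult_left_mono)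
      then show "\<exists>c>0. \<forall>x. c * norm x \<le> norm (x - (r + C) *\<^sub>R T x)"
        unfolding eq using c(1) False by (intro exI[of _ "\<bar>r + C\<bar> * c"]) auto
    qed
    then show ?thesis using False True by (simp add: r op_spectrum_def real_resolvent_iff)
  qed
qed

lemma opT_eigen_iff:
  assumes f: "f \<in> ell2 m"
  shows "opT m T C f (smul (of_real l) f) \<longleftrightarrow> iota m f = (l + C) *\<^sub>R T (iota m f)"
  unfolding opT_def using f
  by (simp add: ell2_smul iota_smul cscale_of_real T'.scaleR flip: scaleR_add_left)

text \<open>For the converse, either \<open>T - s\<close> fails to be bounded below for
  \<open>s\<close> arbitrarily close to \<open>t\<close>, and \<open>l\<close> is a limit point of
  the spectrum, or \<open>t\<close> is isolated and the Weyl sequence yields infinitely many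
  orthonormal eigenvectors.\<close>

theorem ess_spectrum_iff_weyl:
  "l \<in> op_ess_spectrum m (opT m T C) \<longleftrightarrow> l \<in> \<real> \<and> Re l + C \<noteq> 0 \<and> weyl T (1 / (Re l + C))"
proof
  assume "l \<in> op_ess_spectrum m (opT m T C)"
  then have sp: "l \<in> op_spectrum m (opT m T C)"
    and or: "l islimpt op_spectrum m (opT m T C) \<or> infinite_multiplicity m (opT m T C) l"
    unfolding op_ess_spectrum_def by auto
  have l: "l \<in> \<real>" "Re l + C \<noteq> 0" using sp unfolding mem_spectrum_iff by auto
  have lr: "of_real (Re l) = l" using l(1) by (simp add: of_real_Re)
  from or have "weyl T (1 / (Re l + C))"
  proof
    assume "l islimpt op_spectrum m (opT m T C)"
    then obtain f where f: "\<And>n. f n \<in> op_spectrum m (opT m T C) - {l}" "f \<longlonglongrightarrow> l"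
      unfolding islimpt_sequential by blast
    have fr: "f n \<in> \<real>" "Re (f n) + C \<noteq> 0" "\<not> bbelow T (1 / (Re (f n) + C))" "f n \<noteq> l" for n
      using f(1)[of n] unfolding Diff_iff mem_spectrum_iff by auto
    show ?thesis
    proof (rule weyl_if_limit_point[OF T(1), of "\<lambda>n. 1 / (Re (f n) + C)"])
      show "(\<lambda>n. 1 / (Re (f n) + C)) \<longlonglongrightarrow> 1 / (Re l + C)"
        by (intro tendsto_intros tendsto_Re f(2) l(2))
      show "1 / (Re (f n) + C) \<noteq> 1 / (Re l + C)" for n
      proof
        assume "1 / (Re (f n) + C) = 1 / (Re l + C)"
        then have "Re (f n) = Re l" using fr(2)[of n] l(2) by (simp add: field_simps)
        then show False using fr(1,4)[of n] l(1) by (auto simp: complex_eq_iff complex_is_Real_iff)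
      qed
    qed (rule fr(3))
  next
    assume "infinite_multiplicity m (opT m T C) l"
    then obtain F where F: "\<And>i::nat. opT m T C (F i) (smul l (F i))"
      "\<And>i j. ell2_ip m (F i) (F j) = (if i = j then 1 else 0)"
      unfolding infinite_multiplicity_def by blast
    have Fm: "F i \<in> ell2 m" for i using opT_ell2[OF F(1)] by blast
    show ?thesis
    proof (rule weyl_if_infinite_multiplicity[where F = "\<lambda>i. iota m (F i)"])
      fix i
      have "iota m (F i) = (Re l + C) *\<^sub>R T (iota m (F i))"
        using F(1)[of i] opT_eigen_iff[OF Fm, of i "Re l"] lr by simp
      from arg_cong[OF this, of "scaleR (1 / (Re l + C))"]
      show "T (iota m (F i)) = (1 / (Re l + C)) *\<^sub>R iota m (F i)" using l(2) by simp
    qed (use F(2) Fm in \<open>simp add: ell2_ip_eq\<close>)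
  qed
  with l show "l \<in> \<real> \<and> Re l + C \<noteq> 0 \<and> weyl T (1 / (Re l + C))" by blast
next
  assume R: "l \<in> \<real> \<and> Re l + C \<noteq> 0 \<and> weyl T (1 / (Re l + C))"
  then have l: "l \<in> \<real>" "Re l + C \<noteq> 0" and we: "weyl T (1 / (Re l + C))" by auto
  have lr: "of_real (Re l) = l" using l(1) by (simp add: of_real_Re)
  define t where "t = 1 / (Re l + C)"
  have t0: "t \<noteq> 0" using l(2) by (simp add: t_def)
  have sp: "l \<in> op_spectrum m (opT m T C)" unfolding mem_spectrum_iff using l weyl_not_bbelow[OF we] by blast
  have "l islimpt op_spectrum m (opT m T C) \<or> infinite_multiplicity m (opT m T C) l"
  proof (cases "\<exists>d>0. \<forall>s. s \<noteq> t \<longrightarrow> \<bar>s - t\<bar> < d \<longrightarrow> bbelow T s")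
    case True
    then obtain F where F: "\<And>i::nat. T (F i) = t *\<^sub>R F i" "\<And>i j. cip (F i) (F j) = (if i = j then 1 else 0)"
      using infinite_multiplicity_if_weyl_isolated[OF T we[folded t_def]] by blast
    have "opT m T C (unio m (F i)) (smul l (unio m (F i)))" for i
      using opT_eigen_iff[of "unio m (F i)" "Re l"] l(2) by (simp add: lr m0 F(1) t_def)
    moreover have "ell2_ip m (unio m (F i)) (unio m (F j)) = (if i = j then 1 else 0)" for i j
      by (simp add: ell2_ip_eq m0 F(2))
    ultimately show ?thesis unfolding infinite_multiplicity_def by (intro disjI2 exI[of _ "\<lambda>i. unio m (F i)"]) blast
  next
    case False
    \<comment> \<open>The radius is at most \<open>\<bar>t\<bar>\<close>, which keeps
      \<open>s\<close> away from 0, so that \<open>1 / s - C\<close> is a genuine spectral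
      point.\<close>
    have "\<exists>s. s \<noteq> t \<and> \<bar>s - t\<bar> < min \<bar>t\<bar> (1 / real (Suc n)) \<and> \<not> bbelow T s" for n
      using False t0 by (meson min_less_iff_conj zero_less_abs_iff zero_less_divide_1_iff of_nat_0_less_iff zero_less_Suc)
    then obtain s where s: "\<And>n. s n \<noteq> t" "\<And>n. \<bar>s n - t\<bar> < min \<bar>t\<bar> (1 / real (Suc n))" "\<And>n. \<not> bbelow T (s n)"
      by metis
    have s0: "s n \<noteq> 0" for n using s(2)[of n] by auto
    have "(\<lambda>n. s n - t) \<longlonglongrightarrow> 0"
    proof (rule Lim_null_comparison[OF always_eventually])
      show "\<forall>n. norm (s n - t) \<le> 1 / real (Suc n)" using s(2) by (auto intro: less_imp_le)
      show "(\<lambda>n. 1 / real (Suc n)) \<longlonglongrightarrow> 0"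
        using LIMSEQ_inverse_real_of_nat by (simp only: inverse_eq_divide)
    qed
    then have lim: "s \<longlonglongrightarrow> t" by (rule LIM_zero_cancel)
    define f where "f n = complex_of_real (1 / s n - C)" for n
    have fC: "Re (f n) + C = 1 / s n" for n by (simp add: f_def)
    have "f n \<in> op_spectrum m (opT m T C)" for n
      unfolding mem_spectrum_iff fC using s(3)[of n] s0[of n] by (simp add: f_def)
    moreover have "f n \<noteq> l" for n
    proof
      assume "f n = l"
      then have "1 / s n = Re l + C" using fC[of n] by simp
      then have "s n = t" using s0[of n] l(2) by (simp add: t_def field_simps)
      then show False using s(1) by blast
    qed
    moreover have "f \<longlonglongrightarrow> l"
    proof -
      have "f \<longlonglongrightarrow> complex_of_real (1 / t - C)" unfolding f_def by (intro tendsto_intros lim t0)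
      moreover have "complex_of_real (1 / t - C) = l" using lr by (simp add: t_def)
      ultimately show ?thesis by simp
    qed
    ultimately show ?thesis unfolding islimpt_sequential by blast
  qed
  with sp show "l \<in> op_ess_spectrum m (opT m T C)" unfolding op_ess_spectrum_def by blast
qed

lemma ess_spectrum_empty_iff:
  "op_ess_spectrum m (opT m T C) = {} \<longleftrightarrow> \<not> (\<exists>t. t \<noteq> 0 \<and> weyl T t)"
proof -
  have "of_real (1 / t - C) \<in> op_ess_spectrum m (opT m T C)" if "t \<noteq> 0" "weyl T t" for t
    unfolding ess_spectrum_iff_weyl using that by simp
  then show ?thesis using ess_spectrum_iff_weyl by (metis all_not_in_conv divide_eq_0_iff one_neq_zero)
qed

text \<open>Positivity of \<open>T\<close> forces \<open>nu + C > 0\<close> for every eigenvalue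
  \<open>nu\<close>, and then \<open>nu <= mu\<close> becomes a lower bound for the eigenvalue of
  \<open>T\<close>. With \<open>N > 0\<close> there is an eigenvector that makes
  \<open>mu + C\<close> positive.\<close>

lemma eigenvalue_N_eq:
  assumes pos: "\<And>x. 0 \<le> inner (T x) x" and N: "0 < N"
  shows "eigenvalue_N m (opT m T C) N = Inf {mu. 0 < mu + C \<and> (\<exists>U. eigenfamily T (1 / (mu + C)) N U)}"
proof -
  have "(\<exists>F::nat \<Rightarrow> 'v \<Rightarrow> complex. (\<forall>i<N. \<forall>j<N. ell2_ip m (F i) (F j) = (if i = j then 1 else 0)) \<and>
     (\<forall>i<N. \<exists>nu::real. nu \<le> mu \<and> opT m T C (F i) (smul (complex_of_real nu) (F i))))
     \<longleftrightarrow> 0 < mu + C \<and> (\<exists>U. eigenfamily T (1 / (mu + C)) N U)" (is "?L = ?R") for mu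
  proof
    assume ?L
    then obtain F nu where orth: "\<And>i j. i < N \<Longrightarrow> j < N \<Longrightarrow> ell2_ip m (F i) (F j) = (if i = j then 1 else 0)"
      and nu: "\<And>i. i < N \<Longrightarrow> nu i \<le> mu" "\<And>i. i < N \<Longrightarrow> opT m T C (F i) (smul (complex_of_real (nu i)) (F i))"
      by metis
    have Fm: "F i \<in> ell2 m" if "i < N" for i using opT_ell2[OF nu(2)[OF that]] by blast
    let ?U = "\<lambda>i. iota m (F i)"
    have cU: "cip (?U i) (?U j) = (if i = j then 1 else 0)" if "i < N" "j < N" for i j
      using orth[OF that] Fm that by (simp add: ell2_ip_eq)
    have eig: "?U i = (nu i + C) *\<^sub>R T (?U i)" if "i < N" for i
      using nu(2)[OF that] opT_eigen_iff[OF Fm[OF that]] by blast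
    have pos': "0 < nu i + C" if i: "i < N" for i
    proof -
      have "1 = inner (?U i) (?U i)" using arg_cong[OF cU[OF i i], of Re] by (simp add: Re_cip)
      also have "\<dots> = (nu i + C) * inner (T (?U i)) (?U i)" by (subst (1) eig[OF i]) simp
      finally have "0 < (nu i + C) * inner (T (?U i)) (?U i)" by simp
      then show ?thesis using pos[of "?U i"] by (simp add: zero_less_mult_iff)
    qed
    have mu: "0 < mu + C" using pos'[OF N] nu(1)[OF N] by linarith
    have "eigenfamily T (1 / (mu + C)) N ?U"
      unfolding eigenfamily_def orthonormal_upto_def
    proof (intro conjI allI impI)
      fix i assume i: "i < N"
      have "1 / (mu + C) \<le> 1 / (nu i + C)" using nu(1)[OF i] pos'[OF i] by (intro divide_left_mono mult_pos_pos) (auto simp: mu)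
      moreover have "T (?U i) = (1 / (nu i + C)) *\<^sub>R ?U i"
        using arg_cong[OF eig[OF i], of "scaleR (1 / (nu i + C))"] pos'[OF i] by simp
      ultimately show "\<exists>t\<ge>1 / (mu + C). T (?U i) = t *\<^sub>R ?U i" by blast
    qed (rule cU)
    then show ?R using mu by blast
  next
    assume R: ?R
    then obtain U where mu: "0 < mu + C" and U: "eigenfamily T (1 / (mu + C)) N U" by blast
    obtain t where t: "\<And>i. i < N \<Longrightarrow> t i \<ge> 1 / (mu + C) \<and> T (U i) = t i *\<^sub>R U i"
      using U unfolding eigenfamily_def by metis
    have tp: "0 < t i" if "i < N" for i using t[OF that] mu by (meson divide_pos_pos less_le_trans zero_less_one)
    show ?L
    proof (intro exI[of _ "\<lambda>i. unio m (U i)"] conjI allI impI)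
      fix i j assume "i < N" "j < N"
      then show "ell2_ip m (unio m (U i)) (unio m (U j)) = (if i = j then 1 else 0)"
        using U unfolding eigenfamily_def orthonormal_upto_def by (simp add: ell2_ip_eq m0)
    next
      fix i assume i: "i < N"
      have "1 / t i - C \<le> mu" using t[OF i] tp[OF i] mu by (simp add: field_simps)
      moreover have "opT m T C (unio m (U i)) (smul (complex_of_real (1 / t i - C)) (unio m (U i)))"
        using opT_eigen_iff[of "unio m (U i)" "1 / t i - C"] t[OF i] tp[OF i] by (simp add: m0)
      ultimately show "\<exists>nu\<le>mu. opT m T C (unio m (U i)) (smul (complex_of_real nu) (unio m (U i)))" by blast
    qed
  qed
  then show ?thesis unfolding eigenvalue_N_def by simp
qed

end

text \<open>Growth of \<open>b\<close> absorbs the additive error \<open>g\<close>, which may depend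
  on \<open>e\<close>.\<close>

lemma ratio_tendsto_1:
  fixes a b :: "nat \<Rightarrow> real"
  assumes b: "filterlim b at_top sequentially"
    and cmp: "\<And>e. 0 < e \<Longrightarrow> e < 1 \<Longrightarrow> \<exists>g. \<forall>N>0. a N \<le> (1 + e) * b N + g \<and> (1 - e) * b N - g \<le> a N"
  shows "(\<lambda>N. a N / b N) \<longlonglongrightarrow> 1"
proof (rule LIMSEQ_I)
  fix r :: real assume r: "0 < r"
  define e where "e = min (r / 2) (1 / 2)"
  have e: "0 < e" "e < 1" "e \<le> r / 2" using r by (auto simp: e_def)
  obtain g where g: "\<And>N. N > 0 \<Longrightarrow> a N \<le> (1 + e) * b N + g \<and> (1 - e) * b N - g \<le> a N" using cmp[OF e(1,2)] by blast
  have "\<forall>\<^sub>F N in sequentially. max 1 (2 * \<bar>g\<bar> / r + 1) \<le> b N"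
    using b unfolding filterlim_at_top by blast
  then obtain N0 where N0: "\<And>N. N \<ge> N0 \<Longrightarrow> max 1 (2 * \<bar>g\<bar> / r + 1) \<le> b N" unfolding eventually_sequentially by blast
  have "norm (a N / b N - 1) < r" if N: "N \<ge> max N0 1" for N
  proof -
    have bN: "1 \<le> b N" "2 * \<bar>g\<bar> / r < b N" using N0[of N] N by auto
    then have "\<bar>g\<bar> < (r / 2) * b N" using r by (simp add: field_simps)
    moreover have "e * b N \<le> (r / 2) * b N" using e bN by (intro mult_right_mono) auto
    moreover have "\<bar>a N - b N\<bar> \<le> e * b N + \<bar>g\<bar>"
      using g[of N] N by (simp add: algebra_simps abs_le_iff) linarith
    ultimately have "\<bar>a N - b N\<bar> < r * b N" by linarith
    moreover have "a N / b N - 1 = (a N - b N) / b N" using bN by (simp add: field_simps)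
    ultimately show ?thesis using bN by (simp add: abs_divide divide_less_eq)
  qed
  then show "\<exists>N0. \<forall>N\<ge>N0. norm (a N / b N - 1) < r" by blast
qed

section \<open>Comparison with the degree\<close>

lemma norm_sq_finite_support:
  assumes "finite S" "\<And>x. x \<notin> S \<Longrightarrow> coord f x = 0"
  shows "(norm f)\<^sup>2 = (\<Sum>x\<in>S. (cmod (coord f x))\<^sup>2)"
proof -
  have "(norm f)\<^sup>2 = (\<Sum>\<^sub>\<infinity>x\<in>S. (cmod (coord f x))\<^sup>2)"
    unfolding norm_l2_sq by (rule infsum_cong_neutral) (use assms in auto)
  then show ?thesis using assms by simp
qed

lemma Lambda_nonneg: "0 \<le> Lambda E E0 m x"
  unfolding Lambda_def by (intro divide_nonneg_nonneg sum_nonneg) auto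

lemma sum_diff_le_Lambda:
  assumes m: "0 < m x" and fin: "finite {y. adj E x y}" "finite {y. adj E0 x y}" and S: "finite S"
  shows "(\<Sum>y\<in>S. \<bar>E x y - E0 x y\<bar>) \<le> Lambda E E0 m x * (m x)\<^sup>2"
proof -
  let ?N = "{y. adj E x y \<or> adj E0 x y}"
  have fN: "finite ?N" using fin by (simp add: Collect_disj_eq)
  have "(\<Sum>y\<in>S. \<bar>E x y - E0 x y\<bar>) = (\<Sum>y\<in>S \<inter> ?N. \<bar>E x y - E0 x y\<bar>)"
    by (rule sum.mono_neutral_right) (use S in \<open>auto simp: adj_def\<close>)
  also have "\<dots> \<le> (\<Sum>y\<in>?N. \<bar>E x y - E0 x y\<bar>)" by (rule sum_mono2) (use fN in auto)
  also have "\<dots> = Lambda E E0 m x * (m x)\<^sup>2" using m by (simp add: Lambda_def)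
  finally show ?thesis .
qed

lemma wdeg_diff_le_Lambda:
  assumes m: "0 < m x" and fin: "finite {y. adj E x y}" "finite {y. adj E0 x y}"
  shows "\<bar>wdeg E m x - wdeg E0 m x\<bar> \<le> Lambda E E0 m x"
proof -
  let ?N = "{y. adj E x y \<or> adj E0 x y}"
  have fN: "finite ?N" using fin by (simp add: Collect_disj_eq)
  have "(\<Sum>y\<in>{y. adj E x y}. E x y) = (\<Sum>y\<in>?N. E x y)" "(\<Sum>y\<in>{y. adj E0 x y}. E0 x y) = (\<Sum>y\<in>?N. E0 x y)"
    by (rule sum.mono_neutral_left; use fN in \<open>auto simp: adj_def\<close>)+
  then have "wdeg E m x - wdeg E0 m x = (\<Sum>y\<in>?N. E x y - E0 x y) / (m x)\<^sup>2"
    by (simp add: wdeg_def sum_subtractf diff_divide_distrib)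
  then show ?thesis unfolding Lambda_def by (simp add: divide_right_mono sum_abs)
qed

context graph_form
begin

text \<open>The difference of the squared norms of \<open>F\<close> and \<open>P F\<close> is the
  degree form. On the diagonal \<open>Lambda\<close> and \<open>V\<close> measure the deviation from
  it; off the diagonal the tree part is bounded by \<open>off\<close>, and the weights
  \<open>\<bar>E - E0\<bar>\<close> cost \<open>Lambda\<close> once more by AM-GM.\<close>

lemma form_degree_bound:
  assumes graph0: "weighted_graph E0 m th0" and dE0: "d = wdeg E0 m"
    and off: "\<And>eps. 0 < eps \<Longrightarrow> \<exists>c\<ge>0. \<forall>S (f :: 'v \<Rightarrow> real). finite S \<longrightarrow>
       (\<Sum>x\<in>S. \<Sum>y\<in>S. E0 x y * (\<bar>f x\<bar> * \<bar>f y\<bar>))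
        \<le> eps * (\<Sum>x\<in>S. d x * (m x)\<^sup>2 * (f x)\<^sup>2) + c * (\<Sum>x\<in>S. (m x)\<^sup>2 * (f x)\<^sup>2)"
    and pert: "\<And>eps. 0 < eps \<Longrightarrow> \<exists>c\<ge>0. \<forall>x. \<bar>V x\<bar> + Lambda E E0 m x \<le> eps * (1 + d x) + c"
    and eps: "0 < eps"
  shows "\<exists>c\<ge>0. \<forall>F. \<bar>inner (A F) F - ((norm F)\<^sup>2 - (norm (P F))\<^sup>2)\<bar>
      \<le> eps * ((norm F)\<^sup>2 - (norm (P F))\<^sup>2) + c * (norm (P F))\<^sup>2"
proof -
  have fin0: "finite {y. adj E0 x y}" and E00: "0 \<le> E0 x y" and E0s: "E0 x y = E0 y x" for x y
    using graph0 unfolding weighted_graph_def by blast+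
  let ?L = "Lambda E E0 m"
  \<comment> \<open>One third pays for the tree off-diagonal part, two thirds for
    \<open>2 * Lambda + \<bar>V\<bar>\<close>.\<close>
  define h where "h = eps / 3"
  have h: "0 < h" and eps3: "eps = h + 2 * h" using eps by (simp_all add: h_def)
  obtain c1 where c1: "0 \<le> c1" "\<And>S (f :: 'v \<Rightarrow> real). finite S \<Longrightarrow>
       (\<Sum>x\<in>S. \<Sum>y\<in>S. E0 x y * (\<bar>f x\<bar> * \<bar>f y\<bar>))
        \<le> h * (\<Sum>x\<in>S. d x * (m x)\<^sup>2 * (f x)\<^sup>2) + c1 * (\<Sum>x\<in>S. (m x)\<^sup>2 * (f x)\<^sup>2)"
    using off[OF h] by blast
  obtain c2 where c2: "0 \<le> c2" "\<And>x. \<bar>V x\<bar> + ?L x \<le> h * (1 + d x) + c2" using pert[OF h] by blast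
  \<comment> \<open>The extra \<open>h\<close> comes from the 1 in \<open>1 + d\<close>, which
    belongs to the norm of \<open>P F\<close> and not to the degree form.\<close>
  define c where "c = c1 + 2 * (h + c2)"
  have c0: "0 \<le> c" using c1 c2 h by (simp add: c_def)
  have finite_case: "\<bar>inner (A F) F - ((norm F)\<^sup>2 - (norm (P F))\<^sup>2)\<bar>
      \<le> eps * ((norm F)\<^sup>2 - (norm (P F))\<^sup>2) + c * (norm (P F))\<^sup>2"
    if Sf: "finite {x. coord F x \<noteq> 0}" for F
  proof -
    let ?S = "{x. coord F x \<noteq> 0}"
    define f where "f x = cmod (coord F x) / w x" for x
    have wn: "w x \<noteq> 0" for x using w0[of x] by simp
    have f0: "0 \<le> f x" for x using w0[of x] by (simp add: f_def)
    have Fx: "(cmod (coord F x))\<^sup>2 = (1 + d x) * (m x)\<^sup>2 * (f x)\<^sup>2" for x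
    proof -
      have "(1 + d x) * (m x)\<^sup>2 = (w x)\<^sup>2" using wsq[of x] by (simp add: mult.commute)
      then show ?thesis using wn[of x] by (simp only: f_def power_divide) simp
    qed
    have nF: "(norm F)\<^sup>2 = (\<Sum>x\<in>?S. (1 + d x) * (m x)\<^sup>2 * (f x)\<^sup>2)"
      using norm_sq_finite_support[OF Sf, of F] by (simp add: Fx)
    have nPF: "(norm (P F))\<^sup>2 = (\<Sum>x\<in>?S. (m x)\<^sup>2 * (f x)\<^sup>2)"
    proof -
      have "(cmod (coord (P F) x))\<^sup>2 = (m x)\<^sup>2 * (f x)\<^sup>2" for x
        using d1[of x] by (simp add: coord_P norm_divide power_divide Fx)
      then show ?thesis using norm_sq_finite_support[OF Sf, of "P F"] by (simp add: coord_P)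
    qed
    have D: "(norm F)\<^sup>2 - (norm (P F))\<^sup>2 = (\<Sum>x\<in>?S. d x * (m x)\<^sup>2 * (f x)\<^sup>2)"
      unfolding nF nPF by (simp add: sum_subtractf[symmetric] algebra_simps)
    let ?q = "\<lambda>x y. of_real (E x y) * cis (th x y) * cnj (coord F x) * coord F y / of_real (w x * w y)"
    have alg: "a * ((r - e) / N) * b = r * (a * b / N) - e * a * b / N" for a r e N b :: complex
      by (simp add: diff_divide_distrib algebra_simps)
    have trm: "cnj (coord F x) * ke x y * coord F y
        = (if x = y then of_real ((wdeg E m x + V x) * (m x)\<^sup>2 * (f x)\<^sup>2) else 0) - ?q x y" for x y
    proof -
      have "cnj (coord F x) * coord F x / of_real (w x * w x) = of_real ((f x)\<^sup>2)"
        unfolding f_def power_divide by (simp add: mult.commute complex_norm_square[symmetric] power2_eq_square)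
      moreover have "cnj (coord F x) * ((of_real ((wdeg E m x + V x) * (m x)\<^sup>2) - of_real (E x y) * cis (th x y)) / of_real (w x * w y)) * coord F y
        = of_real ((wdeg E m x + V x) * (m x)\<^sup>2) * (cnj (coord F x) * coord F y / of_real (w x * w y)) - ?q x y"
        by (rule alg)
      moreover have "cnj (coord F x) * ((0 - of_real (E x y) * cis (th x y)) / of_real (w x * w y)) * coord F y = 0 - ?q x y"
        using alg[of "cnj (coord F x)" 0] by simp
      ultimately show ?thesis unfolding ke_def by (cases "x = y") (simp_all only: if_True if_False of_real_mult simp_thms)
    qed
    have "inner (A F) F = Re (cip F (A F))" by (simp add: Re_cip inner_commute)
    also have "cip F (A F) = (\<Sum>x\<in>?S. \<Sum>y\<in>?S. cnj (coord F x) * ke x y * coord F y)"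
      unfolding A_def by (rule A.cip_kop) (use Sf in auto)
    also have "\<dots> = (\<Sum>x\<in>?S. of_real ((wdeg E m x + V x) * (m x)\<^sup>2 * (f x)\<^sup>2)) - (\<Sum>x\<in>?S. \<Sum>y\<in>?S. ?q x y)"
      unfolding trm sum_subtractf by (simp add: Sf sum.delta' del: of_real_mult of_real_add)
    finally have AF: "inner (A F) F = (\<Sum>x\<in>?S. (wdeg E m x + V x) * (m x)\<^sup>2 * (f x)\<^sup>2) - Re (\<Sum>x\<in>?S. \<Sum>y\<in>?S. ?q x y)"
      by (simp del: of_real_mult of_real_add)
    have "\<bar>Re (\<Sum>x\<in>?S. \<Sum>y\<in>?S. ?q x y)\<bar> \<le> cmod (\<Sum>x\<in>?S. \<Sum>y\<in>?S. ?q x y)" by (rule abs_Re_le_cmod)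
    also have "\<dots> \<le> (\<Sum>x\<in>?S. \<Sum>y\<in>?S. cmod (?q x y))"
      by (intro order_trans[OF norm_sum] sum_mono norm_sum)
    also have "\<dots> = (\<Sum>x\<in>?S. \<Sum>y\<in>?S. E x y * (\<bar>f x\<bar> * \<bar>f y\<bar>))"
      using f0 E0 w0 by (intro sum.cong refl) (simp add: norm_mult norm_divide f_def abs_of_pos)
    also have "\<dots> \<le> (\<Sum>x\<in>?S. \<Sum>y\<in>?S. E0 x y * (\<bar>f x\<bar> * \<bar>f y\<bar>) + \<bar>E x y - E0 x y\<bar> * (\<bar>f x\<bar> * \<bar>f y\<bar>))"
      by (intro sum_mono) (simp add: distrib_right[symmetric] mult_right_mono)
    also have "\<dots> = (\<Sum>x\<in>?S. \<Sum>y\<in>?S. E0 x y * (\<bar>f x\<bar> * \<bar>f y\<bar>)) + (\<Sum>x\<in>?S. \<Sum>y\<in>?S. \<bar>E x y - E0 x y\<bar> * (\<bar>f x\<bar> * \<bar>f y\<bar>))"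
      by (simp add: sum.distrib)
    also have "(\<Sum>x\<in>?S. \<Sum>y\<in>?S. \<bar>E x y - E0 x y\<bar> * (\<bar>f x\<bar> * \<bar>f y\<bar>)) \<le> (\<Sum>x\<in>?S. ?L x * (m x)\<^sup>2 * (f x)\<^sup>2)"
    proof -
      let ?e = "\<lambda>x y. \<bar>E x y - E0 x y\<bar>"
      have "(\<Sum>x\<in>?S. \<Sum>y\<in>?S. ?e x y * (\<bar>f x\<bar> * \<bar>f y\<bar>)) \<le> (\<Sum>x\<in>?S. \<Sum>y\<in>?S. ?e x y * ((f x)\<^sup>2 / 2) + ?e x y * ((f y)\<^sup>2 / 2))"
      proof (intro sum_mono)
        fix x y
        have "\<bar>f x\<bar> * \<bar>f y\<bar> \<le> (f x)\<^sup>2 / 2 + (f y)\<^sup>2 / 2"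
          using sum_squares_bound[of "\<bar>f x\<bar>" "\<bar>f y\<bar>"] by simp
        then show "?e x y * (\<bar>f x\<bar> * \<bar>f y\<bar>) \<le> ?e x y * ((f x)\<^sup>2 / 2) + ?e x y * ((f y)\<^sup>2 / 2)"
          unfolding distrib_left[symmetric] by (intro mult_left_mono) auto
      qed
      also have "\<dots> = (\<Sum>x\<in>?S. \<Sum>y\<in>?S. ?e x y * ((f x)\<^sup>2 / 2)) + (\<Sum>x\<in>?S. \<Sum>y\<in>?S. ?e x y * ((f y)\<^sup>2 / 2))"
        by (simp only: sum.distrib)
      also have "(\<Sum>x\<in>?S. \<Sum>y\<in>?S. ?e x y * ((f y)\<^sup>2 / 2)) = (\<Sum>y\<in>?S. \<Sum>x\<in>?S. ?e x y * ((f y)\<^sup>2 / 2))" by (rule sum.swap)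
      also have "\<dots> = (\<Sum>x\<in>?S. \<Sum>y\<in>?S. ?e x y * ((f x)\<^sup>2 / 2))"
        using E_sym E0s by (intro sum.cong refl) metis
      finally have le: "(\<Sum>x\<in>?S. \<Sum>y\<in>?S. ?e x y * (\<bar>f x\<bar> * \<bar>f y\<bar>))
          \<le> (\<Sum>x\<in>?S. \<Sum>y\<in>?S. ?e x y * ((f x)\<^sup>2 / 2)) + (\<Sum>x\<in>?S. \<Sum>y\<in>?S. ?e x y * ((f x)\<^sup>2 / 2))" .
      have "(\<Sum>x\<in>?S. \<Sum>y\<in>?S. ?e x y * (\<bar>f x\<bar> * \<bar>f y\<bar>)) \<le> (\<Sum>x\<in>?S. (\<Sum>y\<in>?S. ?e x y) * (f x)\<^sup>2)"
      proof -
        have "(\<Sum>x\<in>?S. \<Sum>y\<in>?S. ?e x y * ((f x)\<^sup>2 / 2)) + (\<Sum>x\<in>?S. \<Sum>y\<in>?S. ?e x y * ((f x)\<^sup>2 / 2))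
            = (\<Sum>x\<in>?S. \<Sum>y\<in>?S. ?e x y * ((f x)\<^sup>2 / 2) + ?e x y * ((f x)\<^sup>2 / 2))"
          by (simp only: sum.distrib)
        also have "\<dots> = (\<Sum>x\<in>?S. (\<Sum>y\<in>?S. ?e x y) * (f x)\<^sup>2)"
          by (intro sum.cong refl) (simp add: sum_distrib_left mult.commute)
        finally have "(\<Sum>x\<in>?S. \<Sum>y\<in>?S. ?e x y * ((f x)\<^sup>2 / 2)) + (\<Sum>x\<in>?S. \<Sum>y\<in>?S. ?e x y * ((f x)\<^sup>2 / 2))
            = (\<Sum>x\<in>?S. (\<Sum>y\<in>?S. ?e x y) * (f x)\<^sup>2)" .
        then show ?thesis using le by simp
      qed
      also have "\<dots> \<le> (\<Sum>x\<in>?S. ?L x * (m x)\<^sup>2 * (f x)\<^sup>2)"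
        by (intro sum_mono mult_right_mono sum_diff_le_Lambda[of m _ E E0, OF m0 fin fin0 Sf]) auto
      finally show ?thesis .
    qed
    finally have offE: "\<bar>Re (\<Sum>x\<in>?S. \<Sum>y\<in>?S. ?q x y)\<bar>
        \<le> h * (\<Sum>x\<in>?S. d x * (m x)\<^sup>2 * (f x)\<^sup>2) + c1 * (\<Sum>x\<in>?S. (m x)\<^sup>2 * (f x)\<^sup>2) + (\<Sum>x\<in>?S. ?L x * (m x)\<^sup>2 * (f x)\<^sup>2)"
      using c1(2)[OF Sf, of f] by linarith
    have eqn: "inner (A F) F - ((norm F)\<^sup>2 - (norm (P F))\<^sup>2)
        = (\<Sum>x\<in>?S. (wdeg E m x - d x + V x) * (m x)\<^sup>2 * (f x)\<^sup>2) - Re (\<Sum>x\<in>?S. \<Sum>y\<in>?S. ?q x y)"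
      unfolding AF D by (simp add: sum_subtractf[symmetric] algebra_simps)
    have b0: "\<bar>inner (A F) F - ((norm F)\<^sup>2 - (norm (P F))\<^sup>2)\<bar>
        \<le> \<bar>\<Sum>x\<in>?S. (wdeg E m x - d x + V x) * (m x)\<^sup>2 * (f x)\<^sup>2\<bar> + \<bar>Re (\<Sum>x\<in>?S. \<Sum>y\<in>?S. ?q x y)\<bar>"
      unfolding eqn by (rule abs_triangle_ineq4)
    have b1: "\<bar>\<Sum>x\<in>?S. (wdeg E m x - d x + V x) * (m x)\<^sup>2 * (f x)\<^sup>2\<bar> \<le> (\<Sum>x\<in>?S. (?L x + \<bar>V x\<bar>) * (m x)\<^sup>2 * (f x)\<^sup>2)"
    proof (rule order_trans[OF sum_abs], rule sum_mono)
      fix x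
      have "\<bar>wdeg E m x - d x + V x\<bar> \<le> ?L x + \<bar>V x\<bar>"
        using wdeg_diff_le_Lambda[of m x E E0, OF m0 fin fin0] unfolding dE0 by linarith
      then show "\<bar>(wdeg E m x - d x + V x) * (m x)\<^sup>2 * (f x)\<^sup>2\<bar> \<le> (?L x + \<bar>V x\<bar>) * (m x)\<^sup>2 * (f x)\<^sup>2"
        by (simp add: abs_mult mult_right_mono)
    qed
    have b2: "(\<Sum>x\<in>?S. (?L x + \<bar>V x\<bar>) * (m x)\<^sup>2 * (f x)\<^sup>2) + (\<Sum>x\<in>?S. ?L x * (m x)\<^sup>2 * (f x)\<^sup>2)
        = (\<Sum>x\<in>?S. (2 * ?L x + \<bar>V x\<bar>) * (m x)\<^sup>2 * (f x)\<^sup>2)"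
      unfolding sum.distrib[symmetric] by (intro sum.cong refl) (simp add: algebra_simps)
    have "(\<Sum>x\<in>?S. (2 * ?L x + \<bar>V x\<bar>) * (m x)\<^sup>2 * (f x)\<^sup>2)
        \<le> (\<Sum>x\<in>?S. (2 * (h * (1 + d x) + c2)) * (m x)\<^sup>2 * (f x)\<^sup>2)"
    proof (intro sum_mono mult_right_mono)
      fix x show "2 * ?L x + \<bar>V x\<bar> \<le> 2 * (h * (1 + d x) + c2)"
      proof -
        have "2 * l + v \<le> 2 * r" if "v + l \<le> r" "0 \<le> v" for l v r :: real using that by linarith
        from this[OF c2(2)[of x]] show ?thesis by simp
      qed
    qed auto
    also have "\<dots> = (\<Sum>x\<in>?S. (2 * h) * (d x * (m x)\<^sup>2 * (f x)\<^sup>2) + (2 * (h + c2)) * ((m x)\<^sup>2 * (f x)\<^sup>2))"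
      by (intro sum.cong refl) (simp add: algebra_simps)
    also have "\<dots> = (2 * h) * (\<Sum>x\<in>?S. d x * (m x)\<^sup>2 * (f x)\<^sup>2) + (2 * (h + c2)) * (\<Sum>x\<in>?S. (m x)\<^sup>2 * (f x)\<^sup>2)"
      by (simp only: sum.distrib sum_distrib_left)
    finally have b3: "(\<Sum>x\<in>?S. (2 * ?L x + \<bar>V x\<bar>) * (m x)\<^sup>2 * (f x)\<^sup>2)
        \<le> (2 * h) * ((norm F)\<^sup>2 - (norm (P F))\<^sup>2) + (2 * (h + c2)) * (norm (P F))\<^sup>2"
      unfolding D[symmetric] nPF[symmetric] .
    have "\<bar>inner (A F) F - ((norm F)\<^sup>2 - (norm (P F))\<^sup>2)\<bar>
        \<le> (h * ((norm F)\<^sup>2 - (norm (P F))\<^sup>2) + c1 * (norm (P F))\<^sup>2)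
          + ((2 * h) * ((norm F)\<^sup>2 - (norm (P F))\<^sup>2) + (2 * (h + c2)) * (norm (P F))\<^sup>2)"
      using b0 b1 b2 b3 offE[folded D nPF] by linarith
    then show ?thesis unfolding c_def eps3 by (simp only: distrib_right add.assoc add.left_commute)
  qed
  have "\<bar>inner (A F) F - ((norm F)\<^sup>2 - (norm (P F))\<^sup>2)\<bar>
      \<le> eps * ((norm F)\<^sup>2 - (norm (P F))\<^sup>2) + c * (norm (P F))\<^sup>2" for F
  proof -
    obtain u where u: "\<And>n. finite {x. coord (u n) x \<noteq> 0}" "u \<longlonglongrightarrow> F" by (rule finite_support_dense[of F]) blast
    show ?thesis
    proof (rule LIMSEQ_le)
      show "(\<lambda>n. \<bar>inner (A (u n)) (u n) - ((norm (u n))\<^sup>2 - (norm (P (u n)))\<^sup>2)\<bar>)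
          \<longlonglongrightarrow> \<bar>inner (A F) F - ((norm F)\<^sup>2 - (norm (P F))\<^sup>2)\<bar>"
        by (intro tendsto_intros A'.tendsto P'.tendsto u)
      show "(\<lambda>n. eps * ((norm (u n))\<^sup>2 - (norm (P (u n)))\<^sup>2) + c * (norm (P (u n)))\<^sup>2)
          \<longlonglongrightarrow> eps * ((norm F)\<^sup>2 - (norm (P F))\<^sup>2) + c * (norm (P F))\<^sup>2"
        by (intro tendsto_intros P'.tendsto u)
    qed (use finite_case u in auto)
  qed
  then show ?thesis using c0 by blast
qed

end

text \<open>The potential is the same on both sides, so the phases factor out and off-diagonal
  entries differ only by \<open>\<bar>E - E0\<bar>\<close>. The row bound is then twice the quotient
  in \<open>lim\<close>, which decays.\<close>

lemma ccont_form_difference: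
  fixes E :: "'v::countable \<Rightarrow> 'v \<Rightarrow> real"
  assumes g: "graph_form E m th V d K" and g0: "graph_form E0 m th (\<lambda>_. 0) d K0"
    and le: "\<And>x. \<bar>V x\<bar> + Lambda E E0 m x \<le> M0 * (1 + d x)"
    and lim: "((\<lambda>x. (\<bar>V x\<bar> + Lambda E E0 m x) / (1 + d x)) \<longlongrightarrow> 0) cofinite"
  shows "ccont (\<lambda>F. graph_form.A E m th V d F - graph_form.A E0 m th (\<lambda>_. 0) d F)"
proof -
  interpret g: graph_form E m th V d K by fact
  interpret g0: graph_form E0 m th "\<lambda>_. 0" d K0 by fact
  let ?L = "Lambda E E0 m"
  let ?k = "\<lambda>x y. g.ke x y - g0.ke x y"
  let ?e = "\<lambda>x y. (if x = y then (\<bar>V x\<bar> + ?L x) * (m x)\<^sup>2 else 0) + \<bar>E x y - E0 x y\<bar>"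
  let ?M = "\<lambda>x. 2 * ((\<bar>V x\<bar> + ?L x) / (1 + d x))"
  interpret k: schur_kernel ?k ?e g.w ?M "2 * M0"
  proof
    fix x y
    show "0 < g.w x" by (rule g.w0)
    show "?e x y = ?e y x" using g.E_sym[of x y] g0.E_sym[of x y] by auto
    show "0 \<le> ?e x y" using Lambda_nonneg[of E E0 m x] by auto
    have sub: "{y. ?e x y \<noteq> 0} \<subseteq> insert x ({y. adj E x y} \<union> {y. adj E0 x y})" by (auto simp: adj_def)
    show f: "finite {y. ?e x y \<noteq> 0}" by (rule finite_subset[OF sub]) (simp add: g.fin g0.fin)
    have "(\<Sum>y\<in>S. ?e x y) \<le> ?M x * (g.w x)\<^sup>2" if S: "finite S" for S
    proof -
      have 1: "(\<Sum>y\<in>S. if x = y then (\<bar>V x\<bar> + ?L x) * (m x)\<^sup>2 else 0) \<le> (\<bar>V x\<bar> + ?L x) * (m x)\<^sup>2"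
        using Lambda_nonneg[of E E0 m x] by (subst sum.delta'[OF S]) auto
      have 2: "(\<Sum>y\<in>S. \<bar>E x y - E0 x y\<bar>) \<le> ?L x * (m x)\<^sup>2"
        by (rule sum_diff_le_Lambda[of m x E E0, OF g.m0 g.fin g0.fin S])
      have 3: "?L x * (m x)\<^sup>2 \<le> (\<bar>V x\<bar> + ?L x) * (m x)\<^sup>2" by (rule mult_right_mono) auto
      have 4: "?M x * (g.w x)\<^sup>2 = 2 * ((\<bar>V x\<bar> + ?L x) * (m x)\<^sup>2)" using g.d1[of x] by (simp add: g.wsq)
      show ?thesis unfolding sum.distrib 4 using 1 2 3 by linarith
    qed
    then show "(\<Sum>y\<in>{y. ?e x y \<noteq> 0}. ?e x y) \<le> ?M x * (g.w x)\<^sup>2" using f by blast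
    show "?M x \<le> 2 * M0" using le[of x] g.d1[of x] by (simp add: divide_le_eq)
    have "?k x y = ((if x = y then of_real ((wdeg E m x - wdeg E0 m x + V x) * (m x)\<^sup>2) else 0)
        - of_real (E x y - E0 x y) * cis (th x y)) / of_real (g.w x * g.w y)"
    proof -
      have num: "(if x = y then of_real ((wdeg E m x + V x) * (m x)\<^sup>2) else 0) - of_real (E x y) * cis (th x y)
          - ((if x = y then of_real ((wdeg E0 m x + 0) * (m x)\<^sup>2) else 0) - of_real (E0 x y) * cis (th x y))
        = (if x = y then of_real ((wdeg E m x - wdeg E0 m x + V x) * (m x)\<^sup>2) else 0)
          - complex_of_real (E x y - E0 x y) * cis (th x y)"
        by (cases "x = y") (simp_all add: algebra_simps)
      show ?thesis by (simp only: g.ke_def g0.ke_def diff_divide_distrib[symmetric] num)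
    qed
    then have "cmod (?k x y) = cmod ((if x = y then of_real ((wdeg E m x - wdeg E0 m x + V x) * (m x)\<^sup>2) else 0)
        - of_real (E x y - E0 x y) * cis (th x y)) / (g.w x * g.w y)"
      using g.w0[of x] g.w0[of y] by (simp only: norm_divide norm_of_real abs_mult abs_of_pos)
    also have "\<dots> \<le> ?e x y / (g.w x * g.w y)"
    proof (rule divide_right_mono)
      have "cmod ((if x = y then of_real ((wdeg E m x - wdeg E0 m x + V x) * (m x)\<^sup>2) else 0)
          - of_real (E x y - E0 x y) * cis (th x y))
        \<le> cmod (if x = y then of_real ((wdeg E m x - wdeg E0 m x + V x) * (m x)\<^sup>2) else 0)
          + cmod (of_real (E x y - E0 x y) * cis (th x y))" by (rule norm_triangle_ineq4)
      also have "cmod (of_real (E x y - E0 x y) * cis (th x y)) = \<bar>E x y - E0 x y\<bar>"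
        by (simp only: norm_mult norm_of_real norm_cis mult_1_right)
      also have "cmod (if x = y then of_real ((wdeg E m x - wdeg E0 m x + V x) * (m x)\<^sup>2) else 0)
          \<le> (if x = y then (\<bar>V x\<bar> + ?L x) * (m x)\<^sup>2 else 0)"
      proof -
        have "\<bar>wdeg E m x - wdeg E0 m x + V x\<bar> \<le> \<bar>V x\<bar> + ?L x"
          using wdeg_diff_le_Lambda[of m x E E0, OF g.m0 g.fin g0.fin] by linarith
        then have "\<bar>(wdeg E m x - wdeg E0 m x + V x) * (m x)\<^sup>2\<bar> \<le> (\<bar>V x\<bar> + ?L x) * (m x)\<^sup>2"
          unfolding abs_mult by (intro mult_mono) auto
        then show ?thesis by (simp only: norm_of_real norm_zero split: if_split) simp
      qed
      finally show "cmod ((if x = y then of_real ((wdeg E m x - wdeg E0 m x + V x) * (m x)\<^sup>2) else 0)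
          - of_real (E x y - E0 x y) * cis (th x y)) \<le> ?e x y" by simp
    qed (use g.w0[of x] g.w0[of y] in simp)
    finally show "cmod (?k x y) \<le> ?e x y / (g.w x * g.w y)" .
  qed
  have "g.A F - g0.A F = kop ?k F" for F
  proof (rule l2_eqI)
    fix x
    let ?N = "insert x ({y. adj E x y} \<union> {y. adj E0 x y})"
    have N: "finite ?N" using g.fin g0.fin by simp
    have "coord (g.A F) x = (\<Sum>y\<in>?N. g.ke x y * coord F y)"
      unfolding g.A_def g.A.coord_kop by (rule sum.mono_neutral_left) (use N in \<open>auto simp: g.ke_def adj_def\<close>)
    moreover have "coord (g0.A F) x = (\<Sum>y\<in>?N. g0.ke x y * coord F y)"
      unfolding g0.A_def g0.A.coord_kop by (rule sum.mono_neutral_left) (use N in \<open>auto simp: g0.ke_def adj_def\<close>)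
    moreover have "coord (kop ?k F) x = (\<Sum>y\<in>?N. ?k x y * coord F y)"
      unfolding k.coord_kop by (rule sum.mono_neutral_left) (use N in \<open>auto simp: g.ke_def g0.ke_def adj_def\<close>)
    ultimately show "coord (g.A F - g0.A F) x = coord (kop ?k F) x"
      by (simp add: sum_subtractf left_diff_distrib)
  qed
  moreover have "ccont (kop ?k)"
    by (rule k.ccont_kop) (use tendsto_mult_right_zero[OF lim, of 2] in simp)
  ultimately show ?thesis by simp
qed

subsection \<open>Gauge invariance\<close>

definition umul :: "('v \<Rightarrow> complex) \<Rightarrow> 'v l2 \<Rightarrow> 'v l2" where
  "umul u F = Abs_l2 (\<lambda>x. u x * coord F x)"

lemma coord_umul: "(\<And>x. cmod (u x) = 1) \<Longrightarrow> coord (umul u F) x = u x * coord F x"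
  unfolding umul_def using coord_summable[of F] by (subst coord_Abs_l2) (simp_all add: norm_mult)

lemma norm_umul: "(\<And>x. cmod (u x) = 1) \<Longrightarrow> norm (umul u F) = norm F"
proof -
  assume u: "\<And>x. cmod (u x) = 1"
  have "(norm (umul u F))\<^sup>2 = (norm F)\<^sup>2"
    unfolding norm_l2_sq by (rule infsum_cong) (simp add: coord_umul[OF u] norm_mult u)
  then show ?thesis by simp
qed

text \<open>Multiplication by the phases \<open>u\<close> is unitary, commutes with \<open>P\<close>
  and intertwines the two forms, hence the two resolvents; it also preserves weakly null
  sequences.\<close>

lemma weyl_gauge:
  assumes f0: "coercive_form E m th0 V d K C c" and f1: "coercive_form E m th V d K C c'"
    and u: "\<And>x. cmod (u x) = 1"
    and gauge: "\<And>x y. adj E x y \<Longrightarrow> u x = cis (th x y - th0 x y) * u y"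
    and weyl: "weyl (pres (graph_form.P d) (coercive_form.B E m th0 V d C)) t"
  shows "weyl (pres (graph_form.P d) (coercive_form.B E m th V d C)) t"
proof -
  interpret f0: coercive_form E m th0 V d K C c by fact
  interpret f1: coercive_form E m th V d K C c' by fact
  let ?U = "umul u"
  note cU = coord_umul[of u, OF u] and nU = norm_umul[of u, OF u]
  have PU: "f0.P (?U F) = ?U (f0.P F)" for F by (rule l2_eqI) (simp add: f0.coord_P cU)
  have U_diff: "?U (F - G) = ?U F - ?U G" and U_add: "?U (F + G) = ?U F + ?U G"
    and U_sc: "?U (r *\<^sub>R F) = r *\<^sub>R ?U F" for F G r
    by (rule l2_eqI, simp add: cU algebra_simps)+
  have ke: "f1.ke x y * u y = u x * f0.ke x y" for x y
  proof (cases "x = y")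
    case True
    then show ?thesis by (simp add: f0.ke_def f1.ke_def f0.E_diag mult.commute)
  next
    case False
    show ?thesis
    proof (cases "adj E x y")
      case True
      have "cis (th x y) * u y = cis (th0 x y) * (cis (th x y - th0 x y) * u y)" by (simp add: cis_mult flip: mult.assoc)
      also have "\<dots> = cis (th0 x y) * u x" using gauge[OF True] by simp
      finally have "cis (th x y) * u y = cis (th0 x y) * u x" .
      then show ?thesis using False by (simp add: f0.ke_def f1.ke_def)
    qed (use False in \<open>simp add: f0.ke_def f1.ke_def adj_def\<close>)
  qed
  have AU: "f1.A (?U F) = ?U (f0.A F)" for F
  proof (rule l2_eqI)
    fix x
    let ?N = "insert x {y. adj E x y}"
    have N: "finite ?N" using f0.fin by simp
    have "coord (f1.A (?U F)) x = (\<Sum>y\<in>?N. f1.ke x y * (u y * coord F y))"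
      unfolding f1.A_def f1.A.coord_kop cU
      by (rule sum.mono_neutral_left) (use N in \<open>auto simp: f1.ke_def adj_def\<close>)
    also have "\<dots> = (\<Sum>y\<in>?N. u x * (f0.ke x y * coord F y))"
      by (intro sum.cong refl) (metis ke mult.assoc)
    also have "\<dots> = u x * (\<Sum>y\<in>?N. f0.ke x y * coord F y)" by (simp only: sum_distrib_left)
    also have "(\<Sum>y\<in>?N. f0.ke x y * coord F y) = coord (f0.A F) x"
      unfolding f0.A_def f0.A.coord_kop
      by (rule sum.mono_neutral_right) (use N in \<open>auto simp: f0.ke_def adj_def\<close>)
    finally show "coord (f1.A (?U F)) x = coord (?U (f0.A F)) x" by (simp add: cU)
  qed
  have BU: "f1.B (?U F) = ?U (f0.B F)" for F
    unfolding f0.B_def f1.B_def by (simp add: AU PU U_add U_sc)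
  have "inv f1.B (?U F) = ?U (inv f0.B F)" for F
    using BU[of "inv f0.B F"] f1.p.inv_B[of "?U (inv f0.B F)"] by simp
  then have TU: "pres f0.P f1.B (?U F) = ?U (pres f0.P f0.B F)" for F
    by (simp add: pres_def PU)
  obtain f where f: "\<And>n. norm (f n) = 1" "wnull f" "(\<lambda>n. pres f0.P f0.B (f n) - t *\<^sub>R f n) \<longlonglongrightarrow> 0"
    using weyl unfolding weyl_def by blast
  show ?thesis
    unfolding weyl_def
  proof (intro exI[of _ "\<lambda>n. ?U (f n)"] conjI allI)
    show "norm (?U (f n)) = 1" for n by (simp add: nU f(1))
    show "wnull (\<lambda>n. ?U (f n))"
      unfolding wnull_def
    proof (intro conjI exI[of _ 1] allI)
      show "norm (?U (f n)) \<le> 1" for n by (simp add: nU f(1))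
      show "(\<lambda>n. coord (?U (f n)) x) \<longlonglongrightarrow> 0" for x
        unfolding cU using f(2) unfolding wnull_def by (intro tendsto_mult_right_zero) blast
    qed
    have "(\<lambda>n. norm (pres f0.P f1.B (?U (f n)) - t *\<^sub>R ?U (f n))) \<longlonglongrightarrow> 0"
      unfolding TU U_sc[symmetric] U_diff[symmetric] nU by (rule tendsto_norm_zero[OF f(3)])
    then show "(\<lambda>n. pres f0.P f1.B (?U (f n)) - t *\<^sub>R ?U (f n)) \<longlonglongrightarrow> 0"
      by (rule tendsto_norm_zero_cancel)
  qed
qed

section \<open>Square root, essential spectrum and eigenvalues\<close>

context coercive_form
begin

abbreviation "T \<equiv> pres P B"

sublocale r: resolvent_op m T C
  by unfold_locales (rule m0 p.bsym_pres p.clinear_pres)+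

lemma range_P_iff:
  assumes f: "f \<in> ell2 m"
  shows "iota m f \<in> range P \<longleftrightarrow> f \<in> ell2 w"
proof
  assume "iota m f \<in> range P"
  then obtain G where "iota m f = P G" by blast
  then have "iota m f = iota m (unio w G)" by (metis P_iota iota_unio unio_in w0)
  then have "f = unio w G" by (intro iota_inject[OF m0 f ell2_w_subset]) (auto simp: w0)
  then show "f \<in> ell2 w" by (simp add: w0)
qed (use P_iota in \<open>metis rangeI\<close>)

lemma op_dom_sqrt_mult: "op_dom (mult_op m (\<lambda>x. sqrt (d x))) = ell2 w"
proof -
  have wq: "(w x)\<^sup>2 * (cmod (f x))\<^sup>2 = (m x)\<^sup>2 * (cmod (f x))\<^sup>2 + (m x)\<^sup>2 * (cmod (of_real (sqrt (d x)) * f x))\<^sup>2" for f x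
    using d0[of x] by (simp add: wsq norm_mult power_mult_distrib algebra_simps)
  have "(\<lambda>x. (w x)\<^sup>2 * (cmod (f x))\<^sup>2) summable_on UNIV \<longleftrightarrow>
     (\<lambda>x. (m x)\<^sup>2 * (cmod (f x))\<^sup>2) summable_on UNIV \<and> (\<lambda>x. (m x)\<^sup>2 * (cmod (of_real (sqrt (d x)) * f x))\<^sup>2) summable_on UNIV" for f
  proof
    assume w: "(\<lambda>x. (w x)\<^sup>2 * (cmod (f x))\<^sup>2) summable_on UNIV"
    show "(\<lambda>x. (m x)\<^sup>2 * (cmod (f x))\<^sup>2) summable_on UNIV \<and> (\<lambda>x. (m x)\<^sup>2 * (cmod (of_real (sqrt (d x)) * f x))\<^sup>2) summable_on UNIV"
      by (intro conjI; rule summable_on_comparison_test[OF w]; simp add: wq)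
  next
    assume "(\<lambda>x. (m x)\<^sup>2 * (cmod (f x))\<^sup>2) summable_on UNIV \<and> (\<lambda>x. (m x)\<^sup>2 * (cmod (of_real (sqrt (d x)) * f x))\<^sup>2) summable_on UNIV"
    then show "(\<lambda>x. (w x)\<^sup>2 * (cmod (f x))\<^sup>2) summable_on UNIV" unfolding wq by (intro summable_on_add) auto
  qed
  then show ?thesis unfolding op_dom_def mult_op_def ell2_def by auto
qed

text \<open>The root of the shifted operator is the inverse of \<open>R\<close>, the root of its
  resolvent, so its domain is the range of \<open>R\<close>. The squared norm of \<open>R x\<close>
  is the form of \<open>inv B\<close> at \<open>P x\<close> and hence comparable with that of
  \<open>P x\<close>; the range inclusion lemma applies in both directions.\<close>

lemma sqrt_exists:
  assumes low: "\<And>F. (norm (P F))\<^sup>2 \<le> inner (B F) F"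
  shows "\<exists>S. op_sqrt m S (op_shift (friedrichs m s) C) \<and> op_dom S = op_dom (mult_op m (\<lambda>x. sqrt (d x)))"
proof -
  \<comment> \<open>At \<open>inv B (P x)\<close> the hypothesis says that the squared norm of
    \<open>T x\<close> is at most \<open>inner (T x) x\<close>, so \<open>T\<close> is a
    contraction, as the square root iteration requires.\<close>
  have T_le: "inner (T x) x \<le> (norm x)\<^sup>2" for x
  proof -
    let ?G = "inv B (P x)"
    have "(norm (T x))\<^sup>2 \<le> inner (T x) x"
      using low[of ?G] by (simp add: pres_def bsymD[OF bsym_P] inner_commute)
    also have "\<dots> \<le> norm (T x) * norm x" by (rule norm_cauchy_schwarz)
    finally have "norm (T x) * norm (T x) \<le> norm (T x) * norm x" by (simp add: power2_eq_square)
    then have "norm (T x) \<le> norm x" by (cases "T x = 0") (auto dest: mult_left_le_imp_le)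
    then have "norm (T x) * norm x \<le> norm x * norm x" by (rule mult_right_mono) simp
    then show ?thesis using norm_cauchy_schwarz[of "T x" x] by (simp add: power2_eq_square)
  qed
  obtain R where R: "bsym R" "\<And>x. 0 \<le> inner (R x) x" "\<And>x. R (R x) = T x"
    and comm: "\<And>U x. bounded_linear U \<Longrightarrow> (\<And>x. U (T x) = T (U x)) \<Longrightarrow> U (R x) = R (U x)"
    by (rule bsym_sqrt[OF p.bsym_pres p.inner_pres_nonneg T_le]) (rule that, assumption+, blast)
  have Rc: "R (cscale z x) = cscale z (R x)" for z x
    by (rule comm[OF bounded_linear_cscale, symmetric]) (simp add: r.T_cscale)
  have cipR: "cip (R x) y = cip x (R y)" for x y
  proof (rule complex_eqI)
    show "Re (cip (R x) y) = Re (cip x (R y))" unfolding Re_cip by (rule bsymD[OF R(1)])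
    show "Im (cip (R x) y) = Im (cip x (R y))"
      unfolding Im_cip Rc[symmetric] by (rule bsymD[OF R(1)])
  qed
  define S where "S f g \<longleftrightarrow> f \<in> ell2 m \<and> g \<in> ell2 m \<and> iota m f = R (iota m g)" for f g
  have nR: "(norm (R x))\<^sup>2 = inner (inv B (P x)) (P x)" for x
    unfolding p.inner_pres[symmetric] R(3)[symmetric] by (simp add: bsymD[OF R(1)] power2_norm_eq_inner)
  obtain M where M: "0 < M" "\<And>x. norm (inv B x) \<le> M * norm x" using bsym_bound[OF p.bsym_invB] by blast
  obtain M' where M': "0 < M'" "\<And>x. norm (B x) \<le> M' * norm x" using bsym_bound[OF p.B(1)] by blast
  have "norm (R x) \<le> sqrt M * norm (P x)" for x
  proof (rule power2_le_imp_le)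
    have "(norm (R x))\<^sup>2 \<le> norm (inv B (P x)) * norm (P x)" unfolding nR by (rule norm_cauchy_schwarz)
    also have "\<dots> \<le> (M * norm (P x)) * norm (P x)" by (intro mult_right_mono M) auto
    finally have le: "(norm (R x))\<^sup>2 \<le> (M * norm (P x)) * norm (P x)" .
    show "(norm (R x))\<^sup>2 \<le> (sqrt M * norm (P x))\<^sup>2"
    proof -
      have "(sqrt M)\<^sup>2 = M" using M(1) by simp
      then have "(sqrt M * norm (P x))\<^sup>2 = (M * norm (P x)) * norm (P x)"
        unfolding power_mult_distrib by (simp only: power2_eq_square[of "norm (P x)"] mult.assoc)
      then show ?thesis using le by simp
    qed
  qed (use M in simp)
  then have 1: "range R \<subseteq> range P" by (rule bsym_range_subset[OF R(1) bsym_P])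
  have "norm (P x) \<le> (M' / sqrt c) * norm (R x)" for x
  proof (rule power2_le_imp_le)
    let ?h = "inv B (P x)"
    have "norm (P x) \<le> M' * norm ?h" using M'(2)[of ?h] by simp
    then have "(norm (P x))\<^sup>2 \<le> (M' * norm ?h)\<^sup>2" by (rule power_mono) simp
    also have "\<dots> = (M'\<^sup>2 / c) * (c * (norm ?h)\<^sup>2)" using c by (simp add: power_mult_distrib)
    also have "\<dots> \<le> (M'\<^sup>2 / c) * inner (B ?h) ?h" using c by (intro mult_left_mono p.coer) auto
    also have "inner (B ?h) ?h = (norm (R x))\<^sup>2" unfolding nR by (simp add: inner_commute)
    also have "(M'\<^sup>2 / c) * (norm (R x))\<^sup>2 = ((M' / sqrt c) * norm (R x))\<^sup>2"
      using c by (simp add: power_mult_distrib power_divide)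
    finally show "(norm (P x))\<^sup>2 \<le> ((M' / sqrt c) * norm (R x))\<^sup>2" .
  qed (use M' c in simp)
  then have 2: "range P \<subseteq> range R" by (rule bsym_range_subset[OF bsym_P R(1)])
  have dom: "op_dom S = op_dom (mult_op m (\<lambda>x. sqrt (d x)))"
  proof -
    have "f \<in> op_dom S \<longleftrightarrow> f \<in> ell2 m \<and> iota m f \<in> range R" for f
    proof
      assume "f \<in> op_dom S"
      then show "f \<in> ell2 m \<and> iota m f \<in> range R" unfolding op_dom_def S_def by auto
    next
      assume R: "f \<in> ell2 m \<and> iota m f \<in> range R"
      then obtain G where "iota m f = R G" by blast
      then have "S f (unio m G)" unfolding S_def using R by (simp add: m0)
      then show "f \<in> op_dom S" unfolding op_dom_def by blast
    qed
    note domS = this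
    have eqR: "range R = range P" by (rule equalityI[OF 1 2])
    have "op_dom S = ell2 w"
    proof (rule set_eqI)
      fix f show "f \<in> op_dom S \<longleftrightarrow> f \<in> ell2 w"
        unfolding domS eqR using range_P_iff[of f] ell2_w_subset[of f] by blast
    qed
    then show ?thesis by (simp add: op_dom_sqrt_mult)
  qed
  have sa: "self_adjoint_op m S"
    unfolding self_adjoint_op_def op_adjoint_def
  proof (intro allI iffI)
    fix f g assume "S f g"
    then have fg: "f \<in> ell2 m" "g \<in> ell2 m" "iota m f = R (iota m g)" by (auto simp: S_def)
    have "ell2_ip m a f = ell2_ip m u g" if "S u a" for u a
      using that fg by (simp add: S_def ell2_ip_eq cipR)
    then show "f \<in> ell2 m \<and> g \<in> ell2 m \<and> (\<forall>u a. S u a \<longrightarrow> ell2_ip m a f = ell2_ip m u g)" using fg by blast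
  next
    fix f g assume A: "f \<in> ell2 m \<and> g \<in> ell2 m \<and> (\<forall>u a. S u a \<longrightarrow> ell2_ip m a f = ell2_ip m u g)"
    \<comment> \<open>Every vector \<open>X\<close> occurs as a value of \<open>S\<close>, namely at
      \<open>R X\<close>, so the adjoint relation can be tested against all of the space.\<close>
    have "cip X (iota m f) = cip X (R (iota m g))" for X
    proof -
      have "S (unio m (R X)) (unio m X)" unfolding S_def by (simp add: m0)
      then have "ell2_ip m (unio m X) f = ell2_ip m (unio m (R X)) g" using A by blast
      then show ?thesis using A by (simp add: ell2_ip_eq m0 cipR)
    qed
    then have "iota m f = R (iota m g)" by (rule cip_ext)
    then show "S f g" using A by (simp add: S_def)
  qed
  have pos: "0 \<le> Re (ell2_ip m f g)" if "S f g" for f g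
    using that R(2) by (simp add: S_def ell2_ip_eq Re_cip)
  have sq: "op_shift (friedrichs m s) C f g \<longleftrightarrow> (\<exists>h. S f h \<and> S h g)" for f g
  proof -
    have "op_shift (friedrichs m s) C f g \<longleftrightarrow> f \<in> ell2 m \<and> g \<in> ell2 m \<and> iota m f = T (iota m g)"
    proof -
      have iff: "g - smul (of_real C) f \<in> ell2 m \<longleftrightarrow> g \<in> ell2 m" if f: "f \<in> ell2 m"
      proof
        assume "g - smul (of_real C) f \<in> ell2 m"
        from ell2_diff[OF this ell2_smul[OF f]]
        have "(g - smul (of_real C) f) - smul (- of_real C) f \<in> ell2 m" .
        moreover have eq: "(g - smul (of_real C) f) - smul (- of_real C) f = g"
          by (simp add: fun_eq_iff smul_def)
        ultimately show "g \<in> ell2 m" by (simp only: eq)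
      next
        assume "g \<in> ell2 m"
        then show "g - smul (of_real C) f \<in> ell2 m" using f by (intro ell2_diff ell2_smul)
      qed
      show ?thesis
      proof (cases "f \<in> ell2 m \<and> g \<in> ell2 m")
        case True
        then show ?thesis
          unfolding op_shift_def friedrichs_eq_opT opT_def
          by (simp add: iff iota_diff ell2_smul iota_smul cscale_of_real)
      qed (use iff in \<open>auto simp: op_shift_def friedrichs_eq_opT opT_def\<close>)
    qed
    also have "\<dots> \<longleftrightarrow> (\<exists>h. S f h \<and> S h g)"
    proof
      assume A: "f \<in> ell2 m \<and> g \<in> ell2 m \<and> iota m f = T (iota m g)"
      then have "S f (unio m (R (iota m g))) \<and> S (unio m (R (iota m g))) g"
        unfolding S_def by (simp add: m0 R(3))
      then show "\<exists>h. S f h \<and> S h g" by blast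
    qed (auto simp: S_def R(3))
    finally show ?thesis .
  qed
  show ?thesis using sa pos sq dom unfolding op_sqrt_def by blast
qed

lemma ccont_P:
  assumes "filterlim d at_top cofinite"
  shows "ccont P"
  unfolding P_def
proof (rule ccont_dmul[OF P_weight])
  have "filterlim (\<lambda>x. 1 + d x) at_top cofinite"
    by (rule filterlim_tendsto_add_at_top[OF tendsto_const assms])
  then have "filterlim (\<lambda>x. sqrt (1 + d x)) at_top cofinite" by (rule filterlim_compose[OF sqrt_at_top])
  then show "((\<lambda>x. 1 / sqrt (1 + d x)) \<longlongrightarrow> 0) cofinite"
    by (rule real_tendsto_divide_at_top[OF tendsto_const])
qed

text \<open>If the degree stays below some \<open>Z\<close> at infinitely many vertices, the form of
  \<open>T\<close> is bounded below on their basis vectors, and \<open>weyl_exists\<close> applies.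
  Otherwise \<open>P\<close> and hence \<open>T\<close> are completely continuous.\<close>

lemma ess_spectrum_empty_iff_degree:
  "op_ess_spectrum m (friedrichs m s) = {} \<longleftrightarrow> filterlim d at_top cofinite"
proof
  assume e: "op_ess_spectrum m (friedrichs m s) = {}"
  show "filterlim d at_top cofinite"
  proof (rule ccontr)
    assume "\<not> filterlim d at_top cofinite"
    then obtain Z where "\<not> (\<forall>\<^sub>F x in cofinite. Z \<le> d x)" unfolding filterlim_at_top by blast
    then have inf: "infinite {x. \<not> Z \<le> d x}" by (simp add: eventually_cofinite)
    obtain M' where M': "0 < M'" "\<And>x. norm (B x) \<le> M' * norm x" using bsym_bound[OF p.B(1)] by blast
    have Z: "0 < 1 + Z" using inf d0 by (metis (mono_tags, lifting) Collect_empty_eq add_nonneg_pos add.commute finite.emptyI less_eq_real_def not_le order_trans zero_less_one)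
    have "1 / (M' * (1 + Z)) \<le> inner (T (basis x)) (basis x)" if x: "x \<in> {x. \<not> Z \<le> d x}" for x
    proof -
      \<comment> \<open>Normalised so that \<open>P G\<close> is the basis vector; its squared norm
        \<open>1 + d x\<close> is at most \<open>1 + Z\<close>.\<close>
      define G where "G = sqrt (1 + d x) *\<^sub>R basis x"
      have PG: "P G = basis x"
        using d1[of x] by (intro l2_eqI) (simp add: coord_P G_def)
      have nG: "(norm G)\<^sup>2 = 1 + d x" using d1[of x] by (simp add: G_def power_mult_distrib)
      have "inner (B G) G \<le> norm (B G) * norm G" by (rule norm_cauchy_schwarz)
      also have "\<dots> \<le> M' * norm G * norm G" by (intro mult_right_mono M') auto
      also have "\<dots> = M' * (norm G)\<^sup>2" by (simp add: power2_eq_square)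
      also have "\<dots> \<le> M' * (1 + Z)" unfolding nG using x M' by (intro mult_left_mono) auto
      finally have BG: "inner (B G) G \<le> M' * (1 + Z)" .
      have "1 \<le> inner (T (basis x)) (basis x) * inner (B G) G"
        using p.norm_P_pow4_le[of G] by (simp add: PG)
      also have "\<dots> \<le> inner (T (basis x)) (basis x) * (M' * (1 + Z))"
        by (intro mult_left_mono BG p.inner_pres_nonneg)
      finally show ?thesis using mult_pos_pos[OF M'(1) Z] by (simp only: pos_divide_le_eq)
    qed
    then obtain b where "b > 0" "weyl T b"
      using weyl_exists[OF p.bsym_pres _ inf, of "1 / (M' * (1 + Z))"] M' Z by auto
    then have "b \<noteq> 0" "weyl T b" by auto
    then show False using e unfolding friedrichs_eq_opT r.ess_spectrum_empty_iff by blast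
  qed
next
  assume "filterlim d at_top cofinite"
  then have "ccont P" by (rule ccont_P)
  then have "ccont T" by (rule p.ccont_pres)
  then show "op_ess_spectrum m (friedrichs m s) = {}"
    unfolding friedrichs_eq_opT r.ess_spectrum_empty_iff using not_weyl_if_ccont by blast
qed

end

section \<open>Multiplication by the degree\<close>

context graph_form
begin

lemma inv_ident: "inv (\<lambda>x::'b. x) = (\<lambda>x. x)"
  using inv_id unfolding id_def .

text \<open>Multiplication by \<open>d\<close> fits the same scheme with the identity in place of
  \<open>B\<close> and shift 1: its resolvent is \<open>P\<close> applied twice, that is,
  multiplication by \<open>1 / (1 + d)\<close>.\<close>

sublocale pd: pencil P "\<lambda>x. x" 1
proof unfold_locales
  show "bsym P" "clinear_op P" by (rule bsym_P clinear_P)+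
  show "bsym (\<lambda>x :: 'v l2. x)" by (simp add: bsym_def bounded_linear_ident)
  show "clinear_op (\<lambda>x :: 'v l2. x)" by (simp add: clinear_op_def)
qed (simp_all add: dot_square_norm)

sublocale rd: resolvent_op m "pres P (\<lambda>x. x)" 1
  by unfold_locales (rule m0 pd.bsym_pres pd.clinear_pres)+

lemma coord_pres_ident: "coord (pres P (\<lambda>x. x) F) x = coord F x / of_real (1 + d x)"
proof -
  have "complex_of_real (sqrt (1 + d x)) * complex_of_real (sqrt (1 + d x)) = of_real (1 + d x)"
    using d1[of x] by (simp only: of_real_mult[symmetric]) simp
  then show ?thesis by (simp add: pres_def inv_ident coord_P)
qed

lemma mult_op_eq_opT: "mult_op m d = opT m (pres P (\<lambda>x. x)) 1"
proof (intro ext)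
  fix f g
  have "g = (\<lambda>x. of_real (d x) * f x) \<longleftrightarrow> iota m f = pres P (\<lambda>x. x) (iota m g + 1 *\<^sub>R iota m f)"
    if f: "f \<in> ell2 m" and g: "g \<in> ell2 m"
  proof -
    have "coord (iota m f) x = coord (pres P (\<lambda>x. x) (iota m g + 1 *\<^sub>R iota m f)) x \<longleftrightarrow> g x = of_real (d x) * f x" for x
    proof -
      have mn: "complex_of_real (m x) \<noteq> 0" and dn: "complex_of_real (1 + d x) \<noteq> 0"
        using m0[of x] d1[of x] by (simp_all del: of_real_add)
      have "coord (iota m f) x = coord (pres P (\<lambda>x. x) (iota m g + 1 *\<^sub>R iota m f)) x
          \<longleftrightarrow> of_real (m x) * f x = of_real (m x) * (g x + f x) / of_real (1 + d x)"
        by (simp add: coord_pres_ident coord_iota f g distrib_left)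
      also have "\<dots> \<longleftrightarrow> of_real (m x) * (f x * of_real (1 + d x)) = of_real (m x) * (g x + f x)"
        using dn by (simp only: eq_divide_eq mult.assoc) simp
      also have "\<dots> \<longleftrightarrow> g x = of_real (d x) * f x"
        using mn by (auto simp: algebra_simps)
      finally show ?thesis .
    qed
    then show ?thesis using l2_eqI by (metis (mono_tags, lifting) ext)
  qed
  then show "mult_op m d f g = opT m (pres P (\<lambda>x. x)) 1 f g" unfolding mult_op_def opT_def by blast
qed

lemma degree_eigenfamily_exists:
  assumes inf: "infinite (UNIV :: 'v set)"
  shows "\<exists>mu U. 0 < mu + 1 \<and> eigenfamily (pres P (\<lambda>x. x)) (1 / (mu + 1)) N U"
proof -
  obtain e :: "nat \<Rightarrow> 'v" where e: "inj e" using infinite_countable_subset[OF inf] by blast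
  \<comment> \<open>A convenient common upper bound for \<open>N\<close> degrees; only its existence
    matters.\<close>
  define mu where "mu = (\<Sum>i<N. d (e i))"
  have mu0: "0 \<le> mu" unfolding mu_def by (intro sum_nonneg d0)
  have le: "d (e i) \<le> mu" if "i < N" for i
    unfolding mu_def using that d0 by (intro member_le_sum[of i "{..<N}" "\<lambda>i. d (e i)"]) auto
  have "eigenfamily (pres P (\<lambda>x. x)) (1 / (mu + 1)) N (\<lambda>i. basis (e i))"
    unfolding eigenfamily_def orthonormal_upto_def
  proof (intro conjI allI impI)
    fix i j assume "i < N" "j < N"
    show "cip (basis (e i)) (basis (e j)) = (if i = j then 1 else 0)"
      using e by (auto simp: cip_basis inj_eq)
  next
    fix i assume i: "i < N"
    have "1 / (mu + 1) \<le> 1 / (1 + d (e i))" using le[OF i] d0[of "e i"] mu0 by (intro divide_left_mono) auto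
    moreover have "pres P (\<lambda>x. x) (basis (e i)) = (1 / (1 + d (e i))) *\<^sub>R basis (e i)"
      by (rule l2_eqI) (simp add: coord_pres_ident)
    ultimately show "\<exists>t\<ge>1 / (mu + 1). pres P (\<lambda>x. x) (basis (e i)) = t *\<^sub>R basis (e i)" by blast
  qed
  then show ?thesis using mu0 by (intro exI[of _ mu] exI[of _ "\<lambda>i. basis (e i)"]) auto
qed

text \<open>If \<open>mu < Z\<close>, the eigenvectors would all be supported where
  \<open>d < Z\<close>, and \<open>N\<close> orthonormal vectors do not fit on fewer than
  \<open>N\<close> vertices.\<close>

lemma degree_eigenfamily_count:
  assumes fin: "finite {x. \<not> Z \<le> d x}" and N: "card {x. \<not> Z \<le> d x} < N"
    and mu: "0 < mu + 1" and U: "eigenfamily (pres P (\<lambda>x. x)) (1 / (mu + 1)) N U"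
  shows "Z \<le> mu"
proof (rule ccontr)
  assume muZ: "\<not> Z \<le> mu"
  let ?X = "{x. \<not> Z \<le> d x}"
  obtain t where t: "\<And>i. i < N \<Longrightarrow> t i \<ge> 1 / (mu + 1) \<and> pres P (\<lambda>x. x) (U i) = t i *\<^sub>R U i"
    using U unfolding eigenfamily_def by metis
  have supp: "coord (U i) x = 0" if i: "i < N" and x: "x \<notin> ?X" for i x
  proof (rule ccontr)
    assume U0: "coord (U i) x \<noteq> 0"
    have "coord (U i) x / of_real (1 + d x) = of_real (t i) * coord (U i) x"
      using arg_cong[OF conjunct2[OF t[OF i]], of "\<lambda>F. coord F x"] by (simp add: coord_pres_ident)
    then have "complex_of_real (1 / (1 + d x)) * coord (U i) x = of_real (t i) * coord (U i) x" by simp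
    then have "complex_of_real (1 / (1 + d x)) = of_real (t i)" 
      by (rule mult_right_cancel[OF U0, THEN iffD1])
    then have "1 / (1 + d x) = t i" by (simp only: of_real_eq_iff)
    then have "1 / (mu + 1) \<le> 1 / (1 + d x)" using t[OF i] by simp
    then have "1 + d x \<le> mu + 1" using mu d1[of x] by (simp add: divide_le_cancel frac_le_eq divide_simps split: if_splits)
    then show False using x muZ by auto
  qed
  obtain c where c: "\<exists>j\<in>{..<N}. c j \<noteq> 0" "\<forall>x\<in>?X. (\<Sum>j<N. coord (U j) x * c j) = 0"
    using homogeneous_system_nontrivial[OF fin, of "{..<N}" "\<lambda>x j. coord (U j) x"] N by auto
  define f where "f = (\<Sum>j<N. cscale (c j) (U j))"
  have "f = 0"
  proof (rule l2_eqI)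
    fix x
    have "(\<Sum>j<N. c j * coord (U j) x) = 0"
    proof (cases "x \<in> ?X")
      case True
      then show ?thesis using c(2) by (simp add: mult.commute)
    next
      case False
      have "coord (U j) x = 0" if "j \<in> {..<N}" for j by (rule supp[OF _ False]) (use that in simp)
      then show ?thesis by (intro sum.neutral) simp
    qed
    then show "coord f x = coord 0 x" unfolding f_def coord_sum coord_simps .
  qed
  obtain j where j: "j < N" "c j \<noteq> 0" using c(1) by auto
  have cU: "cip (U j) (U i) = (if i = j then 1 else 0)" if "i < N" for i
    using U j(1) that unfolding eigenfamily_def orthonormal_upto_def by auto
  have "cip (U j) f = (\<Sum>i<N. if i = j then c j else 0)"
    unfolding f_def cip_sum_right by (intro sum.cong refl) (auto simp: cU)
  also have "\<dots> = c j" using j(1) by simp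
  finally have "cip (U j) 0 = c j" unfolding \<open>f = 0\<close> .
  then have "c j = 0" unfolding cip_zero_right by (rule sym)
  then show False using j(2) by (rule notE[rotated])
qed

end

context coercive_form
begin

text \<open>The form inequalities compare the two pencils in both directions, up to factors close to
  1 and additive constants; growth of the degree eigenvalues removes the constants from the
  quotient.\<close>

lemma eigenvalue_asymptotics:
  assumes est: "\<And>eps. 0 < eps \<Longrightarrow> \<exists>c\<ge>0. \<forall>F. \<bar>inner (A F) F - ((norm F)\<^sup>2 - (norm (P F))\<^sup>2)\<bar>
      \<le> eps * ((norm F)\<^sup>2 - (norm (P F))\<^sup>2) + c * (norm (P F))\<^sup>2"
    and lim: "filterlim d at_top cofinite" and inf: "infinite (UNIV :: 'a set)"
  shows "(\<lambda>N. eigenvalue_N m (friedrichs m s) N / eigenvalue_N m (mult_op m d) N) \<longlonglongrightarrow> 1"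
proof -
  let ?D = "pres P (\<lambda>x. x)"
  \<comment> \<open>The eigenvalues are the infima of these sets by \<open>eigenvalue_N_eq\<close>,
    so mapping one set into the other by an affine map compares them.\<close>
  define SH where "SH N = {mu. 0 < mu + C \<and> (\<exists>U. eigenfamily T (1 / (mu + C)) N U)}" for N
  define SD where "SD N = {mu. 0 < mu + 1 \<and> (\<exists>U. eigenfamily ?D (1 / (mu + 1)) N U)}" for N
  have EH: "eigenvalue_N m (friedrichs m s) N = Inf (SH N)" if "0 < N" for N
    unfolding friedrichs_eq_opT SH_def by (rule r.eigenvalue_N_eq[OF p.inner_pres_nonneg that])
  have ED: "eigenvalue_N m (mult_op m d) N = Inf (SD N)" if "0 < N" for N
    unfolding mult_op_eq_opT SD_def by (rule rd.eigenvalue_N_eq[OF pd.inner_pres_nonneg that])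
  have ccP: "ccont P" by (rule ccont_P[OF lim])
  have ccT: "ccont T" by (rule p.ccont_pres[OF ccP])
  have ccD: "ccont ?D" by (rule pd.ccont_pres[OF ccP])
  \<comment> \<open>Infinitely many vertices provide \<open>N\<close> orthonormal eigenvectors for
    every \<open>N\<close>; an infimum over an empty set would carry no information.\<close>
  have SD_ne: "SD N \<noteq> {}" for N using degree_eigenfamily_exists[OF inf, of N] unfolding SD_def by blast
  have SD_bd: "bdd_below (SD N)" and SH_bd: "bdd_below (SH N)" for N
    by (rule bdd_belowI[of _ "- 1"], simp add: SD_def) (rule bdd_belowI[of _ "- C"], simp add: SH_def)
  have up: "\<exists>g\<ge>0. \<forall>N. \<forall>mu\<in>SD N. (1 + e) * (mu + 1) + g - C \<in> SH N" if e: "0 < e" for e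
  proof -
    obtain c1 where c1: "0 \<le> c1" "\<And>F. \<bar>inner (A F) F - ((norm F)\<^sup>2 - (norm (P F))\<^sup>2)\<bar>
      \<le> e * ((norm F)\<^sup>2 - (norm (P F))\<^sup>2) + c1 * (norm (P F))\<^sup>2" using est[OF e] by blast
    define g where "g = c1 + \<bar>C\<bar>"
    have g: "0 \<le> g" using c1 by (simp add: g_def)
    have le: "inner (B G) G \<le> (1 + e) * inner G G + g * (norm (P G))\<^sup>2" for G
    proof -
      have "inner (A G) G \<le> (1 + e) * ((norm G)\<^sup>2 - (norm (P G))\<^sup>2) + c1 * (norm (P G))\<^sup>2"
        using c1(2)[of G] by (simp add: abs_le_iff algebra_simps)
      also have "\<dots> \<le> (1 + e) * (norm G)\<^sup>2 + c1 * (norm (P G))\<^sup>2"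
        using e by (intro add_right_mono mult_left_mono) auto
      finally have 1: "inner (A G) G \<le> (1 + e) * (norm G)\<^sup>2 + c1 * (norm (P G))\<^sup>2" .
      have 2: "C * (norm (P G))\<^sup>2 \<le> \<bar>C\<bar> * (norm (P G))\<^sup>2" by (intro mult_right_mono) auto
      have 3: "(c1 + \<bar>C\<bar>) * (norm (P G))\<^sup>2 = c1 * (norm (P G))\<^sup>2 + \<bar>C\<bar> * (norm (P G))\<^sup>2" by (rule distrib_right)
      show ?thesis unfolding inner_B g_def 3 dot_square_norm using 1 2 by linarith
    qed
    have "(1 + e) * (mu + 1) + g - C \<in> SH N" if "mu \<in> SD N" for mu N
    proof -
      obtain U where mu: "0 < mu + 1" and U: "eigenfamily ?D (1 / (mu + 1)) N U" using \<open>mu \<in> SD N\<close> unfolding SD_def by blast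
      have pos: "0 < (1 + e) * (mu + 1) + g" 
        using mult_pos_pos[OF _ mu, of "1 + e"] e g by linarith
      have "\<exists>F. eigenfamily T (1 / ((1 + e) * (mu + 1) + g)) N F"
        by (rule eigenfamily_compare[OF pd.pencil_axioms p.pencil_axioms ccT _ le mu pos U]) (use e in simp)
      then show ?thesis unfolding SH_def using pos by simp
    qed
    then show ?thesis using g by blast
  qed
  have dn: "\<exists>g. \<forall>N. \<forall>mu\<in>SH N. (mu + C) / (1 - e) + g - 1 \<in> SD N" if e: "0 < e" "e < 1" for e
  proof -
    obtain c1 where c1: "0 \<le> c1" "\<And>F. \<bar>inner (A F) F - ((norm F)\<^sup>2 - (norm (P F))\<^sup>2)\<bar>
      \<le> e * ((norm F)\<^sup>2 - (norm (P F))\<^sup>2) + c1 * (norm (P F))\<^sup>2" using est[OF e(1)] by blast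
    \<comment> \<open>Obtained by solving the lower estimate for the squared norm of
      \<open>G\<close>; the summand 1 restores the norm of \<open>P G\<close> that the degree form
      subtracts.\<close>
    define g where "g = 1 + (c1 + \<bar>C\<bar>) / (1 - e)"
    have g: "0 \<le> g" using c1 e by (simp add: g_def)
    have le: "inner G G \<le> (1 / (1 - e)) * inner (B G) G + g * (norm (P G))\<^sup>2" for G
    proof -
      have "(1 - e) * ((norm G)\<^sup>2 - (norm (P G))\<^sup>2) \<le> inner (A G) G + c1 * (norm (P G))\<^sup>2"
        using c1(2)[of G] by (simp add: abs_le_iff algebra_simps)
      also have "\<dots> \<le> inner (B G) G + (c1 + \<bar>C\<bar>) * (norm (P G))\<^sup>2"
      proof -
        have 2: "- C * (norm (P G))\<^sup>2 \<le> \<bar>C\<bar> * (norm (P G))\<^sup>2" by (intro mult_right_mono) auto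
        have 3: "(c1 + \<bar>C\<bar>) * (norm (P G))\<^sup>2 = c1 * (norm (P G))\<^sup>2 + \<bar>C\<bar> * (norm (P G))\<^sup>2" by (rule distrib_right)
        show ?thesis unfolding inner_B 3 using 2 by simp
      qed
      finally have "(norm G)\<^sup>2 - (norm (P G))\<^sup>2 \<le> (inner (B G) G + (c1 + \<bar>C\<bar>) * (norm (P G))\<^sup>2) / (1 - e)"
        using e by (simp add: pos_le_divide_eq mult.commute)
      then show ?thesis unfolding g_def by (simp add: dot_square_norm distrib_right add_divide_distrib)
    qed
    have "(mu + C) / (1 - e) + g - 1 \<in> SD N" if "mu \<in> SH N" for mu N
    proof -
      obtain U where mu: "0 < mu + C" and U: "eigenfamily T (1 / (mu + C)) N U" using \<open>mu \<in> SH N\<close> unfolding SH_def by blast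
      have pos: "0 < 1 / (1 - e) * (mu + C) + g" 
        using mult_pos_pos[OF _ mu, of "1 / (1 - e)"] e g by (intro add_pos_nonneg) auto
      have "\<exists>F. eigenfamily ?D (1 / (1 / (1 - e) * (mu + C) + g)) N F"
        by (rule eigenfamily_compare[OF p.pencil_axioms pd.pencil_axioms ccD _ le mu pos U]) (use e in simp)
      then show ?thesis unfolding SD_def using pos by simp
    qed
    then show ?thesis by blast
  qed
  have SH_ne: "SH N \<noteq> {}" for N using up[of 1] SD_ne[of N] by fastforce
  show ?thesis
  proof (rule ratio_tendsto_1)
    show "filterlim (eigenvalue_N m (mult_op m d)) at_top sequentially"
      unfolding filterlim_at_top
    proof
      fix Z
      have fin: "finite {x. \<not> Z \<le> d x}" using lim unfolding filterlim_at_top eventually_cofinite by blast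
      show "\<forall>\<^sub>F N in sequentially. Z \<le> eigenvalue_N m (mult_op m d) N"
        using eventually_gt_at_top[of "card {x. \<not> Z \<le> d x}"]
      proof eventually_elim
        case (elim N)
        then have N: "0 < N" by simp
        show ?case
          unfolding ED[OF N]
        proof (rule cInf_greatest[OF SD_ne])
          fix mu assume "mu \<in> SD N"
          then show "Z \<le> mu" unfolding SD_def using degree_eigenfamily_count[OF fin elim] by blast
        qed
      qed
    qed
  next
    fix e :: real assume e: "0 < e" "e < 1"
    obtain g1 where g1: "\<And>N mu. mu \<in> SD N \<Longrightarrow> (1 + e) * (mu + 1) + g1 - C \<in> SH N" using up[OF e(1)] by blast
    obtain g2 where g2: "\<And>N mu. mu \<in> SH N \<Longrightarrow> (mu + C) / (1 - e) + g2 - 1 \<in> SD N" using dn[OF e] by blast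
    define g where "g = max ((1 + e) + g1 - C) ((1 - e) * (g2 - 1) + C)"
    have "eigenvalue_N m (friedrichs m s) N \<le> (1 + e) * eigenvalue_N m (mult_op m d) N + g
        \<and> (1 - e) * eigenvalue_N m (mult_op m d) N - g \<le> eigenvalue_N m (friedrichs m s) N" if N: "N > 0" for N
    proof
      have "(Inf (SH N) - ((1 + e) + g1 - C)) / (1 + e) \<le> Inf (SD N)"
      proof (rule cInf_greatest[OF SD_ne])
        fix mu assume "mu \<in> SD N"
        then have "Inf (SH N) \<le> (1 + e) * (mu + 1) + g1 - C" by (intro cInf_lower[OF g1 SH_bd])
        then show "(Inf (SH N) - ((1 + e) + g1 - C)) / (1 + e) \<le> mu"
          using e by (simp add: pos_divide_le_eq algebra_simps)
      qed
      then have "Inf (SH N) \<le> (1 + e) * Inf (SD N) + ((1 + e) + g1 - C)"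
        using e by (simp add: pos_divide_le_eq algebra_simps)
      then show "eigenvalue_N m (friedrichs m s) N \<le> (1 + e) * eigenvalue_N m (mult_op m d) N + g"
        unfolding EH[OF N] ED[OF N] g_def by linarith
      have "(1 - e) * Inf (SD N) - ((1 - e) * (g2 - 1) + C) \<le> Inf (SH N)"
      proof (rule cInf_greatest[OF SH_ne])
        fix mu assume "mu \<in> SH N"
        then have "Inf (SD N) \<le> (mu + C) / (1 - e) + g2 - 1" by (intro cInf_lower[OF g2 SD_bd])
        then have "(1 - e) * Inf (SD N) \<le> (1 - e) * ((mu + C) / (1 - e) + (g2 - 1))"
          using e by (intro mult_left_mono) auto
        also have "\<dots> = mu + C + (1 - e) * (g2 - 1)" 
          unfolding distrib_left[of _ "(mu + C) / (1 - e)"] using e by simp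
        finally show "(1 - e) * Inf (SD N) - ((1 - e) * (g2 - 1) + C) \<le> mu" by simp
      qed
      then show "(1 - e) * eigenvalue_N m (mult_op m d) N - g \<le> eigenvalue_N m (friedrichs m s) N"
        unfolding EH[OF N] ED[OF N] g_def by linarith
    qed
    then show "\<exists>g. \<forall>N>0. eigenvalue_N m (friedrichs m s) N \<le> (1 + e) * eigenvalue_N m (mult_op m d) N + g
        \<and> (1 - e) * eigenvalue_N m (mult_op m d) N - g \<le> eigenvalue_N m (friedrichs m s) N" by blast
  qed
qed

end

section \<open>Choice of constants and assembly\<close>

lemma ccont_minus_commute:
  assumes "ccont (\<lambda>x. S x - T x)"
  shows "ccont (\<lambda>x. T x - S x)"
  unfolding ccont_def
proof (intro allI impI)
  fix f :: "nat \<Rightarrow> 'a l2" assume "wnull f"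
  then have "(\<lambda>n. S (f n) - T (f n)) \<longlonglongrightarrow> 0" using assms unfolding ccont_def by blast
  from tendsto_minus[OF this] show "(\<lambda>n. T (f n) - S (f n)) \<longlonglongrightarrow> 0" by simp
qed

text \<open>The inequality fails at finitely many points only, and the sum of \<open>f\<close> over
  them serves as the constant.\<close>

lemma smallo_cofinite_bound:
  fixes f g :: "'v \<Rightarrow> real"
  assumes o: "f \<in> o[cofinite](g)" and f: "\<And>x. 0 \<le> f x" and g: "\<And>x. 0 \<le> g x" and e: "0 < e"
  shows "\<exists>c\<ge>0. \<forall>x. f x \<le> e * g x + c"
proof -
  have "\<forall>\<^sub>F x in cofinite. norm (f x) \<le> e * norm (g x)" by (rule landau_o.smallD[OF o e])
  then have fin: "finite {x. \<not> f x \<le> e * g x}" using f g by (simp add: eventually_cofinite)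
  let ?c = "\<Sum>x\<in>{x. \<not> f x \<le> e * g x}. f x"
  have c: "0 \<le> ?c" by (intro sum_nonneg f)
  have "f x \<le> e * g x + ?c" for x
  proof (cases "f x \<le> e * g x")
    case False
    then have "f x \<le> ?c" by (intro member_le_sum fin f) auto
    then show ?thesis using mult_nonneg_nonneg[of e "g x"] e g[of x] by linarith
  qed (use c in linarith)
  then show ?thesis using c by blast
qed

context graph_form
begin

text \<open>The estimate leaves at least \<open>1/2\<close> of the squared norm of \<open>F\<close>
  minus \<open>c + 1/2\<close> times that of \<open>P F\<close>. A shift by \<open>c + 1/2\<close>
  would give coercivity; one further unit supplies the term that \<open>sqrt_exists\<close>
  uses.\<close>

lemma form_coercive:
  assumes "\<bar>inner (A F) F - ((norm F)\<^sup>2 - (norm (P F))\<^sup>2)\<bar>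
      \<le> (1/2) * ((norm F)\<^sup>2 - (norm (P F))\<^sup>2) + c * (norm (P F))\<^sup>2" and C: "c + 3/2 \<le> C"
  shows "(1/2) * (norm F)\<^sup>2 + (norm (P F))\<^sup>2 \<le> inner (A F) F + C * (norm (P F))\<^sup>2"
proof -
  have "(c + 3/2) * (norm (P F))\<^sup>2 \<le> C * (norm (P F))\<^sup>2" by (intro mult_right_mono C) simp
  then have 1: "c * (norm (P F))\<^sup>2 + (3/2) * (norm (P F))\<^sup>2 \<le> C * (norm (P F))\<^sup>2"
    unfolding distrib_right .
  have "(1/2) * n + p \<le> a + r" if "\<bar>a - (n - p)\<bar> \<le> (1/2) * (n - p) + q" "q + (3/2) * p \<le> r"
    for n p a r q :: real
    using abs_le_D2[OF that(1)] that(2) by (simp add: field_simps)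
  from this[OF assms(1) 1] show ?thesis .
qed

lemma ell2_norm_P: "f \<in> Cc \<Longrightarrow> ell2_norm m f = norm (P (iota w f))"
  by (simp add: P_iota Cc_ell2 ell2_norm_eq)

lemma Re_form: "f \<in> Cc \<Longrightarrow> Re (s f f) = inner (A (iota w f)) (iota w f)"
  by (simp add: s_eq Re_cip inner_commute)

lemma Re_degree_form:
  assumes f: "f \<in> Cc"
  shows "Re (ell2_ip m f (\<lambda>x. of_real (d x) * f x)) = (norm (iota w f))\<^sup>2 - (norm (P (iota w f)))\<^sup>2"
proof -
  let ?S = "{x. f x \<noteq> 0}"
  have S: "finite ?S" using f by (simp add: Cc_def)
  have fw: "f \<in> ell2 w" and fm: "f \<in> ell2 m" using f by (auto intro: Cc_ell2)
  have "(norm (iota w f))\<^sup>2 = (\<Sum>x\<in>?S. (w x)\<^sup>2 * (cmod (f x))\<^sup>2)"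
    using norm_sq_finite_support[OF S, of "iota w f"] by (simp add: coord_iota fw norm_mult power_mult_distrib)
  moreover have "(norm (P (iota w f)))\<^sup>2 = (\<Sum>x\<in>?S. (m x)\<^sup>2 * (cmod (f x))\<^sup>2)"
    unfolding P_iota[OF fw]
    using norm_sq_finite_support[OF S, of "iota m f"] by (simp add: coord_iota fm norm_mult power_mult_distrib)
  moreover have "ell2_ip m f (\<lambda>x. of_real (d x) * f x) = (\<Sum>x\<in>?S. of_real ((m x)\<^sup>2 * d x * (cmod (f x))\<^sup>2))"
  proof -
    have "ell2_ip m f (\<lambda>x. of_real (d x) * f x) = (\<Sum>\<^sub>\<infinity>x\<in>?S. of_real ((m x)\<^sup>2 * d x * (cmod (f x))\<^sup>2))"
      unfolding ell2_ip_def
    proof (rule infsum_cong_neutral)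
      fix x
      show "of_real ((m x)\<^sup>2) * (cnj (f x) * (of_real (d x) * f x)) = of_real ((m x)\<^sup>2 * d x * (cmod (f x))\<^sup>2)"
        unfolding of_real_mult complex_norm_square by (simp add: mult_ac)
    qed auto
    then show ?thesis using S by simp
  qed
  ultimately show ?thesis
    by (simp add: wsq sum_subtractf[symmetric] algebra_simps del: of_real_mult of_real_power)
qed

end

theorem theorem1p2:
  fixes E0 E :: "'v::countable \<Rightarrow> 'v \<Rightarrow> real"
    and th0 th :: "'v \<Rightarrow> 'v \<Rightarrow> real"
    and m :: "'v \<Rightarrow> real"
    and V :: "'v \<Rightarrow> real"
  assumes tree: "weighted_tree E0 m th0"
    and graph: "weighted_graph E m th"
    and C0: "\<exists>eps0 C0. 0 < eps0 \<and> eps0 < 1 \<and>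
               (\<forall>x y. wdeg E0 m x powr (eps0 - 1) * E0 x y / (m x)\<^sup>2 \<le> C0)"
    and pert: "(\<lambda>x. \<bar>V x\<bar> + Lambda E E0 m x) \<in> o[cofinite](\<lambda>x. 1 + wdeg E0 m x)"
  defines "H \<equiv> friedrichs m (schr_form E m th V)"
    and "D0 \<equiv> friedrichs m (schr_form E0 m th0 (\<lambda>_. 0))"
  shows "\<exists>C::real.
     \<comment> \<open>(a)\<close>
     (\<forall>f\<in>Cc. - C * (ell2_norm m f)\<^sup>2 \<le> Re (schr_form E m th V f f)) \<and>
     \<comment> \<open>(b)\<close>
     (\<forall>eps>0. \<exists>c\<ge>0. \<forall>f\<in>Cc. \<exists>g. H f g \<and>
        (1 - eps) * Re (ell2_ip m f (\<lambda>x. complex_of_real (wdeg E0 m x) * f x))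
            - c * (ell2_norm m f)\<^sup>2 \<le> Re (ell2_ip m f g) \<and>
        Re (ell2_ip m f g) \<le>
          (1 + eps) * Re (ell2_ip m f (\<lambda>x. complex_of_real (wdeg E0 m x) * f x))
            + c * (ell2_norm m f)\<^sup>2) \<and>
     (\<exists>S. op_sqrt m S (op_shift H C) \<and>
        op_dom S = op_dom (mult_op m (\<lambda>x. sqrt (wdeg E0 m x)))) \<and>
     \<comment> \<open>(c)\<close>
     op_ess_spectrum m H = op_ess_spectrum m D0 \<and>
     \<comment> \<open>(d)\<close>
     (op_ess_spectrum m H = {} \<longleftrightarrow> filterlim (wdeg E0 m) at_top cofinite) \<and>
     (filterlim (wdeg E0 m) at_top cofinite \<longrightarrow> infinite (UNIV :: 'v set) \<longrightarrow>
        (\<lambda>N. eigenvalue_N m H N / eigenvalue_N m (mult_op m (wdeg E0 m)) N) \<longlonglongrightarrow> 1)"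
proof -
  define d where "d = wdeg E0 m"
  let ?L = "Lambda E E0 m"
  obtain e0 B0 where e0: "0 < e0" "e0 < 1" and B0: "\<And>x y. wdeg E0 m x powr (e0 - 1) * E0 x y / (m x)\<^sup>2 \<le> B0"
    using C0 by blast
  have graph0: "weighted_graph E0 m th0" using tree by (simp add: weighted_tree_def)
  have graph1: "weighted_graph E0 m th" 
    using graph0 graph unfolding weighted_graph_def by (elim conjE) (intro conjI; assumption)
  have m0: "0 < m x" and E00: "0 \<le> E0 x y" and fin: "finite {y. adj E x y}" and fin0: "finite {y. adj E0 x y}" for x y
    using graph graph0 unfolding weighted_graph_def by blast+
  have d0: "0 \<le> d x" for x unfolding d_def wdeg_def by (intro divide_nonneg_nonneg sum_nonneg E00) simp
  have off: "\<exists>c\<ge>0. \<forall>S (f :: 'v \<Rightarrow> real). finite S \<longrightarrow> (\<Sum>x\<in>S. \<Sum>y\<in>S. E0 x y * (\<bar>f x\<bar> * \<bar>f y\<bar>))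
        \<le> eps * (\<Sum>x\<in>S. d x * (m x)\<^sup>2 * (f x)\<^sup>2) + c * (\<Sum>x\<in>S. (m x)\<^sup>2 * (f x)\<^sup>2)" if eps: "0 < eps" for eps
  proof (rule tree_off_diagonal_bound[OF tree e0 B0 eps])
    fix c assume c: "0 \<le> c" "\<And>S (f :: 'v \<Rightarrow> real). finite S \<Longrightarrow> (\<Sum>x\<in>S. \<Sum>y\<in>S. E0 x y * (\<bar>f x\<bar> * \<bar>f y\<bar>))
        \<le> eps * (\<Sum>x\<in>S. wdeg E0 m x * (m x)\<^sup>2 * (f x)\<^sup>2) + c * (\<Sum>x\<in>S. (m x)\<^sup>2 * (f x)\<^sup>2)"
    show ?thesis unfolding d_def by (intro exI[of _ c] conjI allI impI c)
  qed
  have pertb: "\<exists>c\<ge>0. \<forall>x. \<bar>V x\<bar> + ?L x \<le> eps * (1 + d x) + c" if "0 < eps" for eps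
    by (rule smallo_cofinite_bound[OF pert[folded d_def] _ _ that]) (use d0 in \<open>auto simp: Lambda_nonneg add_nonneg_nonneg\<close>)
  have "\<exists>c\<ge>0. \<forall>x. \<bar>V x\<bar> + ?L x \<le> 1 * (1 + d x) + c" by (rule pertb) simp
  then obtain c1 where c1: "0 \<le> c1" "\<And>x. \<bar>V x\<bar> + ?L x \<le> 1 * (1 + d x) + c1" by blast
  have M0: "\<bar>V x\<bar> + ?L x \<le> (1 + c1) * (1 + d x)" for x
    using c1(2)[of x] mult_nonneg_nonneg[OF c1(1) d0[of x]] by (simp add: algebra_simps)
  \<comment> \<open>The degree of \<open>E\<close> exceeds \<open>d\<close> by at most
    \<open>Lambda\<close>, so twice it plus \<open>\<bar>V\<bar>\<close> is at most
    \<open>2 d\<close> plus twice the quantity bounded in \<open>M0\<close>.\<close>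
  define K where "K = 2 + 2 * (1 + c1)"
  have lim: "((\<lambda>x. (\<bar>V x\<bar> + ?L x) / (1 + d x)) \<longlongrightarrow> 0) cofinite"
    using smalloD_tendsto[OF pert] unfolding d_def .
  have L0: "Lambda E0 E0 m x = 0" for x by (simp add: Lambda_def)
  have pert0: "\<exists>c\<ge>0. \<forall>x. \<bar>0::real\<bar> + Lambda E0 E0 m x \<le> eps * (1 + d x) + c" if "0 < eps" for eps
    using that d0 by (intro exI[of _ 0]) (simp add: L0 add_nonneg_nonneg)
  interpret H: graph_form E m th V d K
  proof
    fix x
    have 1: "wdeg E m x \<le> d x + ?L x" using wdeg_diff_le_Lambda[of m x E E0, OF m0 fin fin0] unfolding d_def by linarith
    have 2: "K * (1 + d x) = 2 * (1 + d x) + 2 * ((1 + c1) * (1 + d x))" by (simp add: K_def algebra_simps)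
    have "2 * a + v \<le> k" if "a \<le> b + l" "k = 2 * (1 + b) + 2 * r" "v + l \<le> r" "0 \<le> v" for a b v k l r :: real
    proof -
      have "2 * a + v \<le> 2 * (b + l) + 2 * v" using that(1,4) by (intro add_mono) auto
      also have "\<dots> = 2 * b + 2 * (v + l)" by simp
      also have "\<dots> \<le> k" unfolding that(2) using that(3) by simp
      finally show ?thesis .
    qed
    from this[OF 1 2 M0] show "2 * wdeg E m x + \<bar>V x\<bar> \<le> K * (1 + d x)" by simp
  qed (rule graph d0)+
  interpret D: graph_form E0 m th0 "\<lambda>_. 0" d 2
    by unfold_locales (use graph0 d0 in \<open>auto simp: d_def\<close>)
  interpret D1: graph_form E0 m th "\<lambda>_. 0" d 2
    by unfold_locales (use graph1 d0 in \<open>auto simp: d_def\<close>)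
  have estH: "\<exists>c\<ge>0. \<forall>F. \<bar>inner (H.A F) F - ((norm F)\<^sup>2 - (norm (H.P F))\<^sup>2)\<bar>
      \<le> eps * ((norm F)\<^sup>2 - (norm (H.P F))\<^sup>2) + c * (norm (H.P F))\<^sup>2" if "0 < eps" for eps
    by (rule H.form_degree_bound[OF graph0 d_def off pertb that])
  have estD: "\<exists>c\<ge>0. \<forall>F. \<bar>inner (D.A F) F - ((norm F)\<^sup>2 - (norm (H.P F))\<^sup>2)\<bar>
      \<le> eps * ((norm F)\<^sup>2 - (norm (H.P F))\<^sup>2) + c * (norm (H.P F))\<^sup>2" if "0 < eps" for eps
    by (rule D.form_degree_bound[OF graph0 d_def off pert0 that])
  have estD1: "\<exists>c\<ge>0. \<forall>F. \<bar>inner (D1.A F) F - ((norm F)\<^sup>2 - (norm (H.P F))\<^sup>2)\<bar>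
      \<le> eps * ((norm F)\<^sup>2 - (norm (H.P F))\<^sup>2) + c * (norm (H.P F))\<^sup>2" if "0 < eps" for eps
    by (rule D1.form_degree_bound[OF graph0 d_def off pert0 that])
  have half: "0 < (1/2 :: real)" by simp
  obtain cH where cH: "\<And>F. \<bar>inner (H.A F) F - ((norm F)\<^sup>2 - (norm (H.P F))\<^sup>2)\<bar>
      \<le> (1/2) * ((norm F)\<^sup>2 - (norm (H.P F))\<^sup>2) + cH * (norm (H.P F))\<^sup>2" using estH[OF half] by blast
  obtain cD where cD: "\<And>F. \<bar>inner (D.A F) F - ((norm F)\<^sup>2 - (norm (H.P F))\<^sup>2)\<bar>
      \<le> (1/2) * ((norm F)\<^sup>2 - (norm (H.P F))\<^sup>2) + cD * (norm (H.P F))\<^sup>2" using estD[OF half] by blast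
  obtain cD1 where cD1: "\<And>F. \<bar>inner (D1.A F) F - ((norm F)\<^sup>2 - (norm (H.P F))\<^sup>2)\<bar>
      \<le> (1/2) * ((norm F)\<^sup>2 - (norm (H.P F))\<^sup>2) + cD1 * (norm (H.P F))\<^sup>2" using estD1[OF half] by blast
  \<comment> \<open>A common shift for all three operators, so that \<open>1 / (l + C)\<close> means
    the same for each; \<open>3/2\<close> is the margin of \<open>form_coercive\<close>.\<close>
  define C where "C = max cH (max cD cD1) + 3/2"
  have C: "cH + 3/2 \<le> C" "cD + 3/2 \<le> C" "cD1 + 3/2 \<le> C" by (auto simp: C_def)
  have coH: "(1/2) * (norm F)\<^sup>2 + (norm (H.P F))\<^sup>2 \<le> inner (H.A F) F + C * (norm (H.P F))\<^sup>2" for F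
    by (rule H.form_coercive[OF cH C(1)])
  have coD: "(1/2) * (norm F)\<^sup>2 + (norm (H.P F))\<^sup>2 \<le> inner (D.A F) F + C * (norm (H.P F))\<^sup>2" for F
    by (rule D.form_coercive[OF cD C(2)])
  have coD1: "(1/2) * (norm F)\<^sup>2 + (norm (H.P F))\<^sup>2 \<le> inner (D1.A F) F + C * (norm (H.P F))\<^sup>2" for F
    by (rule D1.form_coercive[OF cD1 C(3)])
  \<comment> \<open>The locale takes only the coercive part; the extra square is kept in
    \<open>coH\<close> for the square root.\<close>
  have dropsq: "a + b\<^sup>2 \<le> r \<Longrightarrow> a \<le> r" for a b r :: real using zero_le_power2[of b] by linarith
  interpret H: coercive_form E m th V d K C "1/2"
    by unfold_locales (simp, rule dropsq[OF coH])
  interpret D: coercive_form E0 m th0 "\<lambda>_. 0" d 2 C "1/2"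
    by unfold_locales (simp, rule dropsq[OF coD])
  interpret D1: coercive_form E0 m th "\<lambda>_. 0" d 2 C "1/2"
    by unfold_locales (simp, rule dropsq[OF coD1])
  have a: "- C * (ell2_norm m f)\<^sup>2 \<le> Re (schr_form E m th V f f)" if f: "f \<in> Cc" for f
  proof -
    have "0 \<le> (1/2) * (norm (iota H.w f))\<^sup>2" by simp
    then show ?thesis
      unfolding H.ell2_norm_P[OF f] H.Re_form[OF f] using H.coer[of "iota H.w f"] by linarith
  qed
  have b: "\<exists>c\<ge>0. \<forall>f\<in>Cc. \<exists>g. H f g \<and>
        (1 - eps) * Re (ell2_ip m f (\<lambda>x. complex_of_real (wdeg E0 m x) * f x))
            - c * (ell2_norm m f)\<^sup>2 \<le> Re (ell2_ip m f g) \<and>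
        Re (ell2_ip m f g) \<le>
          (1 + eps) * Re (ell2_ip m f (\<lambda>x. complex_of_real (wdeg E0 m x) * f x))
            + c * (ell2_norm m f)\<^sup>2" if eps: "0 < eps" for eps
  proof -
    obtain c where c: "0 \<le> c" "\<And>F. \<bar>inner (H.A F) F - ((norm F)\<^sup>2 - (norm (H.P F))\<^sup>2)\<bar>
      \<le> eps * ((norm F)\<^sup>2 - (norm (H.P F))\<^sup>2) + c * (norm (H.P F))\<^sup>2" using estH[OF eps] by blast
    show ?thesis
    proof (intro exI[of _ c] conjI ballI)
      fix f :: "'v \<Rightarrow> complex" assume f: "f \<in> Cc"
      obtain g where g: "friedrichs m (schr_form E m th V) f g" "ell2_ip m f g = schr_form E m th V f f"
        using H.friedrichs_Cc[OF f] by blast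
      let ?F = "iota H.w f"
      have D: "Re (ell2_ip m f (\<lambda>x. complex_of_real (wdeg E0 m x) * f x)) = (norm ?F)\<^sup>2 - (norm (H.P ?F))\<^sup>2"
        using H.Re_degree_form[OF f] unfolding d_def .
      have bounds: "(1 - eps) * t - r \<le> u \<and> u \<le> (1 + eps) * t + r" if "\<bar>u - t\<bar> \<le> eps * t + r" for u t r :: real
        using that by (simp add: algebra_simps abs_le_iff)
      show "\<exists>g. H f g \<and>
        (1 - eps) * Re (ell2_ip m f (\<lambda>x. complex_of_real (wdeg E0 m x) * f x))
            - c * (ell2_norm m f)\<^sup>2 \<le> Re (ell2_ip m f g) \<and>
        Re (ell2_ip m f g) \<le>
          (1 + eps) * Re (ell2_ip m f (\<lambda>x. complex_of_real (wdeg E0 m x) * f x))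
            + c * (ell2_norm m f)\<^sup>2"
        unfolding D H.ell2_norm_P[OF f]
        by (rule exI[of _ g], unfold g(2) H.Re_form[OF f], intro conjI)
          (use g(1) bounds[OF c(2)[of ?F]] in \<open>auto simp: H_def\<close>)
    qed (rule c(1))
  qed
  have sqrt: "\<exists>S. op_sqrt m S (op_shift H C) \<and> op_dom S = op_dom (mult_op m (\<lambda>x. sqrt (wdeg E0 m x)))"
  proof -
    have "(norm (H.P F))\<^sup>2 \<le> inner (H.B F) F" for F
      unfolding H.inner_B using coH[of F] zero_le_power2[of "norm F"] by linarith
    from H.sqrt_exists[OF this] show ?thesis unfolding H_def d_def .
  qed
  have ess: "op_ess_spectrum m H = op_ess_spectrum m D0"
  proof -
    have "ccont (\<lambda>F. H.A F - D1.A F)"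
      by (rule ccont_form_difference[OF H.graph_form_axioms D1.graph_form_axioms M0 lim])
    then have "ccont (\<lambda>F. H.B F - D1.B F)" by (simp add: H.B_def D1.B_def)
    then have cc: "ccont (\<lambda>x. D1.T x - H.T x)"
      by (rule ccont_pres_diff[OF D1.p.pencil_axioms H.p.pencil_axioms])
    \<comment> \<open>The gauge lemma transfers Weyl sequences in one direction, so each direction
      gets its own phase, \<open>u\<close> from \<open>th0\<close> to \<open>th\<close> and
      \<open>v\<close> back.\<close>
    obtain u where u: "\<And>x. cmod (u x) = 1" "\<And>x y. adj E0 x y \<Longrightarrow> u x = cis (th x y - th0 x y) * u y"
    proof (rule tree_gauge[OF tree, of "\<lambda>x y. th x y - th0 x y"])
      show "th x y - th0 x y = - (th y x - th0 y x)" for x y using H.th_anti[of x y] D.th_anti[of x y] by simp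
    qed (rule that)
    obtain v where v: "\<And>x. cmod (v x) = 1" "\<And>x y. adj E0 x y \<Longrightarrow> v x = cis (th0 x y - th x y) * v y"
    proof (rule tree_gauge[OF tree, of "\<lambda>x y. th0 x y - th x y"])
      show "th0 x y - th x y = - (th0 y x - th y x)" for x y using H.th_anti[of x y] D.th_anti[of x y] by simp
    qed (rule that)
    have "weyl H.T t \<longleftrightarrow> weyl D.T t" for t
    proof
      assume "weyl H.T t"
      then have 1: "weyl D1.T t" by (rule weyl_perturb[OF ccont_minus_commute[OF cc]])
      show "weyl D.T t"
        by (rule weyl_gauge[OF D1.coercive_form_axioms D.coercive_form_axioms v 1])
    next
      assume 0: "weyl D.T t"
      have "weyl D1.T t"
        by (rule weyl_gauge[OF D.coercive_form_axioms D1.coercive_form_axioms u 0])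
      then show "weyl H.T t" by (rule weyl_perturb[OF cc])
    qed
    then show ?thesis
      unfolding H_def D0_def H.friedrichs_eq_opT D.friedrichs_eq_opT
      by (intro set_eqI) (simp only: H.r.ess_spectrum_iff_weyl D.r.ess_spectrum_iff_weyl)
  qed
  have empty: "op_ess_spectrum m H = {} \<longleftrightarrow> filterlim (wdeg E0 m) at_top cofinite"
    using H.ess_spectrum_empty_iff_degree unfolding H_def d_def .
  have asym: "(\<lambda>N. eigenvalue_N m H N / eigenvalue_N m (mult_op m (wdeg E0 m)) N) \<longlonglongrightarrow> 1"
    if "filterlim (wdeg E0 m) at_top cofinite" "infinite (UNIV :: 'v set)"
    using H.eigenvalue_asymptotics[OF estH that(1)[folded d_def] that(2)] unfolding H_def d_def .
  show ?thesis using a b sqrt ess empty asym by (intro exI[of _ C] conjI) auto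
qed

end
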